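(* Let $T=(T_1,\ldots,T_n)$ be a commuting row contraction on a Hilbert space $\mathcal H$ whose characteristic function is a polynomial of degree $m$. Put $$\mathcal M=\overline{\mathrm{span}}\{T^{\alpha}D_{T^*}h:h\in\mathcal H,\ \alpha\in\mathbb Z_+^n,\ |\alpha|\ge m\},$$ $$\mathcal H_{nil}=\overline{\mathrm{span}}\{T^{\alpha}D_{T^*}h:h\in\mathcal H,\ \alpha\in\mathbb Z_+^n\}\ominus\mathcal M,$$ $$\mathcal H_c=\Big\{h\in\mathcal H:\sum_{|\alpha|=k}\gamma_\alpha\|T^{*\alpha}h\|^2=\|h\|^2\ \text{for all }k\in\mathbb Z_+\Big\}.$$ Then $\mathcal H=\mathcal M\oplus\mathcal H_{nil}\oplus\mathcal H_c$, and with respect to this decomposition each $T_i$, $i=1,\ldots,n$, has the form $$T_i=\begin{bmatrix}M_i&*&*\\0&N_i&*\\0&0&W_i\end{bmatrix},$$ where $M=(M_1,\ldots,M_n)$ on $\mathcal M$ is a pure row contraction, $N=(N_1,\ldots,N_n)$ on $\mathcal H_{nil}$ is a commuting nilpotent tuple of order less than or equal to $m$, and $W=(W_1,\ldots,W_n)$ on $\mathcal H_c$ is a commuting spherical co-isometry. Moreover, $$\sum_{i=1}^nM_iM_i^*=I_{\mathcal M}-P_{\mathcal N},\qquad\text{where }\ \mathcal N=\mathcal M\ominus\Big(\sum_{i=1}^nT_i\mathcal M\Big).$$ If, in addition, $M$ is regular, then $M$ is a Drury–Arveson shift.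
   Context: $\mathbb Z_+=\{0,1,2,\ldots\}$; for $\alpha\in\mathbb Z_+^n$, $|\alpha|=\sum_i\alpha_i$, $\gamma_\alpha=|\alpha|!/\alpha!$, $T^\alpha=T_1^{\alpha_1}\cdots T_n^{\alpha_n}$, $T^{*\alpha}=T_1^{*\alpha_1}\cdots T_n^{*\alpha_n}$. $\mathbb B^n$ is the open unit ball of $\mathbb C^n$; $P_{\mathcal N}$ is the orthogonal projection onto $\mathcal N$. A commuting row contraction on $\mathcal H$ is an $n$-tuple $T=(T_1,\ldots,T_n)$ of pairwise commuting bounded operators on $\mathcal H$ with $\sum_{i=1}^nT_iT_i^*\le I_{\mathcal H}$; $T$ also denotes the row operator $\mathcal H^n\to\mathcal H$, $(h_1,\ldots,h_n)\mapsto\sum_iT_ih_i$. It is pure if $\lim_{k\to\infty}\sum_{|\alpha|=k}\gamma_\alpha\|T^{*\alpha}h\|^2=0$ for all $h$. A tuple $X$ is a spherical co-isometry if $\sum_iX_iX_i^*=I$. A commuting tuple $N$ is nilpotent of order $\le m$ if $N^\alpha=0$ for all $|\alpha|=m$ (for $m=0$ this means $\mathcal H_{nil}=\{0\}$). Defect operators: $D_T=(I-T^*T)^{1/2}\in\mathcal B(\mathcal H^n)$, $D_{T^*}=(I-TT^* )^{1/2}\in\mathcal B(\mathcal H)$; defect spaces: $\mathcal D_T=\overline{\mathrm{ran}}\,D_T$, $\mathcal D_{T^*}=\overline{\mathrm{ran}}\,D_{T^*}$. The characteristic function of $T$ is the analytic function $\theta_T:\mathbb B^n\to\mathcal B(\mathcal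 D_T,\mathcal D_{T^*})$, $$\theta_T(z)=\Big(-T+D_{T^*}\big(I_{\mathcal H}-\sum_{i=1}^nz_iT_i^*\big)^{-1}ZD_T\Big)\Big|_{\mathcal D_T},$$ with $Z=(z_1I_{\mathcal H},\ldots,z_nI_{\mathcal H}):\mathcal H^n\to\mathcal H$. Write its Taylor expansion as $\theta_T(z)=\sum_\alpha\theta_{T,\alpha}z^\alpha$. For $m\ge1$, $\theta_T$ is a polynomial of degree $m$ if $\theta_{T,\alpha}\ne0$ for some $|\alpha|=m$ and $\theta_{T,\beta}=0$ for all $|\beta|>m$; it is a polynomial of degree $0$ if it is constant (the zero polynomial has degree $0$). A commuting $n$-tuple $X$ of bounded operators on a Hilbert space $\mathcal K$ is regular if there is $\epsilon>0$ such that for every $z\in\mathbb C^n$ with $\|z\|<\epsilon$ the subspace $(X-Z)\mathcal K^n:=\{\sum_i(X_i-z_iI)k_i:k_i\in\mathcal K\}$ is closed and $\mathcal K$ is the algebraic direct sum of $(X-Z)\mathcal K^n$ and $\mathcal K\ominus\sum_iX_i\mathcal K$. A commuting tuple is a Drury–Arveson shift if for some Hilbert space $\mathcal W$ it is unitarily equivalent to $(M_{z_1},\ldots,M_{z_n})$ (multiplication by the coordinates) on $H^2_n(\mathcal W)$, the space of power series $\sum_\alpha a_\alpha z^\alpha$, $a_\alpha\in\mathcal W$, with $\sum_\alpha\|a_\alpha\|^2/\gamma_\alpha<\infty$. *)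

theory Defs
  imports "HOL-Analysis.Analysis"
begin

section \<open>Complex Hilbert spaces\<close>

text \<open>Completeness, the norm and the topology come from the underlying real inner product space,
  whose inner product is the real part of the complex one. The complex inner product is linear in
  its first argument.\<close>

class complex_hilbert = real_inner + complete_space +
  fixes scaleC :: "complex \<Rightarrow> 'a \<Rightarrow> 'a" (infixr "*\<^sub>C" 75)
    and cinner :: "'a \<Rightarrow> 'a \<Rightarrow> complex"
  assumes scaleC_add_right: "c *\<^sub>C (x + y) = c *\<^sub>C x + c *\<^sub>C y"
    and scaleC_add_left: "(c + d) *\<^sub>C x = c *\<^sub>C x + d *\<^sub>C x"
    and scaleC_scaleC: "c *\<^sub>C d *\<^sub>C x = (c * d) *\<^sub>C x"
    and scaleC_of_real: "complex_of_real r *\<^sub>C x = r *\<^sub>R x"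
    and cinner_commute: "cinner x y = cnj (cinner y x)"
    and cinner_add_left: "cinner (x + y) z = cinner x z + cinner y z"
    and cinner_scaleC_left: "cinner (c *\<^sub>C x) y = c * cinner x y"
    and inner_eq_Re_cinner: "inner x y = Re (cinner x y)"

lemma scaleC_one: "1 *\<^sub>C x = (x :: 'a::complex_hilbert)"
  using scaleC_of_real[of 1 x] by simp

interpretation complex_vector: vector_space "scaleC :: complex \<Rightarrow> 'a \<Rightarrow> 'a::complex_hilbert"
  by unfold_locales (simp_all add: scaleC_add_right scaleC_add_left scaleC_scaleC scaleC_one)

instantiation complex :: complex_hilbert
begin

definition scaleC_complex :: "complex \<Rightarrow> complex \<Rightarrow> complex" where
  "scaleC_complex c x = c * x"

definition cinner_complex :: "complex \<Rightarrow> complex \<Rightarrow> complex" where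
  "cinner_complex x y = x * cnj y"

instance
  by standard (simp_all add: scaleC_complex_def cinner_complex_def algebra_simps
      scaleR_conv_of_real inner_complex_def)

end

text \<open>The Hilbert space \<open>H\<^sup>n\<close>, i.e. the direct sum of finitely many copies of \<open>H\<close>.\<close>

instantiation vec :: (complex_hilbert, finite) complex_hilbert
begin

definition scaleC_vec :: "complex \<Rightarrow> 'a ^ 'b \<Rightarrow> 'a ^ 'b" where
  "scaleC_vec c x = (\<chi> i. c *\<^sub>C (x $ i))"

definition cinner_vec :: "'a ^ 'b \<Rightarrow> 'a ^ 'b \<Rightarrow> complex" where
  "cinner_vec x y = (\<Sum>i\<in>UNIV. cinner (x $ i) (y $ i))"

instance
proof
  fix c d :: complex and r :: real and x y z :: "'a ^ 'b"
  show "c *\<^sub>C (x + y) = c *\<^sub>C x + c *\<^sub>C y"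
    by (simp add: scaleC_vec_def vec_eq_iff scaleC_add_right)
  show "(c + d) *\<^sub>C x = c *\<^sub>C x + d *\<^sub>C x"
    by (simp add: scaleC_vec_def vec_eq_iff scaleC_add_left)
  show "c *\<^sub>C d *\<^sub>C x = (c * d) *\<^sub>C x"
    by (simp add: scaleC_vec_def vec_eq_iff scaleC_scaleC)
  show "complex_of_real r *\<^sub>C x = r *\<^sub>R x"
    by (simp add: scaleC_vec_def vec_eq_iff scaleC_of_real)
  show "cinner x y = cnj (cinner y x)"
    unfolding cinner_vec_def cnj_sum by (rule sum.cong) (auto intro: cinner_commute)
  show "cinner (x + y) z = cinner x z + cinner y z"
    by (simp add: cinner_vec_def cinner_add_left sum.distrib)
  show "cinner (c *\<^sub>C x) y = c * cinner x y"
    by (simp add: cinner_vec_def scaleC_vec_def cinner_scaleC_left sum_distrib_left)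
  show "inner x y = Re (cinner x y)"
    by (simp add: cinner_vec_def inner_vec_def inner_eq_Re_cinner)
qed

end

section \<open>Subspaces and operators\<close>

text \<open>A Hilbert space is either a whole type or a closed complex subspace \<open>S\<close> of one. An operator
  on \<open>S\<close> is a function of which only the values on \<open>S\<close> matter.\<close>

definition closed_csubspace :: "'a::complex_hilbert set \<Rightarrow> bool" where
  "closed_csubspace S \<longleftrightarrow> complex_vector.subspace S \<and> closed S"

definition closed_cspan :: "'a::complex_hilbert set \<Rightarrow> 'a set" where
  "closed_cspan A = closure (complex_vector.span A)"

definition ominus :: "'a::complex_hilbert set \<Rightarrow> 'a set \<Rightarrow> 'a set" (infixl "\<ominus>" 65) where
  "A \<ominus> B = {x \<in> A. \<forall>y\<in>B. cinner x y = 0}"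

definition proj :: "'a::complex_hilbert set \<Rightarrow> 'a \<Rightarrow> 'a" where
  "proj S x = (THE y. y \<in> S \<and> (\<forall>u\<in>S. cinner (x - y) u = 0))"

definition orthogonal_direct_sum3 ::
    "'a::complex_hilbert set \<Rightarrow> 'a set \<Rightarrow> 'a set \<Rightarrow> 'a set \<Rightarrow> bool" where
  "orthogonal_direct_sum3 H A B C \<longleftrightarrow>
     closed_csubspace A \<and> closed_csubspace B \<and> closed_csubspace C \<and>
     (\<forall>a\<in>A. \<forall>b\<in>B. cinner a b = 0) \<and> (\<forall>a\<in>A. \<forall>c\<in>C. cinner a c = 0) \<and>
     (\<forall>b\<in>B. \<forall>c\<in>C. cinner b c = 0) \<and>
     H = {a + b + c |a b c. a \<in> A \<and> b \<in> B \<and> c \<in> C}"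

definition bounded_clinear_on ::
    "'a::complex_hilbert set \<Rightarrow> ('a \<Rightarrow> 'b::complex_hilbert) \<Rightarrow> bool" where
  "bounded_clinear_on S A \<longleftrightarrow>
     (\<forall>x\<in>S. \<forall>y\<in>S. A (x + y) = A x + A y) \<and> (\<forall>c. \<forall>x\<in>S. A (c *\<^sub>C x) = c *\<^sub>C A x) \<and>
     (\<exists>K. \<forall>x\<in>S. norm (A x) \<le> K * norm x)"

text \<open>The adjoint of an operator with domain \<open>S\<close>.\<close>

definition adjoint_on ::
    "'a::complex_hilbert set \<Rightarrow> ('a \<Rightarrow> 'b::complex_hilbert) \<Rightarrow> 'b \<Rightarrow> 'a" where
  "adjoint_on S A y = (THE z. z \<in> S \<and> (\<forall>x\<in>S. cinner (A x) y = cinner x z))"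

abbreviation adj :: "('a::complex_hilbert \<Rightarrow> 'b::complex_hilbert) \<Rightarrow> 'b \<Rightarrow> 'a" where
  "adj \<equiv> adjoint_on UNIV"

definition positive_on :: "'a::complex_hilbert set \<Rightarrow> ('a \<Rightarrow> 'a) \<Rightarrow> bool" where
  "positive_on S A \<longleftrightarrow> (\<forall>x\<in>S. cinner (A x) x \<in> \<real>\<^sub>\<ge>\<^sub>0)"

definition op_sqrt :: "('a::complex_hilbert \<Rightarrow> 'a) \<Rightarrow> 'a \<Rightarrow> 'a" where
  "op_sqrt A = (THE B. bounded_clinear_on UNIV B \<and> positive_on UNIV B \<and> B \<circ> B = A)"

section \<open>Multi-indices\<close>

definition mi_size :: "('n::finite \<Rightarrow> nat) \<Rightarrow> nat" where
  "mi_size \<alpha> = (\<Sum>i\<in>UNIV. \<alpha> i)"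

definition mi_gamma :: "('n::finite \<Rightarrow> nat) \<Rightarrow> real" where
  "mi_gamma \<alpha> = fact (mi_size \<alpha>) / (\<Prod>i\<in>UNIV. fact (\<alpha> i))"

definition mi_power :: "complex ^ 'n::finite \<Rightarrow> ('n \<Rightarrow> nat) \<Rightarrow> complex" where
  "mi_power z \<alpha> = (\<Prod>i\<in>UNIV. (z $ i) ^ \<alpha> i)"

text \<open>The factors are composed in the order of the index type, smallest index leftmost.\<close>

definition op_power ::
    "('n::{finite,linorder} \<Rightarrow> 'a \<Rightarrow> 'a) \<Rightarrow> ('n \<Rightarrow> nat) \<Rightarrow> 'a \<Rightarrow> 'a" where
  "op_power X \<alpha> = foldr (\<lambda>i f. (X i ^^ \<alpha> i) \<circ> f) (sorted_list_of_set UNIV) id"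

section \<open>Tuples of operators\<close>

definition commuting_tuple ::
    "'a::complex_hilbert set \<Rightarrow> ('n::finite \<Rightarrow> 'a \<Rightarrow> 'a) \<Rightarrow> bool" where
  "commuting_tuple S X \<longleftrightarrow>
     (\<forall>i. bounded_clinear_on S (X i) \<and> X i ` S \<subseteq> S) \<and>
     (\<forall>i j. \<forall>x\<in>S. X i (X j x) = X j (X i x))"

definition row_square ::
    "'a::complex_hilbert set \<Rightarrow> ('n::finite \<Rightarrow> 'a \<Rightarrow> 'a) \<Rightarrow> 'a \<Rightarrow> 'a" where
  "row_square S X x = (\<Sum>i\<in>UNIV. X i (adjoint_on S (X i) x))"

definition commuting_row_contraction ::
    "'a::complex_hilbert set \<Rightarrow> ('n::finite \<Rightarrow> 'a \<Rightarrow> 'a) \<Rightarrow> bool" where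
  "commuting_row_contraction S X \<longleftrightarrow>
     commuting_tuple S X \<and> positive_on S (\<lambda>x. x - row_square S X x)"

definition adjoint_mass ::
    "'a::complex_hilbert set \<Rightarrow> ('n::{finite,linorder} \<Rightarrow> 'a \<Rightarrow> 'a) \<Rightarrow> nat \<Rightarrow> 'a \<Rightarrow> real" where
  "adjoint_mass S X k h =
     (\<Sum>\<alpha> | mi_size \<alpha> = k. mi_gamma \<alpha> * (norm (op_power (\<lambda>i. adjoint_on S (X i)) \<alpha> h))\<^sup>2)"

definition pure ::
    "'a::complex_hilbert set \<Rightarrow> ('n::{finite,linorder} \<Rightarrow> 'a \<Rightarrow> 'a) \<Rightarrow> bool" where
  "pure S X \<longleftrightarrow> (\<forall>h\<in>S. (\<lambda>k. adjoint_mass S X k h) \<longlonglongrightarrow> 0)"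

definition spherical_coisometry ::
    "'a::complex_hilbert set \<Rightarrow> ('n::finite \<Rightarrow> 'a \<Rightarrow> 'a) \<Rightarrow> bool" where
  "spherical_coisometry S X \<longleftrightarrow> (\<forall>x\<in>S. row_square S X x = x)"

definition nilpotent_le ::
    "'a::complex_hilbert set \<Rightarrow> ('n::{finite,linorder} \<Rightarrow> 'a \<Rightarrow> 'a) \<Rightarrow> nat \<Rightarrow> bool" where
  "nilpotent_le S X m \<longleftrightarrow> (\<forall>\<alpha>. mi_size \<alpha> = m \<longrightarrow> (\<forall>x\<in>S. op_power X \<alpha> x = 0))"

definition tuple_range ::
    "'a::complex_hilbert set \<Rightarrow> ('n::finite \<Rightarrow> 'a \<Rightarrow> 'a) \<Rightarrow> 'a set" where
  "tuple_range S X = {\<Sum>i\<in>UNIV. X i (k i) |k. \<forall>i. k i \<in> S}"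

definition regular ::
    "'a::complex_hilbert set \<Rightarrow> ('n::finite \<Rightarrow> 'a \<Rightarrow> 'a) \<Rightarrow> bool" where
  "regular S X \<longleftrightarrow>
     (\<exists>\<epsilon>>0. \<forall>z :: complex ^ 'n. norm z < \<epsilon> \<longrightarrow>
        (let R = tuple_range S (\<lambda>i x. X i x - (z $ i) *\<^sub>C x);
             E = S \<ominus> tuple_range S X
         in closed R \<and> R \<inter> E = {0} \<and> S = {r + e |r e. r \<in> R \<and> e \<in> E}))"

text \<open>The diagonal entries of an operator matrix: the compressions to \<open>S\<close>.\<close>

definition compression ::
    "'a::complex_hilbert set \<Rightarrow> ('n \<Rightarrow> 'a \<Rightarrow> 'a) \<Rightarrow> 'n \<Rightarrow> 'a \<Rightarrow> 'a" where
  "compression S X i x = proj S (X i x)"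

section \<open>The Drury--Arveson shift\<close>

text \<open>A power series is represented by its family of coefficients.\<close>

definition DA_space :: "'w::complex_hilbert set \<Rightarrow> (('n::finite \<Rightarrow> nat) \<Rightarrow> 'w) set" where
  "DA_space W = {a. range a \<subseteq> W \<and> (\<lambda>\<alpha>. (norm (a \<alpha>))\<^sup>2 / mi_gamma \<alpha>) summable_on UNIV}"

definition DA_cinner ::
    "(('n::finite \<Rightarrow> nat) \<Rightarrow> 'w::complex_hilbert) \<Rightarrow> (('n \<Rightarrow> nat) \<Rightarrow> 'w) \<Rightarrow> complex" where
  "DA_cinner a b = (\<Sum>\<^sub>\<infinity>\<alpha>. cinner (a \<alpha>) (b \<alpha>) / complex_of_real (mi_gamma \<alpha>))"

definition DA_mult ::
    "'n \<Rightarrow> (('n::finite \<Rightarrow> nat) \<Rightarrow> 'w::complex_hilbert) \<Rightarrow> ('n \<Rightarrow> nat) \<Rightarrow> 'w" where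
  "DA_mult i a = (\<lambda>\<beta>. if \<beta> i = 0 then 0 else a (\<beta>(i := \<beta> i - 1)))"

text \<open>The coefficient space \<open>W\<close> may be taken inside the type carrying \<open>X\<close>: a unitary from \<open>S\<close> onto
  the space over \<open>W\<close> identifies \<open>W\<close>, as the space of constants, with a closed subspace of \<open>S\<close>.\<close>

definition Drury_Arveson_shift ::
    "'a::complex_hilbert set \<Rightarrow> ('n::finite \<Rightarrow> 'a \<Rightarrow> 'a) \<Rightarrow> bool" where
  "Drury_Arveson_shift S X \<longleftrightarrow>
     (\<exists>(W :: 'a set) (U :: 'a \<Rightarrow> ('n \<Rightarrow> nat) \<Rightarrow> 'a).
        closed_csubspace W \<and> bij_betw U S (DA_space W) \<and>
        (\<forall>x\<in>S. \<forall>y\<in>S. U (x + y) = (\<lambda>\<alpha>. U x \<alpha> + U y \<alpha>)) \<and>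
        (\<forall>c. \<forall>x\<in>S. U (c *\<^sub>C x) = (\<lambda>\<alpha>. c *\<^sub>C U x \<alpha>)) \<and>
        (\<forall>x\<in>S. \<forall>y\<in>S. DA_cinner (U x) (U y) = cinner x y) \<and>
        (\<forall>i. \<forall>x\<in>S. U (X i x) = DA_mult i (U x)))"

section \<open>The characteristic function\<close>

definition row_op ::
    "('n::finite \<Rightarrow> 'a::complex_hilbert \<Rightarrow> 'a) \<Rightarrow> 'a ^ 'n \<Rightarrow> 'a" where
  "row_op T h = (\<Sum>i\<in>UNIV. T i (h $ i))"

definition defect_op ::
    "('n::finite \<Rightarrow> 'a::complex_hilbert \<Rightarrow> 'a) \<Rightarrow> 'a ^ 'n \<Rightarrow> 'a ^ 'n" where
  "defect_op T = op_sqrt (\<lambda>h. h - adj (row_op T) (row_op T h))"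

definition defect_op_star ::
    "('n::finite \<Rightarrow> 'a::complex_hilbert \<Rightarrow> 'a) \<Rightarrow> 'a \<Rightarrow> 'a" where
  "defect_op_star T = op_sqrt (\<lambda>h. h - row_op T (adj (row_op T) h))"

definition defect_space ::
    "('n::finite \<Rightarrow> 'a::complex_hilbert \<Rightarrow> 'a) \<Rightarrow> ('a ^ 'n) set" where
  "defect_space T = closure (range (defect_op T))"

definition defect_space_star ::
    "('n::finite \<Rightarrow> 'a::complex_hilbert \<Rightarrow> 'a) \<Rightarrow> 'a set" where
  "defect_space_star T = closure (range (defect_op_star T))"

text \<open>The values are meant as operators on \<^term>\<open>defect_space T\<close>, for \<open>z\<close> in the open unit ball;
  there the inverted function is a bijection.\<close>

definition char_fun ::
    "('n::finite \<Rightarrow> 'a::complex_hilbert \<Rightarrow> 'a) \<Rightarrow> complex ^ 'n \<Rightarrow> 'a ^ 'n \<Rightarrow> 'a" where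
  "char_fun T z h =
     - row_op T h +
     defect_op_star T
       (inv (\<lambda>x. x - (\<Sum>i\<in>UNIV. (z $ i) *\<^sub>C adj (T i) x))
          (\<Sum>i\<in>UNIV. (z $ i) *\<^sub>C (defect_op T h $ i)))"

text \<open>The family \<open>c\<close> consists of the Taylor coefficients at \<open>0\<close> of a function \<open>f\<close> from the open unit
  ball to the bounded operators from \<open>D\<close> to \<open>E\<close>. The power series converges unconditionally in
  operator norm, i.e. uniformly on the unit ball of \<open>D\<close>.\<close>

definition Taylor_coeffs ::
    "'b::complex_hilbert set \<Rightarrow> 'a::complex_hilbert set \<Rightarrow> (complex ^ 'n::finite \<Rightarrow> 'b \<Rightarrow> 'a) \<Rightarrow>
     (('n \<Rightarrow> nat) \<Rightarrow> 'b \<Rightarrow> 'a) \<Rightarrow> bool" where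
  "Taylor_coeffs D E f c \<longleftrightarrow>
     (\<forall>\<alpha>. bounded_clinear_on D (c \<alpha>) \<and> c \<alpha> ` D \<subseteq> E) \<and>
     (\<forall>z\<in>ball 0 1. uniform_limit {x \<in> D. norm x \<le> 1}
        (\<lambda>F x. \<Sum>\<alpha>\<in>F. mi_power z \<alpha> *\<^sub>C c \<alpha> x) (f z) (finite_subsets_at_top UNIV))"

text \<open>For \<open>m = 0\<close> this says that \<open>f\<close> is constant, possibly zero.\<close>

definition polynomial_of_degree ::
    "'b::complex_hilbert set \<Rightarrow> 'a::complex_hilbert set \<Rightarrow> (complex ^ 'n::finite \<Rightarrow> 'b \<Rightarrow> 'a) \<Rightarrow>
     nat \<Rightarrow> bool" where
  "polynomial_of_degree D E f m \<longleftrightarrow>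
     (\<exists>c. Taylor_coeffs D E f c \<and>
        (\<forall>\<beta>. mi_size \<beta> > m \<longrightarrow> (\<forall>x\<in>D. c \<beta> x = 0)) \<and>
        (m \<ge> 1 \<longrightarrow> (\<exists>\<alpha>. mi_size \<alpha> = m \<and> (\<exists>x\<in>D. c \<alpha> x \<noteq> 0))))"

section \<open>The three summands\<close>

definition shift_part ::
    "('n::{finite,linorder} \<Rightarrow> 'a::complex_hilbert \<Rightarrow> 'a) \<Rightarrow> nat \<Rightarrow> 'a set" where
  "shift_part T m = closed_cspan {op_power T \<alpha> (defect_op_star T h) |\<alpha> h. mi_size \<alpha> \<ge> m}"

definition nil_part ::
    "('n::{finite,linorder} \<Rightarrow> 'a::complex_hilbert \<Rightarrow> 'a) \<Rightarrow> nat \<Rightarrow> 'a set" where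
  "nil_part T m =
     closed_cspan {op_power T \<alpha> (defect_op_star T h) |\<alpha> h. True} \<ominus> shift_part T m"

definition coisometric_part ::
    "('n::{finite,linorder} \<Rightarrow> 'a::complex_hilbert \<Rightarrow> 'a) \<Rightarrow> 'a set" where
  "coisometric_part T = {h. \<forall>k. adjoint_mass UNIV T k h = (norm h)\<^sup>2}"

end

theory Submission
  imports Defs
begin

text \<open>
  Write \<open>D\<close> for the defect operator of \<open>T\<^sup>*\<close> and \<open>L\<^sub>k\<close> for the closed span of the
  vectors \<open>T\<^sup>\<alpha> D h\<close> with \<open>|\<alpha>| \<ge> k\<close>, so that \<open>\<M> = L\<^sub>m\<close> and \<open>\<H>\<^sub>c\<close> is the orthogonal
  complement of \<open>L\<^sub>0\<close>. The vanishing of the Taylor coefficients of degree \<open>> m\<close> says that certain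
  vectors built from \<open>T\<^sup>\<alpha> D h\<close> lie in the kernel of \<open>I - T\<^sup>* T\<close>. This amounts to
  \<open>T\<^sub>i\<^sup>* T\<^sup>\<beta> D h = (\<beta>\<^sub>i / |\<beta>|) T\<^bsup>\<beta> - e\<^sub>i\<^esup> D h\<close> for \<open>|\<beta>| > m\<close>. Hence \<open>T\<^sub>i\<^sup>*\<close> maps \<open>L\<^bsub>k+1\<^esub>\<close>
  into \<open>L\<^sub>k\<close> for \<open>k \<ge> m\<close>, and \<open>\<Sum> T\<^sub>i T\<^sub>i\<^sup>*\<close> is the identity on \<open>L\<^bsub>m+1\<^esub>\<close>, which gives the formula
  for \<open>\<Sum> M\<^sub>i M\<^sub>i\<^sup>*\<close>. The intersection of the \<open>L\<^sub>k\<close> is invariant under all \<open>T\<^sub>i\<^sup>*\<close> and killed by \<open>D\<close>,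
  so it lies in \<open>\<M> \<inter> \<H>\<^sub>c = 0\<close>. Therefore \<open>\<M>\<close> is the sum of the layers \<open>L\<^sub>k \<ominus> L\<^bsub>k+1\<^esub>\<close>, each of which
  \<open>M\<^sub>i\<^sup>*\<close> lowers by one, and \<open>M\<close> is pure.

  A pure \<open>M\<close> with this defect embeds isometrically into the Drury--Arveson space over \<open>\<N>\<close> by
  \<open>x \<mapsto> \<Sum> \<gamma>\<^sub>\<alpha> z\<^sup>\<alpha> P M\<^bsup>*\<alpha>\<^esup> x\<close>. If the adjoint \<open>f \<mapsto> \<Sum> M\<^sup>\<alpha> f\<^sub>\<alpha>\<close> of this map kills \<open>f\<close>,
  then \<open>f(z)\<close> lies in \<open>(M - z) \<M>\<^sup>n \<inter> \<N>\<close>, which is zero for small \<open>z\<close> when \<open>M\<close> is regular.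
\<close>

section \<open>Complex Hilbert spaces\<close>

text \<open>A single Taylor coefficient of the characteristic function mixes adjoint powers of T
  with the coordinates of \<open>defect_op T\<close>, written D_T below. All indices of one degree
  are therefore kept together: with A = z_1 T_1* + ... + z_n T_n* and u = z_1 (D_T x)_1 + ... + z_n
  (D_T x)_n, the part of degree j + 1 is the single vector D A^j u, and it vanishes for j \<ge> m.
  Taking x = D_T y and passing to adjoints, D_T enters only through its square I - T*T, and the
  vector with coordinates z_i (z_1 T_1 + ... + z_n T_n)^j D h turns out to be fixed by T*T. This is
  the shift relation for a generating function; the factor \<beta>_i / |\<beta>| is the quotient of
  the multinomial weights of \<beta> - e_i and \<beta>. A bounded linear map that vanishes on all
  generating vectors of one degree vanishes on every T^\<alpha> D h of that degree, so the relation
  is never written out for single indices. The adjoint of M_i is P T_i* with P the projection onto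
  the first summand. It kills the layer \<N>, where T_i* itself need not vanish.\<close>

instance complex_hilbert \<subseteq> banach ..

lemma cinner_add_right: "cinner x (y + z) = cinner x y + cinner x (z::'a::complex_hilbert)"
  by (metis cinner_add_left cinner_commute complex_cnj_add)

lemma cinner_scaleC_right: "cinner x (c *\<^sub>C y) = cnj c * cinner x (y::'a::complex_hilbert)"
  by (metis cinner_commute cinner_scaleC_left complex_cnj_mult)

lemma cinner_scaleR_left: "cinner (r *\<^sub>R x) y = r *\<^sub>R cinner x (y::'a::complex_hilbert)"
  by (metis cinner_scaleC_left scaleC_of_real scaleR_conv_of_real)

lemma cinner_scaleR_right: "cinner x (r *\<^sub>R y) = r *\<^sub>R cinner x (y::'a::complex_hilbert)"
  by (metis cinner_scaleC_right complex_cnj_complex_of_real scaleC_of_real scaleR_conv_of_real)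

lemma cinner_self: "cinner x x = complex_of_real ((norm (x::'a::complex_hilbert))\<^sup>2)"
proof (rule complex_eqI)
  show "Re (cinner x x) = Re (complex_of_real ((norm x)\<^sup>2))"
    by (simp flip: inner_eq_Re_cinner add: power2_norm_eq_inner)
  have "Im (cinner x x) = - Im (cinner x x)"
    using cinner_commute[of x x] by (metis cnj.simps(2))
  then show "Im (cinner x x) = Im (complex_of_real ((norm x)\<^sup>2))" by simp
qed

lemma norm_scaleC: "norm (c *\<^sub>C x) = cmod c * norm (x::'a::complex_hilbert)"
proof -
  have "complex_of_real ((norm (c *\<^sub>C x))\<^sup>2) = c * cnj c * of_real ((norm x)\<^sup>2)"
    by (metis cinner_self cinner_scaleC_left cinner_scaleC_right mult.assoc)
  also have "\<dots> = complex_of_real ((cmod c * norm x)\<^sup>2)"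
    by (simp add: power_mult_distrib flip: complex_norm_square)
  finally show ?thesis
    by (metis norm_ge_zero mult_nonneg_nonneg of_real_eq_iff power2_eq_imp_eq)
qed

lemma cmod_cinner_le: "cmod (cinner x y) \<le> norm x * norm (y::'a::complex_hilbert)"
proof -
  \<comment> \<open>Multiplying by \<open>c\<close> turns the inner product into its modulus, which
    reduces the claim to the real Cauchy-Schwarz inequality.\<close>
  define c where "c = cnj (sgn (cinner x y))"
  have "cmod c \<le> 1"
    by (simp add: c_def norm_sgn)
  have "cnj (cinner x y) * cinner x y = (cmod (cinner x y))\<^sup>2"
    by (metis complex_norm_square mult.commute)
  then have "of_real (cmod (cinner x y)) = c * cinner x y"
    by (cases "cinner x y = 0")
      (auto simp: c_def sgn_eq power2_eq_square field_simps)
  then have "cmod (cinner x y) = inner (c *\<^sub>C x) y"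
    by (metis Re_complex_of_real cinner_scaleC_left inner_eq_Re_cinner)
  also have "\<dots> \<le> norm (c *\<^sub>C x) * norm y"
    by (rule norm_cauchy_schwarz)
  also have "\<dots> \<le> norm x * norm y"
    using \<open>cmod c \<le> 1\<close> by (simp add: norm_scaleC mult_left_le_one_le mult_right_mono)
  finally show ?thesis .
qed

lemma scaleC_scaleR: "c *\<^sub>C (r *\<^sub>R x) = r *\<^sub>R (c *\<^sub>C (x::'a::complex_hilbert))"
  by (metis scaleC_of_real scaleC_scaleC mult.commute)

lemma bounded_bilinear_cinner: "bounded_bilinear (cinner :: 'a::complex_hilbert \<Rightarrow> _)"
  by (rule bounded_bilinear.intro)
    (use cmod_cinner_le in \<open>auto simp: cinner_add_left cinner_add_right cinner_scaleR_left
        cinner_scaleR_right intro!: exI[of _ 1]\<close>)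

lemma bounded_bilinear_scaleC: "bounded_bilinear (scaleC :: complex \<Rightarrow> 'a::complex_hilbert \<Rightarrow> 'a)"
proof (rule bounded_bilinear.intro)
  show "(r *\<^sub>R c) *\<^sub>C x = r *\<^sub>R (c *\<^sub>C x)" for r c and x :: 'a
    by (metis scaleC_of_real scaleC_scaleC scaleR_conv_of_real)
qed (auto simp: scaleC_add_left scaleC_add_right norm_scaleC scaleC_scaleR intro!: exI[of _ 1])

lemmas cinner_simps = cinner_add_left cinner_add_right cinner_scaleC_left cinner_scaleC_right
  bounded_bilinear.diff_left[OF bounded_bilinear_cinner]
  bounded_bilinear.diff_right[OF bounded_bilinear_cinner]
  bounded_bilinear.minus_left[OF bounded_bilinear_cinner]
  bounded_bilinear.minus_right[OF bounded_bilinear_cinner]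
  bounded_bilinear.zero_left[OF bounded_bilinear_cinner]
  bounded_bilinear.zero_right[OF bounded_bilinear_cinner]
  bounded_bilinear.sum_left[OF bounded_bilinear_cinner]
  bounded_bilinear.sum_right[OF bounded_bilinear_cinner]

lemma scaleC_zero: "0 *\<^sub>C x = (0::'a::complex_hilbert)" "c *\<^sub>C 0 = (0::'a)"
  by (simp_all add: bounded_bilinear.zero_left[OF bounded_bilinear_scaleC]
      bounded_bilinear.zero_right[OF bounded_bilinear_scaleC])

lemma cinner_eq_zero_commute: "cinner x y = 0 \<longleftrightarrow> cinner y (x::'a::complex_hilbert) = 0"
  by (metis cinner_commute complex_cnj_zero)

lemma cinner_extensional:
  assumes "\<And>y. cinner x y = cinner (x'::'a::complex_hilbert) y"
  shows "x = x'"
proof -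
  have "cinner (x - x') (x - x') = 0"
    using assms[of "x - x'"] by (simp only: cinner_simps(5)[of x x']) simp
  then show ?thesis by (simp add: cinner_self)
qed

lemma pythagoras:
  assumes "cinner x (y::'a::complex_hilbert) = 0"
  shows "(norm (x + y))\<^sup>2 = (norm x)\<^sup>2 + (norm y)\<^sup>2"
proof -
  have "inner x y = 0" using assms by (simp add: inner_eq_Re_cinner)
  then show ?thesis
    by (simp add: power2_norm_eq_inner inner_add_left inner_add_right inner_commute)
qed

subsection \<open>Closed subspaces and projections\<close>

lemma closed_csubspaceD:
  assumes "closed_csubspace S"
  shows "closed S" "0 \<in> S" "\<And>x y. x \<in> S \<Longrightarrow> y \<in> S \<Longrightarrow> x + y \<in> S"
    "\<And>x y. x \<in> S \<Longrightarrow> y \<in> S \<Longrightarrow> x - y \<in> S" "\<And>c x. x \<in> S \<Longrightarrow> c *\<^sub>C x \<in> S"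
    "\<And>c x. x \<in> S \<Longrightarrow> c *\<^sub>R x \<in> S"
  using assms complex_vector.subspace_0 complex_vector.subspace_add complex_vector.subspace_diff
    complex_vector.subspace_scale
  unfolding closed_csubspace_def by (auto simp flip: scaleC_of_real)

lemma closed_csubspaceI:
  assumes "closed S" "0 \<in> S" "\<And>x y. x \<in> S \<Longrightarrow> y \<in> S \<Longrightarrow> x + y \<in> S"
    "\<And>c x. x \<in> S \<Longrightarrow> c *\<^sub>C x \<in> S"
  shows "closed_csubspace S"
  using assms unfolding closed_csubspace_def complex_vector.subspace_def by blast

lemma closed_csubspace_sum:
  assumes "closed_csubspace S" "\<And>i. i \<in> I \<Longrightarrow> f i \<in> S"
  shows "sum f I \<in> S"
  using assms complex_vector.subspace_sum unfolding closed_csubspace_def by blast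

lemma closed_csubspace_UNIV: "closed_csubspace (UNIV::'a::complex_hilbert set)"
  by (rule closed_csubspaceI) auto

text \<open>Completeness enters here: by the parallelogram law, with the midpoint of two almost
  nearest points again in \<open>S\<close>, a minimizing sequence is Cauchy.\<close>

lemma nearest_point_exists:
  fixes S :: "'a::complex_hilbert set"
  assumes S: "closed_csubspace S"
  obtains y where "y \<in> S" "\<And>u. u \<in> S \<Longrightarrow> norm (x - y) \<le> norm (x - u)"
proof -
  define d where "d = (INF u\<in>S. norm (x - u))"
  have ne: "S \<noteq> {}" using closed_csubspaceD(2)[OF S] by blast
  have bdd: "bdd_below ((\<lambda>u. norm (x - u)) ` S)" by (rule bdd_belowI[of _ 0]) auto
  have d_le: "d \<le> norm (x - u)" if "u \<in> S" for u
    unfolding d_def by (rule cINF_lower[OF bdd that])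
  have d0: "0 \<le> d" unfolding d_def by (rule cINF_greatest[OF ne]) simp
  have "\<exists>u\<in>S. norm (x - u) < d + 1 / Suc k" for k
    using cInf_lessD[of "(\<lambda>u. norm (x - u)) ` S" "d + 1 / Suc k"] ne unfolding d_def by auto
  then obtain s where sS: "\<And>k. s k \<in> S" and s: "\<And>k. norm (x - s k) < d + 1 / Suc k"
    by metis
  have lim1: "(\<lambda>k. d + 1 / real (Suc k)) \<longlonglongrightarrow> d"
    using tendsto_add[OF tendsto_const LIMSEQ_Suc[OF lim_inverse_n'], of d] by simp
  have lim: "(\<lambda>k. (d + 1 / real (Suc k))\<^sup>2) \<longlonglongrightarrow> d\<^sup>2"
    by (rule tendsto_power[OF lim1])
  have near: "(norm (x - s i))\<^sup>2 \<le> (d + 1 / Suc i)\<^sup>2" for i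
    using s[of i] by (intro power_mono) auto
  have dist: "(norm (s j - s k))\<^sup>2 \<le> 2 * (d + 1 / Suc j)\<^sup>2 + 2 * (d + 1 / Suc k)\<^sup>2 - 4 * d\<^sup>2" for j k
  proof -
    have "(1/2) *\<^sub>R (s j + s k) \<in> S" using S sS by (intro closed_csubspaceD) auto
    then have "d \<le> norm (x - (1/2) *\<^sub>R (s j + s k))" by (rule d_le)
    also have "x - (1/2) *\<^sub>R (s j + s k) = (1/2) *\<^sub>R ((x - s j) + (x - s k))"
      by (simp add: algebra_simps flip: scaleR_add_left)
    finally have "2 * d \<le> norm ((x - s j) + (x - s k))" by simp
    then have "(2 * d)\<^sup>2 \<le> (norm ((x - s j) + (x - s k)))\<^sup>2" using d0 by (intro power_mono) auto
    moreover have "(norm ((x - s j) + (x - s k)))\<^sup>2 + (norm (s j - s k))\<^sup>2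
        = 2 * (norm (x - s j))\<^sup>2 + 2 * (norm (x - s k))\<^sup>2"
      by (simp add: power2_norm_eq_inner inner_simps inner_commute)
    ultimately show ?thesis
      using near[of j] near[of k] unfolding power_mult_distrib by (simp del: of_nat_Suc)
  qed
  have "Cauchy s"
  proof (rule metric_CauchyI)
    fix e :: real assume e: "e > 0"
    have "eventually (\<lambda>k. (d + 1 / real (Suc k))\<^sup>2 < d\<^sup>2 + e\<^sup>2 / 4) sequentially"
      using lim e by (intro order_tendstoD) auto
    then obtain K where K: "\<And>k. k \<ge> K \<Longrightarrow> (d + 1 / real (Suc k))\<^sup>2 < d\<^sup>2 + e\<^sup>2 / 4"
      by (auto simp: eventually_sequentially)
    show "\<exists>M. \<forall>m\<ge>M. \<forall>n\<ge>M. dist (s m) (s n) < e"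
    proof (intro exI allI impI)
      fix j k assume "K \<le> j" "K \<le> k"
      with dist[of j k] K[of j] K[of k] have "(norm (s j - s k))\<^sup>2 < e\<^sup>2" by auto
      then show "dist (s j) (s k) < e"
        using e by (simp add: dist_norm power_less_imp_less_base)
    qed
  qed
  then obtain y where y: "s \<longlonglongrightarrow> y" using Cauchy_convergent convergent_def by blast
  then have yS: "y \<in> S" using closed_sequentially[OF closed_csubspaceD(1)[OF S]] sS by blast
  have "norm (x - y) \<le> d"
  proof (rule LIMSEQ_le)
    show "(\<lambda>k. norm (x - s k)) \<longlonglongrightarrow> norm (x - y)" by (intro tendsto_intros y)
    show "(\<lambda>k. d + 1 / real (Suc k)) \<longlonglongrightarrow> d" by (rule lim1)
    show "\<exists>N. \<forall>n\<ge>N. norm (x - s n) \<le> d + 1 / Suc n" using s less_imp_le by blast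
  qed
  then show ?thesis using yS d_le that by force
qed

lemma projection_exists:
  fixes S :: "'a::complex_hilbert set"
  assumes S: "closed_csubspace S"
  obtains y where "y \<in> S" "\<And>u. u \<in> S \<Longrightarrow> cinner (x - y) u = 0"
proof -
  obtain y where yS: "y \<in> S" and y: "\<And>u. u \<in> S \<Longrightarrow> norm (x - y) \<le> norm (x - u)"
    using nearest_point_exists[OF S] by blast
  have "cinner (x - y) u = 0" if u: "u \<in> S" for u
  proof (cases "u = 0")
    case False
    \<comment> \<open>\<open>c *\<^sub>C u\<close> is the projection of \<open>x - y\<close> onto
      the line of \<open>u\<close>; if it were nonzero, \<open>y + c *\<^sub>C u\<close> would be
      nearer to \<open>x\<close>.\<close>
    define c where "c = cinner (x - y) u / of_real ((norm u)\<^sup>2)"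
    have "y + c *\<^sub>C u \<in> S" using S yS u by (intro closed_csubspaceD) auto
    have "cinner (x - (y + c *\<^sub>C u)) (c *\<^sub>C u) = 0"
      using False by (simp add: cinner_simps cinner_self c_def diff_diff_eq[symmetric])
    then have "(norm (x - y))\<^sup>2 = (norm (x - (y + c *\<^sub>C u)))\<^sup>2 + (norm (c *\<^sub>C u))\<^sup>2"
      using pythagoras[of "x - (y + c *\<^sub>C u)" "c *\<^sub>C u"] by simp
    moreover have "(norm (x - y))\<^sup>2 \<le> (norm (x - (y + c *\<^sub>C u)))\<^sup>2"
      using y[OF \<open>y + c *\<^sub>C u \<in> S\<close>] by (intro power_mono) auto
    ultimately have "norm (c *\<^sub>C u) = 0" by simp
    then show ?thesis using False by (simp add: norm_scaleC c_def)
  qed (simp add: cinner_simps)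
  with yS that show ?thesis by blast
qed

lemma proj_eqI:
  fixes S :: "'a::complex_hilbert set"
  assumes S: "closed_csubspace S" and y: "y \<in> S" "\<And>u. u \<in> S \<Longrightarrow> cinner (x - y) u = 0"
  shows "proj S x = y"
  unfolding proj_def
proof (rule the_equality)
  fix y' assume y': "y' \<in> S \<and> (\<forall>u\<in>S. cinner (x - y') u = 0)"
  then have "y' - y \<in> S" using S y by (intro closed_csubspaceD) auto
  then have "cinner (x - y) (y' - y) - cinner (x - y') (y' - y) = 0"
    using y y' by simp
  then have "cinner (y' - y) (y' - y) = 0" by (simp flip: cinner_simps(5))
  then show "y' = y" by (simp add: cinner_self)
qed (use y in blast)

context
  fixes S :: "'a::complex_hilbert set"
  assumes S: "closed_csubspace S"
begin

lemma proj_in: "proj S x \<in> S"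
  and proj_orth: "u \<in> S \<Longrightarrow> cinner (x - proj S x) u = 0"
  using projection_exists[OF S, of x] proj_eqI[OF S, of _ x] by metis+

lemma proj_id: "x \<in> S \<Longrightarrow> proj S x = x"
  by (rule proj_eqI[OF S]) (auto simp: cinner_simps)

lemma proj_cinner_right: "u \<in> S \<Longrightarrow> cinner (proj S x) u = cinner x u"
  using proj_orth[of u x] by (simp add: cinner_simps)

lemma proj_cinner_left: "u \<in> S \<Longrightarrow> cinner u (proj S x) = cinner u x"
  using proj_cinner_right[of u x] by (metis cinner_commute)

lemma proj_add: "proj S (x + y) = proj S x + proj S y"
  by (rule proj_eqI[OF S])
    (auto simp: cinner_simps proj_cinner_right intro!: closed_csubspaceD(3)[OF S] proj_in)

lemma proj_scaleC: "proj S (c *\<^sub>C x) = c *\<^sub>C proj S x"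
  by (rule proj_eqI[OF S])
    (auto simp: cinner_simps proj_cinner_right intro!: closed_csubspaceD(5)[OF S] proj_in)

lemma proj_eq_0_iff: "proj S x = 0 \<longleftrightarrow> (\<forall>u\<in>S. cinner x u = 0)"
  by (metis S closed_csubspaceD(2) cinner_simps(9) diff_zero proj_cinner_right proj_eqI)

lemma norm_proj_pythagoras: "(norm x)\<^sup>2 = (norm (proj S x))\<^sup>2 + (norm (x - proj S x))\<^sup>2"
  using pythagoras[of "x - proj S x" "proj S x"] proj_orth[OF proj_in] by simp

lemma norm_proj_le: "norm (proj S x) \<le> norm x"
  by (rule power2_le_imp_le) (use norm_proj_pythagoras[of x] in auto)

lemma bounded_clinear_proj: "bounded_clinear_on UNIV (proj S)"
  unfolding bounded_clinear_on_def
  by (auto simp: proj_add proj_scaleC norm_proj_le intro!: exI[of _ 1])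

text \<open>A closed subspace is its own double complement. This turns membership into the vanishing
  of scalar functionals, to which \<open>linear_zero_on_op_power\<close> applies later.\<close>

lemma mem_closed_csubspaceI:
  assumes "\<And>y. (\<And>u. u \<in> S \<Longrightarrow> cinner u y = 0) \<Longrightarrow> cinner x y = 0"
  shows "x \<in> S"
proof -
  have "cinner x (x - proj S x) = 0"
    using proj_orth by (intro assms) (metis cinner_eq_zero_commute)
  then have "cinner (x - proj S x) (x - proj S x) = 0"
    by (metis cinner_eq_zero_commute cinner_simps(5) diff_0 neg_equal_0_iff_equal proj_in proj_orth)
  then have "x = proj S x" by (simp add: cinner_self)
  then show ?thesis using proj_in by metis
qed

lemma closed_orthogonal_complement: "closed_csubspace {x \<in> S. \<forall>u\<in>B. cinner x u = 0}"
proof (rule closed_csubspaceI)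
  have "closed {x. cinner x u = 0}" for u :: 'a
    by (intro closed_Collect_eq continuous_intros
        bounded_linear.continuous_on[OF bounded_bilinear.bounded_linear_left[OF bounded_bilinear_cinner]])
  then have "closed (S \<inter> (\<Inter>u\<in>B. {x. cinner x u = 0}))"
    using closed_csubspaceD(1)[OF S] by (intro closed_Int closed_INT) auto
  then show "closed {x \<in> S. \<forall>u\<in>B. cinner x u = 0}"
    by (rule back_subst) auto
qed (use closed_csubspaceD[OF S] in \<open>auto simp: cinner_simps\<close>)

lemma riesz_representation:
  fixes f :: "'a \<Rightarrow> complex"
  assumes f: "bounded_clinear_on S f"
  obtains z where "z \<in> S" "\<And>x. x \<in> S \<Longrightarrow> f x = cinner x z"
proof -
  have add: "f (x + y) = f x + f y" if "x \<in> S" "y \<in> S" for x y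
    using f that unfolding bounded_clinear_on_def by blast
  have scale: "f (c *\<^sub>C x) = c * f x" if "x \<in> S" for c x
    using f that unfolding bounded_clinear_on_def by (auto simp: scaleC_complex_def)
  have diff: "f (x - y) = f x - f y" if "x \<in> S" "y \<in> S" for x y
    using add[of "x - y" y] closed_csubspaceD(4)[OF S] that by simp
  obtain K where K: "\<And>x. x \<in> S \<Longrightarrow> norm (f x) \<le> K * norm x"
    using f unfolding bounded_clinear_on_def by blast
  define Z where "Z = {x \<in> S. f x = 0}"
  have "continuous_on S f"
  proof (rule lipschitz_on_continuous_on)
    show "(max K 0)-lipschitz_on S f"
    proof (rule lipschitz_onI)
      fix x y assume xy: "x \<in> S" "y \<in> S"
      then have "norm (f (x - y)) \<le> K * norm (x - y)"
        using K closed_csubspaceD(4)[OF S] by blast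
      also have "\<dots> \<le> max K 0 * norm (x - y)" by (intro mult_right_mono) auto
      finally show "dist (f x) (f y) \<le> max K 0 * dist x y"
        using xy by (simp add: dist_norm diff)
    qed simp
  qed
  then have "closed Z"
    using continuous_closed_preimage_constant[OF _ closed_csubspaceD(1)[OF S]] unfolding Z_def by blast
  then have Z: "closed_csubspace Z"
    using closed_csubspaceD[OF S] diff[of 0 0]
    by (intro closed_csubspaceI) (auto simp: Z_def add scale)
  show ?thesis
  proof (cases "S \<subseteq> Z")
    case True
    then show ?thesis using that[of 0] closed_csubspaceD[OF S] by (auto simp: Z_def cinner_simps)
  next
    case False
    then obtain x0 where x0: "x0 \<in> S" "x0 \<notin> Z" by blast
    obtain y where y: "y \<in> Z" "\<And>u. u \<in> Z \<Longrightarrow> cinner (x0 - y) u = 0"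
      using projection_exists[OF Z] by blast
    define u where "u = x0 - y"
    have uS: "u \<in> S" using x0 y closed_csubspaceD(4)[OF S] by (auto simp: u_def Z_def)
    have "u \<notin> Z" using x0 y closed_csubspaceD(3)[OF Z, of u y] by (auto simp: u_def)
    then have fu: "f u \<noteq> 0" using uS by (auto simp: Z_def)
    have u0: "cinner u u \<noteq> 0" using \<open>u \<notin> Z\<close> closed_csubspaceD(2)[OF Z] by (auto simp: cinner_self)
    \<comment> \<open>The functional is determined by its value at \<open>u\<close>, which is
      orthogonal to its kernel \<open>Z\<close>; the factor makes
      \<open>cinner u z = f u\<close>.\<close>
    define z where "z = cnj (f u / cinner u u) *\<^sub>C u"
    show ?thesis
    proof (rule that)
      show "z \<in> S" unfolding z_def by (rule closed_csubspaceD(5)[OF S uS])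
      fix x assume x: "x \<in> S"
      have "f (x - (f x / f u) *\<^sub>C u) = 0"
        using x uS fu closed_csubspaceD(5)[OF S] by (simp add: diff scale)
      then have "x - (f x / f u) *\<^sub>C u \<in> Z"
        using x uS closed_csubspaceD(4,5)[OF S] by (simp add: Z_def)
      then have "cinner u (x - (f x / f u) *\<^sub>C u) = 0" using y(2) by (simp add: u_def)
      then have "cinner (x - (f x / f u) *\<^sub>C u) u = 0" by (rule cinner_eq_zero_commute[THEN iffD1])
      then have "cinner x u = (f x / f u) * cinner u u" by (simp add: cinner_simps)
      then show "f x = cinner x z"
        using fu u0 by (simp add: z_def cinner_simps field_simps)
    qed
  qed
qed

end

lemma closed_csubspace_ominus:
  assumes "closed_csubspace S"
  shows "closed_csubspace (S \<ominus> B)"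
  unfolding ominus_def by (rule closed_orthogonal_complement[OF assms])

lemma bounded_clinear_on_sub:
  "bounded_clinear_on UNIV f \<Longrightarrow> bounded_clinear_on S f"
  unfolding bounded_clinear_on_def by blast

lemma bounded_clinear_bounded_linear:
  assumes "bounded_clinear_on UNIV f"
  shows "bounded_linear f"
proof -
  obtain K where "\<And>x. norm (f x) \<le> K * norm x" "\<And>x y. f (x + y) = f x + f y"
    "\<And>c x. f (c *\<^sub>C x) = c *\<^sub>C f x"
    using assms unfolding bounded_clinear_on_def by auto
  then show ?thesis
    by (intro bounded_linear_intro[of _ K]) (auto simp: mult.commute simp flip: scaleC_of_real)
qed

lemma bounded_clinearI:
  assumes "bounded_linear f" "\<And>c x. f (c *\<^sub>C x) = c *\<^sub>C f x"
  shows "bounded_clinear_on UNIV f"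
  using assms bounded_linear.bounded[OF assms(1)] linear_add[OF bounded_linear.linear[OF assms(1)]]
  unfolding bounded_clinear_on_def by (auto simp: mult.commute)

lemma bounded_clinear_scaleC:
  "bounded_clinear_on UNIV f \<Longrightarrow> f (c *\<^sub>C x) = c *\<^sub>C f x"
  unfolding bounded_clinear_on_def by blast

lemma bounded_clinear_comp:
  assumes "bounded_clinear_on UNIV f" "bounded_clinear_on UNIV g"
  shows "bounded_clinear_on UNIV (\<lambda>x. f (g x))"
  using assms bounded_linear_compose[OF assms[THEN bounded_clinear_bounded_linear]]
  by (intro bounded_clinearI) (auto simp: bounded_clinear_scaleC)

lemma bounded_clinear_scaled:
  assumes "bounded_clinear_on UNIV f"
  shows "bounded_clinear_on UNIV (\<lambda>x. c *\<^sub>C f x)"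
  using bounded_linear_compose[OF bounded_bilinear.bounded_linear_right[OF bounded_bilinear_scaleC]
      bounded_clinear_bounded_linear[OF assms]] assms
  by (intro bounded_clinearI) (auto simp: bounded_clinear_scaleC scaleC_scaleC mult.commute)

lemma bounded_clinear_sum:
  assumes "\<And>i. i \<in> I \<Longrightarrow> bounded_clinear_on UNIV (f i)"
  shows "bounded_clinear_on UNIV (\<lambda>x. \<Sum>i\<in>I. f i x)"
  using bounded_linear_sum[OF bounded_clinear_bounded_linear[OF assms]] assms
  by (intro bounded_clinearI)
    (auto simp: bounded_clinear_scaleC complex_vector.scale_sum_right)

lemma bounded_clinear_diff:
  assumes "bounded_clinear_on UNIV f" "bounded_clinear_on UNIV g"
  shows "bounded_clinear_on UNIV (\<lambda>x. f x - g x)"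
  using bounded_linear_sub[OF assms[THEN bounded_clinear_bounded_linear]] assms
  by (intro bounded_clinearI)
    (auto simp: bounded_clinear_scaleC complex_vector.scale_right_diff_distrib)

lemma bounded_clinear_id: "bounded_clinear_on UNIV (\<lambda>x. x)"
  by (intro bounded_clinearI bounded_linear_ident) simp

lemma bounded_clinear_funpow:
  fixes f :: "'a::complex_hilbert \<Rightarrow> 'a"
  shows "bounded_clinear_on UNIV f \<Longrightarrow> bounded_clinear_on UNIV (f ^^ k)"
proof (induction k)
  case 0
  show ?case by (auto simp: bounded_clinear_on_def intro!: exI[of _ 1])
next
  case (Suc k)
  have "bounded_clinear_on UNIV (\<lambda>x. f ((f ^^ k) x))"
    by (rule bounded_clinear_comp[OF Suc.prems Suc.IH[OF Suc.prems]])
  then show ?case by (simp add: comp_def)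
qed

lemma closed_csubspace_vimage:
  assumes f: "bounded_clinear_on UNIV f" and S: "closed_csubspace S"
  shows "closed_csubspace {x. f x \<in> S}"
proof (rule closed_csubspaceI)
  have "closed (f -` S)"
    using closed_csubspaceD(1)[OF S] linear_continuous_on[OF bounded_clinear_bounded_linear[OF f]]
    by (intro closed_vimage) auto
  then show "closed {x. f x \<in> S}" by (simp add: vimage_def)
  show "0 \<in> {x. f x \<in> S}"
    using closed_csubspaceD(2)[OF S] linear_0[OF bounded_linear.linear[OF bounded_clinear_bounded_linear[OF f]]]
    by simp
qed (use f closed_csubspaceD(3,5)[OF S] in \<open>auto simp: bounded_clinear_on_def\<close>)

lemma closed_csubspace_closed_cspan: "closed_csubspace (closed_cspan A)"
  unfolding closed_cspan_def
proof (rule closed_csubspaceI)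
  show "0 \<in> closure (complex_vector.span A)"
    using complex_vector.span_zero closure_subset by blast
  fix x y c
  assume x: "x \<in> closure (complex_vector.span A)"
  then obtain s where s: "\<And>k. s k \<in> complex_vector.span A" "s \<longlonglongrightarrow> x"
    unfolding closure_sequential by blast
  have "(\<lambda>k. c *\<^sub>C s k) \<longlonglongrightarrow> c *\<^sub>C x"
    by (rule bounded_bilinear.tendsto[OF bounded_bilinear_scaleC tendsto_const s(2)])
  then show "c *\<^sub>C x \<in> closure (complex_vector.span A)"
    unfolding closure_sequential using s(1) complex_vector.span_scale
    by (intro exI[of _ "\<lambda>k. c *\<^sub>C s k"]) auto
  assume "y \<in> closure (complex_vector.span A)"
  then obtain t where t: "\<And>k. t k \<in> complex_vector.span A" "t \<longlonglongrightarrow> y"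
    unfolding closure_sequential by blast
  have "(\<lambda>k. s k + t k) \<longlonglongrightarrow> x + y" using s t by (intro tendsto_add) auto
  moreover have "s k + t k \<in> complex_vector.span A" for k
    using s t by (intro complex_vector.span_add) auto
  ultimately show "x + y \<in> closure (complex_vector.span A)"
    unfolding closure_sequential by (intro exI[of _ "\<lambda>k. s k + t k"]) auto
qed simp

lemma closed_cspan_superset: "A \<subseteq> closed_cspan A"
  unfolding closed_cspan_def using complex_vector.span_superset closure_subset by blast

lemma closed_cspan_minimal:
  assumes "A \<subseteq> S" "closed_csubspace S"
  shows "closed_cspan A \<subseteq> S"
  using assms complex_vector.span_minimal[of A S] closure_minimal
  unfolding closed_cspan_def closed_csubspace_def by blast

subsection \<open>Adjoints\<close>

lemma adjoint_on_eqI: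
  assumes S: "closed_csubspace S" and z: "z \<in> S" "\<And>x. x \<in> S \<Longrightarrow> cinner (A x) y = cinner x z"
  shows "adjoint_on S A y = z"
  unfolding adjoint_on_def
proof (rule the_equality)
  fix z' assume z': "z' \<in> S \<and> (\<forall>x\<in>S. cinner (A x) y = cinner x z')"
  then have "z' - z \<in> S" using closed_csubspaceD(4)[OF S] z by blast
  then have "cinner (z' - z) (z' - z) = 0" using z z' by (simp add: cinner_simps(6))
  then show "z' = z" by (simp add: cinner_self)
qed (use z in blast)

lemma cinner_adj_right:
  assumes A: "bounded_clinear_on UNIV A"
  shows "cinner x (adj A y) = cinner (A x) y"
proof -
  have "bounded_clinear_on UNIV (\<lambda>x. cinner (A x) y)"
    using bounded_linear_compose[OF bounded_bilinear.bounded_linear_left[OF bounded_bilinear_cinner]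
        bounded_clinear_bounded_linear[OF A], of y]
    by (intro bounded_clinearI) (auto simp: bounded_clinear_scaleC[OF A] cinner_simps scaleC_complex_def)
  then obtain z where "\<And>x. cinner (A x) y = cinner x z"
    by (elim riesz_representation[OF closed_csubspace_UNIV]) auto
  then show ?thesis using adjoint_on_eqI[OF closed_csubspace_UNIV, of z A y] by simp
qed

lemma cinner_adj_left:
  assumes A: "bounded_clinear_on UNIV A"
  shows "cinner (adj A y) x = cinner y (A x)"
  using cinner_adj_right[OF A, of x y] by (metis cinner_commute)

lemma bounded_clinear_adj:
  assumes A: "bounded_clinear_on UNIV A"
  shows "bounded_clinear_on UNIV (adj A)"
  unfolding bounded_clinear_on_def
proof (intro conjI ballI allI)
  show "adj A (x + y) = adj A x + adj A y" for x y
    by (rule cinner_extensional) (simp add: cinner_adj_left[OF A] cinner_simps)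
  show "adj A (c *\<^sub>C x) = c *\<^sub>C adj A x" for c x
    by (rule cinner_extensional) (simp add: cinner_adj_left[OF A] cinner_simps)
  obtain K where K: "\<And>x. norm (A x) \<le> norm x * K" "K > 0"
    using bounded_linear.pos_bounded[OF bounded_clinear_bounded_linear[OF A]] by blast
  have "norm (adj A y) \<le> K * norm y" for y
  proof -
    have "(norm (adj A y))\<^sup>2 = cmod (cinner (adj A y) (adj A y))"
      by (simp add: cinner_self norm_power)
    also have "\<dots> = cmod (cinner (A (adj A y)) y)" by (simp add: cinner_adj_right[OF A])
    also have "\<dots> \<le> norm (A (adj A y)) * norm y" by (rule cmod_cinner_le)
    also have "\<dots> \<le> (norm (adj A y) * K) * norm y" by (intro mult_right_mono K) auto
    finally have "norm (adj A y) * norm (adj A y) \<le> norm (adj A y) * (K * norm y)"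
      by (simp add: power2_eq_square mult.assoc)
    then show ?thesis using K(2) by (cases "adj A y = 0") auto
  qed
  then show "\<exists>K. \<forall>x\<in>UNIV. norm (adj A x) \<le> K * norm x" by blast
qed

lemma positive_cinner_nonneg:
  assumes "positive_on UNIV B"
  shows "0 \<le> Re (cinner (B x) x)" "Im (cinner (B x) x) = 0"
  using assms unfolding positive_on_def by (auto simp: complex_nonneg_Reals_iff)

text \<open>Complex polarization: the form is real at \<open>x + y\<close> and at
  \<open>x + \<i> *\<^sub>C y\<close>, which settles the imaginary and the real part.\<close>

lemma positive_self_adjoint:
  assumes B: "bounded_clinear_on UNIV B" and pos: "positive_on UNIV B"
  shows "cinner (B x) y = cinner x (B y)"
proof -
  have add: "B (u + v) = B u + B v" for u v using B by (simp add: bounded_clinear_on_def)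
  note Im0 = positive_cinner_nonneg(2)[OF pos]
  have "Im (cinner (B x) y) + Im (cinner (B y) x) = 0"
    using Im0[of "x + y"] Im0[of x] Im0[of y] by (simp add: add cinner_simps)
  moreover have "Re (cinner (B y) x) - Re (cinner (B x) y) = 0"
    using Im0[of "x + \<i> *\<^sub>C y"] Im0[of x] Im0[of y]
    by (simp add: add cinner_simps bounded_clinear_scaleC[OF B])
  ultimately have "cinner (B x) y = cnj (cinner (B y) x)" by (simp add: complex_eq_iff)
  then show ?thesis by (metis cinner_commute)
qed

lemma positive_zero_form_imp_zero:
  assumes B: "bounded_clinear_on UNIV B" and pos: "positive_on UNIV B" and y: "cinner (B y) y = 0"
  shows "B y = 0"
proof (rule ccontr)
  assume "B y \<noteq> 0"
  define b where "b = (norm (B y))\<^sup>2"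
  define c where "c = Re (cinner (B (B y)) (B y))"
  have "b > 0" using \<open>B y \<noteq> 0\<close> by (simp add: b_def)
  have "c \<ge> 0" unfolding c_def by (rule positive_cinner_nonneg[OF pos])
  have ineq: "0 \<le> 2 * t * b + t\<^sup>2 * c" for t :: real
  proof -
    have lin: "B (y + t *\<^sub>R B y) = B y + t *\<^sub>R B (B y)"
      using bounded_clinear_bounded_linear[OF B] by (simp add: bounded_linear.linear linear_add linear_scale)
    have "0 \<le> Re (cinner (B (y + t *\<^sub>R B y)) (y + t *\<^sub>R B y))"
      by (rule positive_cinner_nonneg[OF pos])
    also have "\<dots> = 2 * t * b + t\<^sup>2 * c"
      using y positive_self_adjoint[OF B pos, of "B y" y]
      by (simp add: lin cinner_simps cinner_scaleR_left cinner_scaleR_right cinner_self b_def c_def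
          power2_eq_square algebra_simps)
    finally show ?thesis .
  qed
  \<comment> \<open>The quadratic in \<open>t\<close> is least at \<open>- b / c\<close>; the
    denominator \<open>c + 1\<close> also covers \<open>c = 0\<close> and still gives a negative
    value.\<close>
  define t where "t = - b / (c + 1)"
  have "2 * t * b + t\<^sup>2 * c = - (b\<^sup>2 * (c + 2)) / (c + 1)\<^sup>2"
    using \<open>c \<ge> 0\<close> by (simp add: t_def power2_eq_square divide_simps) (simp add: algebra_simps)
  moreover have "b\<^sup>2 * (c + 2) / (c + 1)\<^sup>2 > 0"
    using \<open>b > 0\<close> \<open>c \<ge> 0\<close> by (intro divide_pos_pos mult_pos_pos) auto
  ultimately show False using ineq[of t] by simp
qed

subsection \<open>Square roots\<close>

text \<open>The coefficients of the binomial series of \<open>\<surd>(1 - x)\<close>.\<close>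

definition sqrt_coeff :: "nat \<Rightarrow> real" where
  "sqrt_coeff k = (-1) ^ k * ((1/2) gchoose k)"

lemma sqrt_coeff_0: "sqrt_coeff 0 = 1"
  by (simp add: sqrt_coeff_def)

lemma sqrt_coeff_Suc: "sqrt_coeff (Suc k) = sqrt_coeff k * (real k - 1/2) / (real k + 1)"
proof -
  have eq: "((1/2::real) gchoose Suc k) = (1/2 - real k) * ((1/2) gchoose k) / (real k + 1)"
    by (simp add: gbinomial_prod_rev prod.atLeast0_lessThan_Suc field_simps)
  show ?thesis unfolding sqrt_coeff_def eq by (simp add: field_simps)
qed

lemma sqrt_coeff_nonpos: "k > 0 \<Longrightarrow> sqrt_coeff k \<le> 0"
proof (induction k)
  case (Suc k)
  show ?case
  proof (cases k)
    case 0
    then show ?thesis by (simp add: sqrt_coeff_Suc sqrt_coeff_0)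
  next
    case (Suc j)
    then have "sqrt_coeff k \<le> 0" using Suc.IH by simp
    then show ?thesis
      using Suc unfolding sqrt_coeff_Suc[of k]
      by (intro divide_nonpos_pos mult_nonpos_nonneg) auto
  qed
qed simp

text \<open>The partial sums are the coefficients of sqrt(1 - x) / (1 - x) = (1 - x)^(-1/2), which
  is -2 times the derivative of sqrt(1 - x); hence the closed form.\<close>

lemma sum_sqrt_coeff: "(\<Sum>k\<le>n. sqrt_coeff k) = - 2 * (real n + 1) * sqrt_coeff (Suc n)"
proof (induction n)
  case 0
  then show ?case by (simp add: sqrt_coeff_Suc sqrt_coeff_0)
next
  case (Suc n)
  have "(\<Sum>k\<le>Suc n. sqrt_coeff k) = - 2 * (real n + 1/2) * sqrt_coeff (Suc n)"
    using Suc by (simp add: algebra_simps)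
  also have "\<dots> = - 2 * (real (Suc n) + 1) * sqrt_coeff (Suc (Suc n))"
    by (simp add: sqrt_coeff_Suc[of "Suc n"] field_simps)
  finally show ?case .
qed

lemma sum_sqrt_coeff_nonneg: "(\<Sum>k\<le>n. sqrt_coeff k) \<ge> 0"
  unfolding sum_sqrt_coeff using sqrt_coeff_nonpos[of "Suc n"]
  by (intro mult_nonpos_nonpos) auto

text \<open>Only the first coefficient is positive, so the partial sums of the moduli are 2 minus
  those of the coefficients, and the latter are nonnegative.\<close>

lemma sqrt_coeff_abs_summable: "(\<lambda>k. \<bar>sqrt_coeff k\<bar>) summable_on UNIV"
proof -
  have "(\<Sum>k<n. \<bar>sqrt_coeff k\<bar>) \<le> 2" for n
  proof -
    have eq: "\<bar>sqrt_coeff k\<bar> = (if k = 0 then 2 else 0) - sqrt_coeff k" for k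
      using sqrt_coeff_nonpos[of k] by (auto simp: sqrt_coeff_0)
    have "(\<Sum>k<n. \<bar>sqrt_coeff k\<bar>) \<le> (\<Sum>k\<le>n. \<bar>sqrt_coeff k\<bar>)" by (intro sum_mono2) auto
    also have "\<dots> = 2 - (\<Sum>k\<le>n. sqrt_coeff k)" unfolding eq sum_subtractf by simp
    finally show ?thesis using sum_sqrt_coeff_nonneg[of n] by simp
  qed
  then have "summable (\<lambda>k. \<bar>sqrt_coeff k\<bar>)" by (intro summableI_nonneg_bounded[of _ 2]) auto
  then show ?thesis by (intro summable_nonneg_imp_summable_on) auto
qed

lemma sqrt_coeff_convolution:
  "(\<Sum>k\<le>n. sqrt_coeff k * sqrt_coeff (n - k)) = (if n = 0 then 1 else if n = 1 then -1 else 0)"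
proof -
  have "(\<Sum>k\<le>n. sqrt_coeff k * sqrt_coeff (n - k))
      = (\<Sum>k\<le>n. (-1) ^ n * (((1/2) gchoose k) * ((1/2) gchoose (n - k))))"
    by (rule sum.cong) (auto simp: sqrt_coeff_def simp flip: power_add mult.assoc)
  also have "\<dots> = (-1) ^ n * ((1::real) gchoose n)"
    using gbinomial_Vandermonde[of "1/2::real" "1/2" n]
    by (simp add: atLeast0AtMost flip: sum_distrib_left)
  also have "(1::real) gchoose n = of_nat (1 choose n)" using binomial_gbinomial[of 1 n, where 'a = real] unfolding of_nat_1 by (rule sym)
  finally show ?thesis by (cases n; cases "n - 1") auto
qed

locale selfadjoint_contraction =
  fixes X :: "'a::complex_hilbert \<Rightarrow> 'a"
  assumes X: "bounded_clinear_on UNIV X"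
    and X_le: "norm (X h) \<le> norm h"
    and X_selfadj: "cinner (X x) y = cinner x (X y)"
begin

definition sqrt_series :: "'a \<Rightarrow> 'a" where
  "sqrt_series h = (\<Sum>\<^sub>\<infinity>k. sqrt_coeff k *\<^sub>R (X ^^ k) h)"

lemma norm_X_pow: "norm ((X ^^ k) h) \<le> norm h"
  by (induction k) (auto intro: order_trans[OF X_le])

lemma X_pow: "bounded_clinear_on UNIV (X ^^ k)"
  by (rule bounded_clinear_funpow[OF X])

lemma X_pow_selfadj: "cinner ((X ^^ k) x) y = cinner x ((X ^^ k) y)"
proof (induction k arbitrary: x)
  case (Suc k)
  then show ?case using X_selfadj by (simp add: funpow_swap1)
qed simp

lemma series_abs_summable: "(\<lambda>k. norm (sqrt_coeff k *\<^sub>R (X ^^ k) h)) summable_on UNIV"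
proof (rule Infinite_Sum.abs_summable_on_comparison_test)
  show "(\<lambda>k. norm (\<bar>sqrt_coeff k\<bar> * norm h)) summable_on UNIV"
    using summable_on_cmult_left[OF sqrt_coeff_abs_summable] by (simp add: abs_mult)
qed (auto simp: norm_X_pow mult_left_mono)

lemma series_has_sum: "((\<lambda>k. sqrt_coeff k *\<^sub>R (X ^^ k) h) has_sum sqrt_series h) UNIV"
  unfolding sqrt_series_def using abs_summable_summable[OF series_abs_summable] by simp

lemma linear_map_series:
  assumes "bounded_linear f"
  shows "((\<lambda>k. sqrt_coeff k *\<^sub>R f ((X ^^ k) h)) has_sum f (sqrt_series h)) UNIV"
  using has_sum_bounded_linear[OF assms series_has_sum, of h]
  by (simp add: o_def linear_scale[OF bounded_linear.linear[OF assms]])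

lemma bounded_clinear_sqrt_series: "bounded_clinear_on UNIV sqrt_series"
proof -
  have "norm (sqrt_series h) \<le> (\<Sum>\<^sub>\<infinity>k. \<bar>sqrt_coeff k\<bar>) * norm h" for h
  proof (rule norm_infsum_le[OF series_has_sum])
    show "((\<lambda>k. \<bar>sqrt_coeff k\<bar> * norm h) has_sum (\<Sum>\<^sub>\<infinity>k. \<bar>sqrt_coeff k\<bar>) * norm h) UNIV"
      by (intro has_sum_cmult_left has_sum_infsum sqrt_coeff_abs_summable)
  qed (auto simp: norm_X_pow mult_left_mono)
  moreover have "sqrt_series (x + y) = sqrt_series x + sqrt_series y" for x y
  proof (rule has_sum_unique[OF series_has_sum])
    show "((\<lambda>k. sqrt_coeff k *\<^sub>R (X ^^ k) (x + y)) has_sum sqrt_series x + sqrt_series y) UNIV"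
      using has_sum_add[OF series_has_sum[of x] series_has_sum[of y]] X_pow
      by (simp add: bounded_clinear_on_def scaleR_add_right)
  qed
  moreover have "sqrt_series (c *\<^sub>C x) = c *\<^sub>C sqrt_series x" for c x
  proof (rule has_sum_unique[OF series_has_sum])
    show "((\<lambda>k. sqrt_coeff k *\<^sub>R (X ^^ k) (c *\<^sub>C x)) has_sum c *\<^sub>C sqrt_series x) UNIV"
      using linear_map_series[OF bounded_bilinear.bounded_linear_right[OF bounded_bilinear_scaleC]]
      by (simp add: bounded_clinear_scaleC[OF X_pow])
  qed
  ultimately show ?thesis unfolding bounded_clinear_on_def by blast
qed

text \<open>After the first, the coefficients are nonpositive, and the form of X^k at
  \<open>h\<close> is at most the squared norm of \<open>h\<close>. Each partial sum is thus at
  least that squared norm times a nonnegative partial sum of coefficients.\<close>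

lemma positive_sqrt_series: "positive_on UNIV sqrt_series"
  unfolding positive_on_def
proof
  fix h
  have *: "((\<lambda>k. sqrt_coeff k *\<^sub>R cinner ((X ^^ k) h) h) has_sum cinner (sqrt_series h) h) UNIV"
    using linear_map_series[OF bounded_bilinear.bounded_linear_left[OF bounded_bilinear_cinner]] .
  have Im0: "Im (cinner ((X ^^ k) h) h) = 0" for k
    using X_pow_selfadj[of k h h] cinner_commute[of h "(X ^^ k) h"] by (simp add: complex_eq_iff)
  have "((\<lambda>k. 0) has_sum Im (cinner (sqrt_series h) h)) (UNIV :: nat set)"
    using has_sum_bounded_linear[OF bounded_linear_Im *] by (simp add: o_def Im0)
  then have Im: "Im (cinner (sqrt_series h) h) = 0" by (metis has_sum_0 has_sum_unique)
  have "(\<lambda>k. sqrt_coeff k * Re (cinner ((X ^^ k) h) h)) sums Re (cinner (sqrt_series h) h)"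
    using has_sum_imp_sums[OF has_sum_bounded_linear[OF bounded_linear_Re *]] by (simp add: o_def)
  then have lim: "(\<lambda>n. \<Sum>k\<le>n. sqrt_coeff k * Re (cinner ((X ^^ k) h) h))
      \<longlonglongrightarrow> Re (cinner (sqrt_series h) h)"
    by (simp add: sums_def_le)
  have "0 \<le> (\<Sum>k\<le>n. sqrt_coeff k * Re (cinner ((X ^^ k) h) h))" for n
  proof -
    have "0 \<le> (\<Sum>k\<le>n. sqrt_coeff k) * (norm h)\<^sup>2"
      using sum_sqrt_coeff_nonneg by simp
    also have "\<dots> \<le> (\<Sum>k\<le>n. sqrt_coeff k * Re (cinner ((X ^^ k) h) h))"
      unfolding sum_distrib_right
    proof (rule sum_mono)
      fix k
      show "sqrt_coeff k * (norm h)\<^sup>2 \<le> sqrt_coeff k * Re (cinner ((X ^^ k) h) h)"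
      proof (cases "k = 0")
        case False
        have "Re (cinner ((X ^^ k) h) h) \<le> norm ((X ^^ k) h) * norm h"
          by (metis inner_eq_Re_cinner norm_cauchy_schwarz)
        also have "\<dots> \<le> (norm h)\<^sup>2"
          by (simp add: power2_eq_square norm_X_pow mult_right_mono)
        finally show ?thesis using sqrt_coeff_nonpos False by (intro mult_left_mono_neg) auto
      qed (simp add: cinner_self)
    qed
    finally show ?thesis .
  qed
  then have "0 \<le> Re (cinner (sqrt_series h) h)" by (intro LIMSEQ_le_const[OF lim]) auto
  with Im show "cinner (sqrt_series h) h \<in> \<real>\<^sub>\<ge>\<^sub>0" by (simp add: complex_nonneg_Reals_iff)
qed

lemma sqrt_series_square: "sqrt_series (sqrt_series h) = h - X h"
proof -
  define f where "f = (\<lambda>(k, j). (sqrt_coeff k * sqrt_coeff j) *\<^sub>R (X ^^ (k + j)) h)"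
  define s where "s = (\<Sum>\<^sub>\<infinity>k. \<bar>sqrt_coeff k\<bar>)"
  have s: "((\<lambda>k. \<bar>sqrt_coeff k\<bar>) has_sum s) UNIV"
    unfolding s_def by (intro has_sum_infsum sqrt_coeff_abs_summable)
  have "(\<lambda>(k, j). \<bar>sqrt_coeff k\<bar> * \<bar>sqrt_coeff j\<bar> * norm h) summable_on UNIV \<times> UNIV"
    by (rule summable_on_SigmaI[where g = "\<lambda>k. \<bar>sqrt_coeff k\<bar> * s * norm h"])
      (auto intro!: has_sum_cmult_left has_sum_cmult_right s summable_on_cmult_left sqrt_coeff_abs_summable)
  then have "(\<lambda>p. norm (case p of (k, j) \<Rightarrow> \<bar>sqrt_coeff k\<bar> * \<bar>sqrt_coeff j\<bar> * norm h)) summable_on UNIV \<times> UNIV"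
    by (rule summable_on_cong[THEN iffD1, rotated]) (auto simp: abs_mult)
  then have "(\<lambda>p. norm (f p)) summable_on UNIV \<times> UNIV"
    by (rule Infinite_Sum.abs_summable_on_comparison_test)
      (auto simp: f_def abs_mult norm_X_pow mult_left_mono)
  then have f: "f summable_on UNIV \<times> UNIV" by (rule abs_summable_summable)
  \<comment> \<open>The Cauchy product: the double series is regrouped by the total degree
    \<open>n = k + j\<close>.\<close>
  define g where "g = (\<lambda>(n::nat, k::nat). (k, n - k))"
  have bij: "bij_betw g (SIGMA n:UNIV. {..n}) (UNIV \<times> UNIV)"
    by (rule bij_betw_byWitness[where f' = "\<lambda>(k, j). (k + j, k)"]) (auto simp: g_def)
  have fg: "(\<lambda>x. f (g x)) summable_on (SIGMA n:UNIV. {..n})"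
    using f summable_on_reindex_bij_betw[OF bij] by blast
  have "sqrt_series (sqrt_series h) = (\<Sum>\<^sub>\<infinity>k. \<Sum>\<^sub>\<infinity>j. f (k, j))"
    unfolding sqrt_series_def[of "sqrt_series h"]
  proof (rule infsum_cong)
    fix k
    show "sqrt_coeff k *\<^sub>R (X ^^ k) (sqrt_series h) = (\<Sum>\<^sub>\<infinity>j. f (k, j))"
    proof (rule infsumI[symmetric])
      have "((\<lambda>j. sqrt_coeff k *\<^sub>R (sqrt_coeff j *\<^sub>R (X ^^ k) ((X ^^ j) h)))
          has_sum sqrt_coeff k *\<^sub>R (X ^^ k) (sqrt_series h)) UNIV"
        using has_sum_bounded_linear[OF bounded_linear_scaleR_right[of "sqrt_coeff k"]
            linear_map_series[OF bounded_clinear_bounded_linear[OF X_pow], of k h]]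
        by (simp add: o_def)
      then show "((\<lambda>j. f (k, j)) has_sum sqrt_coeff k *\<^sub>R (X ^^ k) (sqrt_series h)) UNIV"
        by (simp add: f_def funpow_add)
    qed
  qed
  also have "\<dots> = infsum f (UNIV \<times> UNIV)" by (rule infsum_Sigma_banach[OF f])
  also have "\<dots> = (\<Sum>\<^sub>\<infinity>x\<in>(SIGMA n:UNIV. {..n}). f (g x))"
    by (rule infsum_reindex_bij_betw[OF bij, symmetric])
  also have "\<dots> = (\<Sum>\<^sub>\<infinity>n. \<Sum>\<^sub>\<infinity>k\<in>{..n}. f (g (n, k)))"
    by (rule infsum_Sigma_banach[OF fg, symmetric])
  also have "\<dots> = (\<Sum>\<^sub>\<infinity>n. (if n = 0 then 1 else if n = 1 then -1 else 0) *\<^sub>R (X ^^ n) h)"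
    by (rule infsum_cong)
      (auto simp: f_def g_def simp flip: scaleR_sum_left sqrt_coeff_convolution)
  also have "\<dots> = (\<Sum>\<^sub>\<infinity>n\<in>{0, 1}. (if n = 0 then 1 else if n = 1 then -1 else 0) *\<^sub>R (X ^^ n) h)"
    by (rule infsum_cong_neutral) auto
  also have "\<dots> = h - X h" by simp
  finally show ?thesis .
qed

text \<open>\<open>op_sqrt\<close> is a definite description, so uniqueness comes before any use of
  the defect operators. A second root \<open>C\<close> commutes with \<open>X\<close>, hence with
  the series, so the sum of both roots kills their difference \<open>y\<close> at \<open>x\<close>;
  two nonnegative forms with sum 0 are both 0.\<close>

lemma sqrt_unique:
  assumes C: "bounded_clinear_on UNIV C" "positive_on UNIV C" "C \<circ> C = (\<lambda>h. h - X h)"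
  shows "C = sqrt_series"
proof
  fix x
  note B = bounded_clinear_sqrt_series positive_sqrt_series
  have CC: "C (C h) = h - X h" for h using C(3) by (metis comp_apply)
  have linC: "linear C" using C(1) bounded_clinear_bounded_linear bounded_linear.linear by blast
  have linB: "linear sqrt_series" using B(1) bounded_clinear_bounded_linear bounded_linear.linear by blast
  have "C (X h) = X (C h)" for h
    using CC[of "C h"] linear_diff[OF linC, of h "X h"] by (simp add: CC)
  then have CXk: "C ((X ^^ k) h) = (X ^^ k) (C h)" for k h by (induction k) auto
  have CB: "C (sqrt_series h) = sqrt_series (C h)" for h
    using linear_map_series[OF bounded_clinear_bounded_linear[OF C(1)], of h] series_has_sum[of "C h"]
    by (simp add: CXk has_sum_unique)
  define y where "y = sqrt_series x - C x"
  have "sqrt_series y + C y = 0"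
    by (simp add: y_def linear_diff[OF linC] linear_diff[OF linB] CB CC sqrt_series_square)
  then have sum0: "cinner (sqrt_series y) y + cinner (C y) y = 0"
    by (metis cinner_add_left cinner_simps(9))
  then have "Re (cinner (sqrt_series y) y) = 0" "Re (cinner (C y) y) = 0"
    using positive_cinner_nonneg(1)[OF B(2), of y] positive_cinner_nonneg(1)[OF C(2), of y]
    by (auto simp: complex_eq_iff)
  then have "cinner (sqrt_series y) y = 0" "cinner (C y) y = 0"
    using positive_cinner_nonneg(2)[OF B(2), of y] positive_cinner_nonneg(2)[OF C(2), of y]
    by (auto simp: complex_eq_iff)
  then have "sqrt_series y = 0" "C y = 0"
    using positive_zero_form_imp_zero B C by blast+
  then have "cinner (sqrt_series x) y = 0" "cinner (C x) y = 0"
    using positive_self_adjoint[OF B, of x y] positive_self_adjoint[OF C(1,2), of x y]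
    by (simp_all add: cinner_simps)
  then have "cinner y y = 0" using cinner_simps(5)[of "sqrt_series x" "C x" y, folded y_def] by simp
  then have "y = 0" by (simp add: cinner_self)
  then show "C x = sqrt_series x" by (simp add: y_def)
qed

lemma op_sqrt_eq: "op_sqrt (\<lambda>h. h - X h) = sqrt_series"
  unfolding op_sqrt_def
proof (rule the_equality)
  show "bounded_clinear_on UNIV sqrt_series \<and> positive_on UNIV sqrt_series \<and>
      sqrt_series \<circ> sqrt_series = (\<lambda>h. h - X h)"
    by (simp add: bounded_clinear_sqrt_series positive_sqrt_series sqrt_series_square fun_eq_iff)
qed (blast intro: sqrt_unique)

end

section \<open>Multi-indices\<close>

definition mi_inc :: "('n \<Rightarrow> nat) \<Rightarrow> 'n \<Rightarrow> 'n \<Rightarrow> nat" where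
  "mi_inc \<alpha> i = \<alpha>(i := Suc (\<alpha> i))"

definition mi_dec :: "('n \<Rightarrow> nat) \<Rightarrow> 'n \<Rightarrow> 'n \<Rightarrow> nat" where
  "mi_dec \<alpha> i = \<alpha>(i := \<alpha> i - 1)"

lemma mi_inc_dec: "\<alpha> i > 0 \<Longrightarrow> mi_inc (mi_dec \<alpha> i) i = \<alpha>"
  and mi_dec_inc: "mi_dec (mi_inc \<alpha> i) i = \<alpha>"
  and mi_inc_pos: "mi_inc \<alpha> i i > 0"
  by (auto simp: mi_inc_def mi_dec_def)

lemma mi_size_inc [simp]: "mi_size (mi_inc \<alpha> i) = Suc (mi_size \<alpha>)"
  by (simp add: mi_size_def mi_inc_def sum.remove[of UNIV i] cong: sum.cong_simp)

lemma mi_size_dec: "\<alpha> i > 0 \<Longrightarrow> Suc (mi_size (mi_dec \<alpha> i)) = mi_size \<alpha>"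
  by (metis mi_inc_dec mi_size_inc)

lemma mi_size_0_iff: "mi_size \<alpha> = 0 \<longleftrightarrow> \<alpha> = (\<lambda>_. 0)"
  by (auto simp: mi_size_def fun_eq_iff)

lemma mi_size_SucE:
  assumes "mi_size \<alpha> = Suc k"
  obtains \<beta> i where "mi_size \<beta> = k" "\<alpha> = mi_inc \<beta> i"
proof -
  obtain i where "\<alpha> i > 0" using assms by (force simp: mi_size_def)
  then show ?thesis using that[of "mi_dec \<alpha> i" i] assms mi_size_dec[of \<alpha> i] mi_inc_dec[of \<alpha> i] by auto
qed

lemma finite_mi_size_le: "finite {\<alpha> :: 'n::finite \<Rightarrow> nat. mi_size \<alpha> \<le> k}"
proof (rule finite_subset)
  show "{\<alpha> :: 'n \<Rightarrow> nat. mi_size \<alpha> \<le> k} \<subseteq> PiE UNIV (\<lambda>_. {..k})"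
  proof (intro subsetI PiE_I)
    fix \<alpha> :: "'n \<Rightarrow> nat" and i assume "\<alpha> \<in> {\<alpha>. mi_size \<alpha> \<le> k}"
    then show "\<alpha> i \<in> {..k}" using member_le_sum[of i UNIV \<alpha>] by (simp add: mi_size_def)
  qed simp
qed (simp add: finite_PiE)

lemma finite_mi_size: "finite {\<alpha> :: 'n::finite \<Rightarrow> nat. mi_size \<alpha> = k}"
  by (rule finite_subset[OF _ finite_mi_size_le[of k]]) auto

lemma finite_mi_size_less: "finite {\<alpha> :: 'n::finite \<Rightarrow> nat. mi_size \<alpha> < k}"
  by (rule finite_subset[OF _ finite_mi_size_le[of k]]) auto

lemma sum_mi_size_less_Suc:
  "(\<Sum>\<alpha> | mi_size \<alpha> < Suc k. f \<alpha>) = (\<Sum>\<alpha> | mi_size \<alpha> < k. f \<alpha>) + (\<Sum>\<alpha> | mi_size \<alpha> = k. f \<alpha>)"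
  by (subst sum.union_disjoint[symmetric])
    (auto simp: finite_mi_size finite_mi_size_less intro!: sum.cong)

lemma sum_mi_size_0: "(\<Sum>\<alpha> | mi_size \<alpha> = 0. f \<alpha>) = f (\<lambda>_. 0)"
  by (simp add: mi_size_0_iff)

lemma mi_gamma_pos: "mi_gamma \<alpha> > 0"
  by (simp add: mi_gamma_def prod_pos)

lemma mi_gamma_0: "mi_gamma (\<lambda>_. 0) = 1"
  by (simp add: mi_gamma_def mi_size_def)

lemma mi_gamma_dec:
  assumes "\<alpha> i > 0"
  shows "mi_gamma (mi_dec \<alpha> i) = mi_gamma \<alpha> * real (\<alpha> i) / real (mi_size \<alpha>)"
proof -
  have size: "mi_size \<alpha> = Suc (mi_size (mi_dec \<alpha> i))" using mi_size_dec[of \<alpha> i] assms by simp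
  have "(\<Prod>j\<in>UNIV. fact (\<alpha> j)) = fact (\<alpha> i) * (\<Prod>j\<in>UNIV - {i}. fact (\<alpha> j) :: real)"
    by (rule prod.remove) auto
  moreover have "(\<Prod>j\<in>UNIV. fact (mi_dec \<alpha> i j)) = fact (\<alpha> i - 1) * (\<Prod>j\<in>UNIV - {i}. fact (\<alpha> j) :: real)"
    by (subst prod.remove[of _ i]) (auto simp: mi_dec_def)
  moreover have "fact (\<alpha> i) = real (\<alpha> i) * fact (\<alpha> i - 1)" using assms by (simp add: fact_reduce)
  moreover have "(\<Prod>j\<in>UNIV - {i}. fact (\<alpha> j) :: real) > 0" by (simp add: prod_pos)
  moreover have "fact (mi_size \<alpha>) = real (mi_size \<alpha>) * fact (mi_size (mi_dec \<alpha> i))"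
    by (simp add: size)
  ultimately show ?thesis using assms by (simp add: mi_gamma_def size divide_simps)
qed

text \<open>\<open>mi_gamma \<alpha>\<close> counts the words in which the letter \<open>i\<close>
  occurs \<open>\<alpha> i\<close> times; the identity sorts them by their last letter.\<close>

lemma mi_gamma_rec:
  assumes "mi_size \<alpha> > 0"
  shows "(\<Sum>i | \<alpha> i > 0. mi_gamma (mi_dec \<alpha> i)) = mi_gamma \<alpha>"
proof -
  have "(\<Sum>i | \<alpha> i > 0. mi_gamma (mi_dec \<alpha> i)) = (\<Sum>i | \<alpha> i > 0. mi_gamma \<alpha> * real (\<alpha> i) / real (mi_size \<alpha>))"
    by (rule sum.cong) (auto simp: mi_gamma_dec)
  also have "\<dots> = (\<Sum>i\<in>UNIV. mi_gamma \<alpha> * real (\<alpha> i) / real (mi_size \<alpha>))"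
    by (rule sum.mono_neutral_left) auto
  also have "\<dots> = mi_gamma \<alpha> * real (mi_size \<alpha>) / real (mi_size \<alpha>)"
    by (simp add: mi_size_def sum_distrib_left sum_divide_distrib)
  finally show ?thesis using assms by simp
qed

text \<open>The passage from one degree to the next in all later telescoping sums:
  \<open>\<beta>\<close> is reached from each \<open>mi_dec \<beta> i\<close>, and by
  \<open>mi_gamma_rec\<close> their weights add up to its own.\<close>

lemma sum_mi_gamma_Suc:
  fixes g :: "('n::finite \<Rightarrow> nat) \<Rightarrow> 'b::real_vector"
  shows "(\<Sum>\<beta> | mi_size \<beta> = Suc k. mi_gamma \<beta> *\<^sub>R g \<beta>)
    = (\<Sum>\<alpha> | mi_size \<alpha> = k. mi_gamma \<alpha> *\<^sub>R (\<Sum>i\<in>UNIV. g (mi_inc \<alpha> i)))"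
proof -
  have "(\<Sum>\<alpha> | mi_size \<alpha> = k. mi_gamma \<alpha> *\<^sub>R (\<Sum>i\<in>UNIV. g (mi_inc \<alpha> i)))
      = (\<Sum>(\<alpha>, i)\<in>{\<alpha>. mi_size \<alpha> = k} \<times> UNIV. mi_gamma \<alpha> *\<^sub>R g (mi_inc \<alpha> i))"
    by (simp add: scaleR_sum_right sum.cartesian_product)
  also have "\<dots> = (\<Sum>(\<beta>, i)\<in>(SIGMA \<beta>:{\<beta>. mi_size \<beta> = Suc k}. {i. \<beta> i > 0}).
      mi_gamma (mi_dec \<beta> i) *\<^sub>R g \<beta>)"
    by (rule sum.reindex_bij_witness[where i = "\<lambda>(\<beta>, i). (mi_dec \<beta> i, i)" and j = "\<lambda>(\<alpha>, i). (mi_inc \<alpha> i, i)"])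
      (auto simp: mi_inc_dec mi_dec_inc mi_inc_pos dest: mi_size_dec)
  also have "\<dots> = (\<Sum>\<beta> | mi_size \<beta> = Suc k. \<Sum>i | \<beta> i > 0. mi_gamma (mi_dec \<beta> i) *\<^sub>R g \<beta>)"
    by (rule sum.Sigma[symmetric]) (auto simp: finite_mi_size)
  also have "\<dots> = (\<Sum>\<beta> | mi_size \<beta> = Suc k. mi_gamma \<beta> *\<^sub>R g \<beta>)"
    by (rule sum.cong) (auto simp: mi_gamma_rec simp flip: scaleR_sum_left)
  finally show ?thesis by simp
qed

lemma mi_power_inc: "mi_power z (mi_inc \<alpha> i) = z $ i * mi_power z \<alpha>"
  unfolding mi_power_def
  by (subst (1 2) prod.remove[of UNIV i]) (auto simp: mi_inc_def)

lemma mi_power_0: "mi_power z (\<lambda>_. 0) = 1"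
  by (simp add: mi_power_def)

lemma mi_power_scaleR: "mi_power (t *\<^sub>R z) \<alpha> = of_real (t ^ mi_size \<alpha>) * mi_power z \<alpha>"
  by (simp add: mi_power_def mi_size_def scaleR_conv_of_real[where 'a = complex] power_mult_distrib prod.distrib power_sum)

section \<open>Vector-valued polynomials\<close>

text \<open>With \<open>C = 0\<close> this is the identity theorem for polynomials; with an error
  term it reads off the coefficients of an expansion without differentiating. The constant
  coefficient is the limit at 0, and then a factor \<open>t\<close> is divided out.\<close>

lemma poly_small_coeffs_zero:
  fixes p :: "nat \<Rightarrow> 'a::real_normed_vector"
  assumes "\<delta> > 0"
    and "\<And>t. 0 < t \<Longrightarrow> t < \<delta> \<Longrightarrow> norm (\<Sum>i\<le>k. t ^ i *\<^sub>R p i) \<le> C * t ^ Suc k"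
    and "i \<le> k"
  shows "p i = 0"
proof -
  have p0: "q 0 = 0" if "\<And>t. 0 < t \<Longrightarrow> t < \<delta> \<Longrightarrow> norm (\<Sum>i\<le>k. t ^ i *\<^sub>R q i) \<le> C * t ^ Suc k"
    for q :: "nat \<Rightarrow> 'a" and k
  proof -
    have "((\<lambda>t. \<Sum>i\<le>k. t ^ i *\<^sub>R q i) \<longlongrightarrow> (\<Sum>i\<le>k. 0 ^ i *\<^sub>R q i)) (at_right (0::real))"
      by (intro tendsto_intros)
    moreover have "(\<Sum>i\<le>k. (0::real) ^ i *\<^sub>R q i) = q 0"
      by (simp add: sum.atMost_shift)
    ultimately have lim: "((\<lambda>t. \<Sum>i\<le>k. t ^ i *\<^sub>R q i) \<longlongrightarrow> q 0) (at_right (0::real))" by simp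
    have "((\<lambda>t. C * t ^ Suc k) \<longlongrightarrow> C * 0 ^ Suc k) (at_right (0::real))"
      by (intro tendsto_intros)
    then have "((\<lambda>t. C * t ^ Suc k) \<longlongrightarrow> 0) (at_right (0::real))" by simp
    then have "((\<lambda>t. \<Sum>i\<le>k. t ^ i *\<^sub>R q i) \<longlongrightarrow> 0) (at_right (0::real))"
    proof (rule Lim_null_comparison[rotated])
      show "eventually (\<lambda>t. norm (\<Sum>i\<le>k. t ^ i *\<^sub>R q i) \<le> C * t ^ Suc k) (at_right 0)"
        unfolding eventually_at_right_field using assms(1) that by blast
    qed
    then show ?thesis using tendsto_unique[OF _ lim] by simp
  qed
  show ?thesis using assms(2,3)
  proof (induction k arbitrary: p i)
    case 0
    then have "p 0 = 0" by (intro p0[where k = 0]) blast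
    then show ?case using 0 by simp
  next
    case (Suc k)
    have "p 0 = 0" by (rule p0[where k = "Suc k"]) (rule Suc.prems(1))
    show ?case
    proof (cases i)
      case 0
      then show ?thesis using \<open>p 0 = 0\<close> by simp
    next
      case i: (Suc j)
      show ?thesis unfolding i
      proof (rule Suc.IH[where p = "\<lambda>i. p (Suc i)"])
        fix t assume t: "0 < t" "t < \<delta>"
        have "(\<Sum>i\<le>Suc k. t ^ i *\<^sub>R p i) = t *\<^sub>R (\<Sum>i\<le>k. t ^ i *\<^sub>R p (Suc i))"
          unfolding sum.atMost_Suc_shift by (simp add: \<open>p 0 = 0\<close> scaleR_sum_right)
        then have "t * norm (\<Sum>i\<le>k. t ^ i *\<^sub>R p (Suc i)) \<le> t * (C * t ^ Suc k)"
          using Suc.prems(1)[OF t] t by (simp add: algebra_simps)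
        then show "norm (\<Sum>i\<le>k. t ^ i *\<^sub>R p (Suc i)) \<le> C * t ^ Suc k" using t by simp
      qed (use Suc.prems(2) i in simp)
    qed
  qed
qed

text \<open>Pairing with \<open>q j\<close> itself reduces to real power series. There a factor
  \<open>t\<close> is divided out for \<open>t \<noteq> 0\<close>, and the value at 0 is recovered
  by continuity.\<close>

lemma powser_sums_zero_coeffs_zero:
  fixes q :: "nat \<Rightarrow> 'a::real_inner"
  assumes "\<And>t. \<bar>t\<bar> < 1 \<Longrightarrow> (\<lambda>j. t ^ j *\<^sub>R q j) sums 0"
  shows "q j = 0"
proof -
  have main: "a j = 0" if "\<And>t. \<bar>t\<bar> < 1 \<Longrightarrow> (\<lambda>j. a j * t ^ j) sums 0" for a :: "nat \<Rightarrow> real"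
    using that
  proof (induction j arbitrary: a)
    case 0
    have "((\<lambda>_. 0) \<longlongrightarrow> a 0) (at (0::real))"
      by (rule powser_limit_0_strong[of 1]) (use 0 in auto)
    then show ?case using LIM_unique tendsto_const by blast
  next
    case (Suc j)
    have "((\<lambda>_. 0) \<longlongrightarrow> a 0) (at (0::real))"
      by (rule powser_limit_0_strong[of 1]) (use Suc.prems in auto)
    then have a0: "a 0 = 0" using LIM_unique tendsto_const by blast
    have nz: "(\<lambda>j. a (Suc j) * t ^ j) sums 0" if "\<bar>t\<bar> < 1" "t \<noteq> 0" for t
    proof -
      have "(\<lambda>j. a (Suc j) * t ^ Suc j) sums 0"
        using Suc.prems[OF that(1)] sums_Suc_iff[of "\<lambda>j. a j * t ^ j" 0] a0 by simp
      then have "(\<lambda>j. inverse t * (a (Suc j) * t ^ Suc j)) sums (inverse t * 0)" by (rule sums_mult)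
      then show ?thesis using that(2) by (simp add: field_simps)
    qed
    have "((\<lambda>_. 0) \<longlongrightarrow> a (Suc 0)) (at (0::real))"
      by (rule powser_limit_0_strong[of 1]) (use nz in auto)
    then have "a (Suc 0) = 0" using LIM_unique tendsto_const by blast
    then have "(\<lambda>j. a (Suc j) * t ^ j) sums 0" if "\<bar>t\<bar> < 1" for t
      using nz[OF that] powser_sums_zero[of "\<lambda>j. a (Suc j)"] by (cases "t = 0") auto
    then show ?case using Suc.IH[of "\<lambda>j. a (Suc j)"] by blast
  qed
  have "(\<lambda>k. inner (q k) (q j) * t ^ k) sums 0" if "\<bar>t\<bar> < 1" for t
    using bounded_linear.sums[OF bounded_linear_inner_left assms[OF that], of "q j"]
    by (simp add: mult.commute)
  then have "inner (q j) (q j) = 0" by (rule main)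
  then show ?thesis by simp
qed

text \<open>Induction on the set of variables: with the others held fixed, the sum is a one-variable
  polynomial in a real value of \<open>w i\<close>, so the exponent of \<open>i\<close> can be
  frozen at \<open>\<rho> i\<close>. Once all variables are treated, a single term is left.\<close>

lemma mi_poly_coeffs_zero_aux:
  fixes c :: "('n::finite \<Rightarrow> nat) \<Rightarrow> 'a::complex_hilbert"
  assumes "finite I"
  shows "finite F \<Longrightarrow> (\<And>w :: 'n \<Rightarrow> complex. (\<Sum>\<alpha>\<in>F. (\<Prod>i\<in>I. w i ^ \<alpha> i) *\<^sub>C c \<alpha>) = 0) \<Longrightarrow>
    (\<Sum>\<alpha> | \<alpha> \<in> F \<and> (\<forall>i\<in>I. \<alpha> i = \<rho> i). c \<alpha>) = 0"
  using assms
proof (induction I arbitrary: F rule: finite_induct)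
  case empty
  from empty(2)[of undefined] show ?case by (simp add: scaleC_one)
next
  case (insert i I)
  have "(\<Sum>\<alpha> | \<alpha> \<in> F \<and> \<alpha> i = \<rho> i. (\<Prod>j\<in>I. w j ^ \<alpha> j) *\<^sub>C c \<alpha>) = 0" for w :: "'n \<Rightarrow> complex"
  proof -
    define p where "p k = (\<Sum>\<alpha> | \<alpha> \<in> F \<and> \<alpha> i = k. (\<Prod>j\<in>I. w j ^ \<alpha> j) *\<^sub>C c \<alpha>)" for k
    define N where "N = Max (insert (\<rho> i) ((\<lambda>\<alpha>. \<alpha> i) ` F))"
    have K_ge: "\<rho> i \<le> N" "\<And>\<alpha>. \<alpha> \<in> F \<Longrightarrow> \<alpha> i \<le> N" using \<open>finite F\<close> by (auto simp: N_def)
    have "(\<Sum>k\<le>N. t ^ k *\<^sub>R p k) = 0" for t :: real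
    proof -
      define w' where "w' = w(i := complex_of_real t)"
      have tm: "(\<Prod>j\<in>insert i I. w' j ^ \<alpha> j) *\<^sub>C c \<alpha> = t ^ \<alpha> i *\<^sub>R ((\<Prod>j\<in>I. w j ^ \<alpha> j) *\<^sub>C c \<alpha>)" for \<alpha>
      proof -
        have "(\<Prod>j\<in>I. w' j ^ \<alpha> j) = (\<Prod>j\<in>I. w j ^ \<alpha> j)"
          using insert.hyps by (intro prod.cong) (auto simp: w'_def)
        then show ?thesis using insert.hyps
          by (simp add: w'_def scaleC_scaleC flip: scaleC_of_real)
      qed
      have "0 = (\<Sum>\<alpha>\<in>F. t ^ \<alpha> i *\<^sub>R ((\<Prod>j\<in>I. w j ^ \<alpha> j) *\<^sub>C c \<alpha>))"
        using insert.prems(2)[of w'] by (simp only: tm)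
      also have "\<dots> = (\<Sum>k\<le>N. \<Sum>\<alpha> | \<alpha> \<in> F \<and> \<alpha> i = k. t ^ \<alpha> i *\<^sub>R ((\<Prod>j\<in>I. w j ^ \<alpha> j) *\<^sub>C c \<alpha>))"
        by (rule sum.group[symmetric]) (use K_ge \<open>finite F\<close> in auto)
      also have "\<dots> = (\<Sum>k\<le>N. t ^ k *\<^sub>R p k)"
        unfolding p_def scaleR_sum_right by (intro sum.cong) auto
      finally show ?thesis by simp
    qed
    then have "p (\<rho> i) = 0" using poly_small_coeffs_zero[where \<delta> = 1 and k = N and p = p and C = 0 and i = "\<rho> i"] K_ge by simp
    then show ?thesis by (simp add: p_def)
  qed
  then have "(\<Sum>\<alpha> | \<alpha> \<in> {\<alpha> \<in> F. \<alpha> i = \<rho> i} \<and> (\<forall>j\<in>I. \<alpha> j = \<rho> j). c \<alpha>) = 0"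
    using insert.IH[of "{\<alpha> \<in> F. \<alpha> i = \<rho> i}"] \<open>finite F\<close> by simp
  moreover have "{\<alpha>. \<alpha> \<in> {\<alpha> \<in> F. \<alpha> i = \<rho> i} \<and> (\<forall>j\<in>I. \<alpha> j = \<rho> j)}
      = {\<alpha>. \<alpha> \<in> F \<and> (\<forall>j\<in>insert i I. \<alpha> j = \<rho> j)}" by auto
  ultimately show ?case by simp
qed

lemma mi_poly_coeffs_zero:
  fixes c :: "('n::finite \<Rightarrow> nat) \<Rightarrow> 'a::complex_hilbert"
  assumes "finite F" "\<And>z. (\<Sum>\<alpha>\<in>F. mi_power z \<alpha> *\<^sub>C c \<alpha>) = 0" "\<alpha> \<in> F"
  shows "c \<alpha> = 0"
proof -
  have "(\<Sum>\<beta>\<in>F. (\<Prod>i\<in>UNIV. w i ^ \<beta> i) *\<^sub>C c \<beta>) = 0" for w :: "'n \<Rightarrow> complex"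
    using assms(2)[of "\<chi> i. w i"] by (simp add: mi_power_def)
  then have "(\<Sum>\<beta> | \<beta> \<in> F \<and> (\<forall>i\<in>UNIV. \<beta> i = \<alpha> i). c \<beta>) = 0"
    by (intro mi_poly_coeffs_zero_aux assms) auto
  moreover have "{\<beta>. \<beta> \<in> F \<and> (\<forall>i\<in>UNIV. \<beta> i = \<alpha> i)} = {\<alpha>}" using assms(3) by auto
  ultimately show ?thesis by simp
qed

section \<open>Powers of commuting tuples\<close>

text \<open>The algebraic half of \<open>commuting_tuple\<close>, so that the facts on powers serve
  a tuple and its adjoint tuple on a subspace alike.\<close>

definition commuting_maps :: "'a set \<Rightarrow> ('n \<Rightarrow> 'a \<Rightarrow> 'a) \<Rightarrow> bool" where
  "commuting_maps S X \<longleftrightarrow>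
     (\<forall>i. \<forall>x\<in>S. X i x \<in> S) \<and> (\<forall>i j. \<forall>x\<in>S. X i (X j x) = X j (X i x))"

lemma op_power_invariant:
  assumes "\<And>i x. x \<in> S \<Longrightarrow> X i x \<in> S" "x \<in> S"
  shows "op_power X \<alpha> x \<in> S"
proof -
  have pow: "(X i ^^ k) y \<in> S" if "y \<in> S" for i k y
    using that assms(1) by (induction k) auto
  have "foldr (\<lambda>i f. (X i ^^ \<alpha> i) \<circ> f) xs id x \<in> S" for xs
    by (induction xs) (auto simp: assms(2) pow)
  then show ?thesis unfolding op_power_def .
qed

text \<open>With \<open>L\<close> a member of the tuple this gives commutation with powers; with
  \<open>L\<close> a projection it gives the powers of a compression.\<close>

lemma op_power_intertwine:
  assumes "\<And>i x. x \<in> S \<Longrightarrow> X i x \<in> S" "\<And>i x. x \<in> S \<Longrightarrow> L (X i x) = Y i (L x)" "x \<in> S"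
  shows "L (op_power X \<alpha> x) = op_power Y \<alpha> (L x)"
proof -
  have pow: "(X i ^^ k) y \<in> S \<and> L ((X i ^^ k) y) = (Y i ^^ k) (L y)" if "y \<in> S" for i k y
    using that assms(1,2) by (induction k) auto
  have "foldr (\<lambda>i f. (X i ^^ \<alpha> i) \<circ> f) xs id x \<in> S \<and>
      L (foldr (\<lambda>i f. (X i ^^ \<alpha> i) \<circ> f) xs id x) = foldr (\<lambda>i f. (Y i ^^ \<alpha> i) \<circ> f) xs id (L x)" for xs
    by (induction xs) (auto simp: assms(3) pow)
  then show ?thesis unfolding op_power_def by blast
qed

lemma op_power_0: "op_power X (\<lambda>_. 0) x = x"
proof -
  have "foldr (\<lambda>i f. (X i ^^ 0) \<circ> f) xs id x = x" for xs by (induction xs) auto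
  then show ?thesis unfolding op_power_def .
qed

lemma op_power_commute:
  assumes "commuting_maps S X" "x \<in> S"
  shows "X i (op_power X \<alpha> x) = op_power X \<alpha> (X i x)"
  using assms by (intro op_power_intertwine[of S]) (auto simp: commuting_maps_def)

text \<open>The extra factor stands inside the ordered product; commutativity carries it past the
  factors to its right until it acts first.\<close>

lemma op_power_inc:
  fixes X :: "'n::{finite,linorder} \<Rightarrow> 'a \<Rightarrow> 'a"
  assumes "commuting_maps S X" "x \<in> S"
  shows "op_power X (mi_inc \<alpha> i) x = op_power X \<alpha> (X i x)"
proof -
  define F where "F \<beta> xs = foldr (\<lambda>i f. (X i ^^ \<beta> i) \<circ> f) xs id" for \<beta> :: "'n \<Rightarrow> nat" and xs
  have pow: "(X j ^^ k) y \<in> S \<and> X i ((X j ^^ k) y) = (X j ^^ k) (X i y)" if "y \<in> S" for j k y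
    using that
  proof (induction k)
    case (Suc k)
    then have "X i (X j ((X j ^^ k) y)) = X j (X i ((X j ^^ k) y))"
      using assms(1) unfolding commuting_maps_def by blast
    moreover have "X j ((X j ^^ k) y) \<in> S" using Suc assms(1) by (simp add: commuting_maps_def)
    ultimately show ?case using Suc by simp
  qed simp
  have comm: "F \<alpha> xs x \<in> S \<and> X i (F \<alpha> xs x) = F \<alpha> xs (X i x)" for xs
    by (induction xs) (use assms pow in \<open>auto simp: F_def commuting_maps_def\<close>)
  have "F (mi_inc \<alpha> i) xs x = (if i \<in> set xs then F \<alpha> xs (X i x) else F \<alpha> xs x)" if "distinct xs" for xs
    using that
  proof (induction xs)
    case (Cons j xs)
    show ?case
    proof (cases "i = j")
      case True
      then have "F (mi_inc \<alpha> i) (j # xs) x = (X i ^^ \<alpha> i) (X i (F \<alpha> xs x))"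
        using Cons by (simp add: F_def mi_inc_def funpow_swap1)
      also have "\<dots> = F \<alpha> (j # xs) (X i x)" using comm[of xs] True by (simp add: F_def)
      finally show ?thesis using True by simp
    next
      case False
      then show ?thesis using Cons by (auto simp: F_def mi_inc_def)
    qed
  qed (simp add: F_def)
  then show ?thesis by (simp add: op_power_def F_def)
qed

text \<open>Adjoints reverse the order of the factors, so commutativity is what makes the adjoint of
  a power a power in the same fixed order.\<close>

lemma cinner_op_power:
  fixes X :: "'n::{finite,linorder} \<Rightarrow> 'a::complex_hilbert \<Rightarrow> 'a"
  assumes X: "commuting_maps S X" and Y: "commuting_maps S Y"
    and XY: "\<And>i x y. x \<in> S \<Longrightarrow> y \<in> S \<Longrightarrow> cinner (X i x) y = cinner x (Y i y)"
    and xy: "x \<in> S" "y \<in> S"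
  shows "cinner (op_power X \<alpha> x) y = cinner x (op_power Y \<alpha> y)"
  using xy
proof (induction "mi_size \<alpha>" arbitrary: \<alpha> x y)
  case 0
  then have "\<alpha> = (\<lambda>_. 0)" using mi_size_0_iff by metis
  then show ?case by (simp add: op_power_0)
next
  case (Suc k)
  from Suc.hyps(2)[symmetric] obtain \<beta> i where \<beta>: "mi_size \<beta> = k" "\<alpha> = mi_inc \<beta> i"
    by (rule mi_size_SucE)
  have "X i x \<in> S" "op_power Y \<beta> y \<in> S"
    using X Y Suc.prems op_power_invariant[of S Y y \<beta>] by (auto simp: commuting_maps_def)
  then show ?case
    using Suc.prems Suc.hyps(1)[of \<beta> "X i x" y] \<beta> XY[of x "op_power Y \<beta> y" i]
    by (simp add: op_power_inc[OF X] op_power_inc[OF Y] op_power_commute[OF Y])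
qed

lemma bounded_clinear_op_power:
  fixes X :: "'n::{finite,linorder} \<Rightarrow> 'a::complex_hilbert \<Rightarrow> 'a"
  assumes "\<And>i. bounded_clinear_on UNIV (X i)"
  shows "bounded_clinear_on UNIV (op_power X \<alpha>)"
proof -
  have "bounded_clinear_on UNIV (foldr (\<lambda>i f. (X i ^^ \<alpha> i) \<circ> f) xs id)" for xs
  proof (induction xs)
    case Nil
    then show ?case using bounded_clinear_id by (simp add: id_def)
  next
    case (Cons i xs)
    show ?case
      using bounded_clinear_comp[OF bounded_clinear_funpow[OF assms] Cons.IH] by (simp add: comp_def)
  qed
  then show ?thesis unfolding op_power_def .
qed

lemma multinomial_op_power:
  fixes X :: "'n::{finite,linorder} \<Rightarrow> 'a::complex_hilbert \<Rightarrow> 'a"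
  assumes X: "\<And>i. bounded_clinear_on UNIV (X i)" and comm: "commuting_maps UNIV X"
  shows "((\<lambda>x. \<Sum>i\<in>UNIV. (z $ i) *\<^sub>C X i x) ^^ k) h
    = (\<Sum>\<alpha> | mi_size \<alpha> = k. mi_gamma \<alpha> *\<^sub>R (mi_power z \<alpha> *\<^sub>C op_power X \<alpha> h))"
proof (induction k)
  case 0
  then show ?case by (simp add: sum_mi_size_0 mi_gamma_0 mi_power_0 op_power_0 scaleC_one)
next
  case (Suc k)
  let ?g = "\<lambda>\<alpha>. mi_power z \<alpha> *\<^sub>C op_power X \<alpha> h"
  let ?f = "\<lambda>x. \<Sum>i\<in>UNIV. (z $ i) *\<^sub>C X i x"
  have lin: "linear ?f"
    using X by (intro bounded_linear.linear[OF bounded_clinear_bounded_linear] bounded_clinear_sum bounded_clinear_scaled) auto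
  have step: "?f (?g \<alpha>) = (\<Sum>i\<in>UNIV. ?g (mi_inc \<alpha> i))" for \<alpha>
    by (simp add: mi_power_inc op_power_inc[OF comm] op_power_commute[OF comm] bounded_clinear_scaleC[OF X]
        scaleC_scaleC)
  have "(?f ^^ Suc k) h = (\<Sum>\<alpha> | mi_size \<alpha> = k. mi_gamma \<alpha> *\<^sub>R ?f (?g \<alpha>))"
    using Suc by (simp add: linear_sum[OF lin] linear_scale[OF lin])
  also have "\<dots> = (\<Sum>\<beta> | mi_size \<beta> = Suc k. mi_gamma \<beta> *\<^sub>R ?g \<beta>)"
    unfolding step by (rule sum_mi_gamma_Suc[symmetric])
  finally show ?case .
qed

section \<open>Masses of the powers of a tuple, degree by degree\<close>

definition mass :: "('n::{finite,linorder} \<Rightarrow> 'a::complex_hilbert \<Rightarrow> 'a) \<Rightarrow> nat \<Rightarrow> 'a \<Rightarrow> real" where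
  "mass A k h = (\<Sum>\<alpha> | mi_size \<alpha> = k. mi_gamma \<alpha> * (norm (op_power A \<alpha> h))\<^sup>2)"

lemma mass_0: "mass A 0 h = (norm h)\<^sup>2"
  by (simp add: mass_def sum_mi_size_0 mi_gamma_0 op_power_0)

lemma mass_nonneg: "0 \<le> mass A k h"
  unfolding mass_def by (intro sum_nonneg mult_nonneg_nonneg) (auto intro: less_imp_le mi_gamma_pos)

lemma mass_Suc:
  assumes "commuting_maps S A" "h \<in> S"
  shows "mass A (Suc k) h = (\<Sum>i\<in>UNIV. mass A k (A i h))"
proof -
  have "mass A (Suc k) h = (\<Sum>\<alpha> | mi_size \<alpha> = k. \<Sum>i\<in>UNIV. mi_gamma \<alpha> * (norm (op_power A \<alpha> (A i h)))\<^sup>2)"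
    using sum_mi_gamma_Suc[of "\<lambda>\<alpha>. (norm (op_power A \<alpha> h))\<^sup>2" k]
    by (simp add: mass_def op_power_inc[OF assms] sum_distrib_left)
  also have "\<dots> = (\<Sum>i\<in>UNIV. mass A k (A i h))" unfolding mass_def by (rule sum.swap)
  finally show ?thesis .
qed

text \<open>\<open>P\<close> is the defect of the tuple, later \<open>D\<close> for T and the
  projection onto \<N> for its compression. It measures what one step loses, so its weighted sum
  over degree \<open>k\<close> is the loss of mass from \<open>k\<close> to
  \<open>Suc k\<close>.\<close>

lemma mass_diff:
  assumes A: "commuting_maps S A" and h: "h \<in> S"
    and P: "\<And>y. y \<in> S \<Longrightarrow> (norm (P y))\<^sup>2 = (norm y)\<^sup>2 - (\<Sum>i\<in>UNIV. (norm (A i y))\<^sup>2)"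
  shows "(\<Sum>\<alpha> | mi_size \<alpha> = k. mi_gamma \<alpha> * (norm (P (op_power A \<alpha> h)))\<^sup>2) = mass A k h - mass A (Suc k) h"
proof -
  have inv: "op_power A \<alpha> h \<in> S" for \<alpha>
    using A h op_power_invariant[of S A h \<alpha>] by (auto simp: commuting_maps_def)
  show ?thesis
    using sum_mi_gamma_Suc[of "\<lambda>\<alpha>. (norm (op_power A \<alpha> h))\<^sup>2" k]
    by (simp add: mass_def op_power_inc[OF A h] op_power_commute[OF A h, symmetric] P[OF inv]
        right_diff_distrib sum_subtractf)
qed

text \<open>Stands in for the triangle inequality of the seminorm whose square is the mass; the
  factor 2 is harmless in limits.\<close>

lemma mass_parallelogram_le:
  fixes A :: "'n::{finite,linorder} \<Rightarrow> 'a::complex_hilbert \<Rightarrow> 'a"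
  assumes "\<And>i. bounded_clinear_on UNIV (A i)"
  shows "mass A k (x + y) \<le> 2 * mass A k x + 2 * mass A k y"
proof -
  have "(norm (u + v))\<^sup>2 \<le> 2 * (norm u)\<^sup>2 + 2 * (norm v)\<^sup>2" for u v :: 'a
    using zero_le_power2[of "norm (u - v)"]
    by (simp add: power2_norm_eq_inner inner_simps inner_commute)
  then have *: "mi_gamma \<alpha> * (norm (op_power A \<alpha> (x + y)))\<^sup>2
      \<le> mi_gamma \<alpha> * (2 * (norm (op_power A \<alpha> x))\<^sup>2 + 2 * (norm (op_power A \<alpha> y))\<^sup>2)" for \<alpha>
    using bounded_clinear_op_power[of A \<alpha>, OF assms] mi_gamma_pos[of \<alpha>]
    by (auto simp: bounded_clinear_on_def intro!: mult_left_mono)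
  have "mass A k (x + y) \<le> (\<Sum>\<alpha> | mi_size \<alpha> = k. mi_gamma \<alpha> * (2 * (norm (op_power A \<alpha> x))\<^sup>2 + 2 * (norm (op_power A \<alpha> y))\<^sup>2))"
    unfolding mass_def by (rule sum_mono) (rule *)
  also have "\<dots> = 2 * mass A k x + 2 * mass A k y"
    by (simp add: mass_def sum_distrib_left sum.distrib algebra_simps)
  finally show ?thesis .
qed

lemma mass_scaleC:
  assumes "\<And>i. bounded_clinear_on UNIV (A i)"
  shows "mass A k (c *\<^sub>C x) = (cmod c)\<^sup>2 * mass A k x"
  by (simp add: mass_def bounded_clinear_scaleC[OF bounded_clinear_op_power[OF assms]] norm_scaleC
      power_mult_distrib sum_distrib_left algebra_simps)

lemma mass_le_norm:
  assumes A: "commuting_maps S A" and h: "h \<in> S"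
    and le: "\<And>y. y \<in> S \<Longrightarrow> (\<Sum>i\<in>UNIV. (norm (A i y))\<^sup>2) \<le> (norm y)\<^sup>2"
  shows "mass A k h \<le> (norm h)\<^sup>2"
  using h
proof (induction k arbitrary: h)
  case (Suc k)
  have "mass A (Suc k) h \<le> (\<Sum>i\<in>UNIV. (norm (A i h))\<^sup>2)"
    unfolding mass_Suc[OF A Suc.prems] using A Suc by (intro sum_mono) (auto simp: commuting_maps_def)
  also have "\<dots> \<le> (norm h)\<^sup>2" using le Suc.prems by blast
  finally show ?case .
qed (simp add: mass_0)

section \<open>Row contractions and their characteristic functions\<close>

text \<open>\<open>inv\<close> yields a true solution as soon as one exists, and existence comes
  from the contraction principle. The smallness of \<open>A\<close> holds near the origin, where the
  Taylor coefficients are read off.\<close>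

lemma resolvent:
  fixes A :: "'a::complex_hilbert \<Rightarrow> 'a" and y :: 'a
  assumes A: "bounded_clinear_on UNIV A" and le: "\<And>x. norm (A x) \<le> norm x / 2"
  defines "g \<equiv> inv (\<lambda>x. x - A x) y"
  shows "g = y + A g" "norm g \<le> 2 * norm y"
proof -
  have diff: "A (u - v) = A u - A v" for u v
    by (rule linear_diff[OF bounded_linear.linear[OF bounded_clinear_bounded_linear[OF A]]])
  have "\<exists>!x. y + A x = x"
  proof (rule banach_fix_type[where c = "1/2"])
    show "\<forall>u v. dist (y + A u) (y + A v) \<le> 1/2 * dist u v"
      using le by (auto simp: dist_norm simp flip: diff)
  qed auto
  then obtain x where "y + A x = x" by auto
  then have "x - A x = y" by (simp add: algebra_simps)
  then have "g - A g = y" unfolding g_def by (metis (mono_tags, lifting) f_inv_into_f rangeI)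
  then show g: "g = y + A g" by (simp add: algebra_simps)
  have "norm g \<le> norm y + norm (A g)" using norm_triangle_ineq[of y "A g"] g by simp
  then show "norm g \<le> 2 * norm y" using le[of g] by simp
qed

lemma norm_vec_sq: "(norm (v :: 'a::complex_hilbert ^ 'n::finite))\<^sup>2 = (\<Sum>i\<in>UNIV. (norm (v $ i))\<^sup>2)"
  by (simp add: power2_norm_eq_inner inner_vec_def)

locale row_contraction =
  fixes T :: "'n::{finite,linorder} \<Rightarrow> 'a::complex_hilbert \<Rightarrow> 'a"
  assumes crc: "commuting_row_contraction UNIV T"
begin

abbreviation Ts :: "'n \<Rightarrow> 'a \<Rightarrow> 'a" where "Ts i \<equiv> adj (T i)"
abbreviation D :: "'a \<Rightarrow> 'a" where "D \<equiv> defect_op_star T"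

definition pencil :: "(complex, 'n) vec \<Rightarrow> 'a \<Rightarrow> 'a" where
  "pencil z x = (\<Sum>i\<in>UNIV. (z $ i) *\<^sub>C T i x)"

definition pencil_adj :: "(complex, 'n) vec \<Rightarrow> 'a \<Rightarrow> 'a" where
  "pencil_adj z x = (\<Sum>i\<in>UNIV. (z $ i) *\<^sub>C Ts i x)"

lemma T: "bounded_clinear_on UNIV (T i)"
  using crc by (simp add: commuting_row_contraction_def commuting_tuple_def)

lemma Ts: "bounded_clinear_on UNIV (Ts i)"
  by (rule bounded_clinear_adj[OF T])

lemma comm_T: "commuting_maps UNIV T"
  using crc by (simp add: commuting_row_contraction_def commuting_tuple_def commuting_maps_def)

lemma comm_Ts: "commuting_maps UNIV Ts"
proof -
  have "Ts i (Ts j x) = Ts j (Ts i x)" for i j x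
    by (rule cinner_extensional)
      (use comm_T in \<open>simp add: cinner_adj_left[OF T] commuting_maps_def\<close>)
  then show ?thesis by (simp add: commuting_maps_def)
qed

lemma T_linear: "linear (T i)"
  by (intro bounded_linear.linear bounded_clinear_bounded_linear T)

lemma pencil_adj_bounded: "bounded_clinear_on UNIV (pencil_adj z)"
  unfolding pencil_adj_def[abs_def] by (intro bounded_clinear_sum bounded_clinear_scaled Ts)

lemma cinner_pencil_adj: "cinner (pencil_adj z x) y = cinner x (pencil (\<chi> i. cnj (z $ i)) y)"
  by (simp add: pencil_adj_def pencil_def cinner_simps cinner_adj_left[OF T])

lemma cinner_pencil_adj_pow:
  "cinner ((pencil_adj z ^^ k) x) y = cinner x ((pencil (\<chi> i. cnj (z $ i)) ^^ k) y)"
  by (induction k arbitrary: x) (simp_all add: funpow_swap1 cinner_pencil_adj)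

lemma sum_norm_Ts_le: "(\<Sum>i\<in>UNIV. (norm (Ts i y))\<^sup>2) \<le> (norm y)\<^sup>2"
proof -
  have "0 \<le> Re (cinner (y - row_square UNIV T y) y)"
    using crc positive_cinner_nonneg(1)[of "\<lambda>x. x - row_square UNIV T x" y]
    by (simp add: commuting_row_contraction_def)
  also have "\<dots> = (norm y)\<^sup>2 - (\<Sum>i\<in>UNIV. (norm (Ts i y))\<^sup>2)"
    by (simp add: row_square_def cinner_simps cinner_adj_right[OF T, symmetric] cinner_self)
  finally show ?thesis by simp
qed

lemma row_op_bounded: "bounded_clinear_on UNIV (row_op T)"
proof -
  have nth: "bounded_clinear_on UNIV (\<lambda>h :: ('a, 'n) vec. h $ i)" for i
    by (intro bounded_clinearI bounded_linear_vec_nth) (simp add: scaleC_vec_def)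
  show ?thesis
    unfolding row_op_def[abs_def] by (intro bounded_clinear_sum bounded_clinear_comp[OF T nth])
qed

lemma adj_row_op: "adj (row_op T) y = (\<chi> i. Ts i y)"
  by (rule adjoint_on_eqI)
    (auto simp: closed_csubspace_UNIV row_op_def cinner_vec_def cinner_simps cinner_adj_right[OF T])

lemma norm_adj_row_op_le: "norm (adj (row_op T) y) \<le> norm y"
  by (rule power2_le_imp_le) (simp_all add: adj_row_op norm_vec_sq sum_norm_Ts_le)

lemma norm_row_op_le: "norm (row_op T v) \<le> norm v"
proof -
  have "(norm (row_op T v))\<^sup>2 = cmod (cinner (row_op T v) (row_op T v))"
    by (simp add: cinner_self norm_power)
  also have "\<dots> = cmod (cinner v (adj (row_op T) (row_op T v)))"
    by (simp add: cinner_adj_right[OF row_op_bounded])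
  also have "\<dots> \<le> norm v * norm (adj (row_op T) (row_op T v))" by (rule cmod_cinner_le)
  also have "\<dots> \<le> norm v * norm (row_op T v)" by (intro mult_left_mono norm_adj_row_op_le) auto
  finally have "norm (row_op T v) * norm (row_op T v) \<le> norm v * norm (row_op T v)"
    by (simp add: power2_eq_square)
  then show ?thesis by (cases "row_op T v = 0") auto
qed

lemma selfadjoint_contraction_left:
  "selfadjoint_contraction (\<lambda>h. row_op T (adj (row_op T) h))"
proof
  show "bounded_clinear_on UNIV (\<lambda>h. row_op T (adj (row_op T) h))"
    by (intro bounded_clinear_comp[OF row_op_bounded] bounded_clinear_adj row_op_bounded)
  show "norm (row_op T (adj (row_op T) h)) \<le> norm h" for h
    using norm_row_op_le norm_adj_row_op_le by (rule order_trans)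
  show "cinner (row_op T (adj (row_op T) x)) y = cinner x (row_op T (adj (row_op T) y))" for x y
    by (simp add: cinner_adj_left[OF row_op_bounded, symmetric] cinner_adj_right[OF row_op_bounded, symmetric])
qed

lemma selfadjoint_contraction_right:
  "selfadjoint_contraction (\<lambda>h. adj (row_op T) (row_op T h))"
proof
  show "bounded_clinear_on UNIV (\<lambda>h. adj (row_op T) (row_op T h))"
    by (intro bounded_clinear_comp[OF bounded_clinear_adj] row_op_bounded)
  show "norm (adj (row_op T) (row_op T h)) \<le> norm h" for h
    using norm_adj_row_op_le norm_row_op_le by (rule order_trans)
  show "cinner (adj (row_op T) (row_op T x)) y = cinner x (adj (row_op T) (row_op T y))" for x y
    by (simp add: cinner_adj_left[OF row_op_bounded] cinner_adj_right[OF row_op_bounded])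
qed

lemma D_bounded: "bounded_clinear_on UNIV D"
  and D_positive: "positive_on UNIV D"
  and D_square: "D (D h) = h - (\<Sum>i\<in>UNIV. T i (Ts i h))"
  using selfadjoint_contraction.op_sqrt_eq[OF selfadjoint_contraction_left]
    selfadjoint_contraction.bounded_clinear_sqrt_series[OF selfadjoint_contraction_left]
    selfadjoint_contraction.positive_sqrt_series[OF selfadjoint_contraction_left]
    selfadjoint_contraction.sqrt_series_square[OF selfadjoint_contraction_left]
  by (simp_all add: defect_op_star_def adj_row_op row_op_def)

lemma D_selfadj: "cinner (D x) y = cinner x (D y)"
  by (rule positive_self_adjoint[OF D_bounded D_positive])

lemma D_linear: "linear D"
  by (intro bounded_linear.linear bounded_clinear_bounded_linear D_bounded)

lemma norm_D_sq: "(norm (D y))\<^sup>2 = (norm y)\<^sup>2 - (\<Sum>i\<in>UNIV. (norm (Ts i y))\<^sup>2)"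
proof -
  have "complex_of_real ((norm (D y))\<^sup>2) = cinner (D (D y)) y"
    by (simp only: cinner_self[symmetric] D_selfadj)
  also have "\<dots> = complex_of_real ((norm y)\<^sup>2 - (\<Sum>i\<in>UNIV. (norm (Ts i y))\<^sup>2))"
    unfolding D_square by (simp add: cinner_simps cinner_adj_right[OF T, symmetric] cinner_self)
  finally show ?thesis using of_real_eq_iff by blast
qed

lemma norm_D_le: "norm (D y) \<le> norm y"
  by (rule power2_le_imp_le) (auto simp: norm_D_sq sum_nonneg)

lemma defect_bounded: "bounded_clinear_on UNIV (defect_op T)"
  and defect_square: "defect_op T (defect_op T v) = v - adj (row_op T) (row_op T v)"
  using selfadjoint_contraction.op_sqrt_eq[OF selfadjoint_contraction_right]
    selfadjoint_contraction.bounded_clinear_sqrt_series[OF selfadjoint_contraction_right]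
    selfadjoint_contraction.sqrt_series_square[OF selfadjoint_contraction_right]
  by (simp_all add: defect_op_def)

section \<open>Taylor coefficients of the characteristic function and the shift relation\<close>

lemma resolvent_expansion:
  assumes g: "g = t *\<^sub>R u + t *\<^sub>R A g" and A: "bounded_clinear_on UNIV A"
  shows "g = (\<Sum>l<k. t ^ Suc l *\<^sub>R (A ^^ l) u) + t ^ k *\<^sub>R (A ^^ k) (g :: 'a)"
proof (induction k)
  case (Suc k)
  have lin: "linear (A ^^ k)"
    by (intro bounded_linear.linear bounded_clinear_bounded_linear bounded_clinear_funpow A)
  have "(A ^^ k) g = t *\<^sub>R (A ^^ k) u + t *\<^sub>R (A ^^ Suc k) g"
    by (subst g) (simp add: linear_add[OF lin] linear_scale[OF lin] funpow_swap1)
  then have "t ^ k *\<^sub>R (A ^^ k) g = t ^ k *\<^sub>R (t *\<^sub>R (A ^^ k) u + t *\<^sub>R (A ^^ Suc k) g)"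
    by (rule arg_cong)
  then have "t ^ k *\<^sub>R (A ^^ k) g = t ^ Suc k *\<^sub>R (A ^^ k) u + t ^ Suc k *\<^sub>R (A ^^ Suc k) g"
    by (simp only: scaleR_add_right scaleR_scaleR power_Suc2)
  then show ?case using Suc by (simp add: add.assoc)
qed simp

text \<open>Along the ray \<open>t z\<close> both sides are polynomials in \<open>t\<close> up to an error \<open>O(t\<^sup>j\<^sup>+\<^sup>2)\<close>, so that their
  coefficients of \<open>t\<^sup>j\<^sup>+\<^sup>1\<close> agree.\<close>

lemma char_fun_coefficient_zero:
  assumes poly: "polynomial_of_degree (defect_space T) (defect_space_star T) (char_fun T) m"
    and x: "x \<in> defect_space T" "norm x \<le> 1" and j: "j \<ge> m"
  shows "D ((pencil_adj z ^^ j) (\<Sum>i\<in>UNIV. (z $ i) *\<^sub>C (defect_op T x $ i))) = 0"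
proof -
  obtain c where c: "Taylor_coeffs (defect_space T) (defect_space_star T) (char_fun T) c"
    and c0: "\<And>\<beta>. mi_size \<beta> > m \<Longrightarrow> c \<beta> x = 0"
    using poly x(1) unfolding polynomial_of_degree_def by blast
  define A where "A = pencil_adj z"
  define u where "u = (\<Sum>i\<in>UNIV. (z $ i) *\<^sub>C (defect_op T x $ i))"
  define b where "b i = (\<Sum>\<alpha> | mi_size \<alpha> = i. mi_power z \<alpha> *\<^sub>C c \<alpha> x)" for i
  \<comment> \<open>\<open>p\<close> is the difference of the two expansions in each degree; beyond
    degree \<open>m\<close> only the resolvent term is left.\<close>
  define p where "p i = (if i = 0 then - row_op T x else D ((A ^^ (i - 1)) u)) - (if i \<le> m then b i else 0)" for i
  have A: "bounded_clinear_on UNIV A" unfolding A_def by (rule pencil_adj_bounded)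
  obtain K where K: "K > 0" "\<And>x. norm (A x) \<le> norm x * K"
    using bounded_linear.pos_bounded[OF bounded_clinear_bounded_linear[OF A]] by blast
  have Kpow: "norm ((A ^^ k) y) \<le> K ^ k * norm y" for k y
  proof (induction k)
    case (Suc k)
    have "norm ((A ^^ Suc k) y) \<le> norm ((A ^^ k) y) * K" using K(2) by simp
    also have "\<dots> \<le> (K ^ k * norm y) * K" using Suc K(1) by (intro mult_right_mono) auto
    finally show ?case by (simp add: mult_ac)
  qed simp
  \<comment> \<open>The first bound makes \<open>t *\<^sub>R A\<close> shrink norms by 1/2, the
    second keeps \<open>t *\<^sub>R z\<close> in the unit ball.\<close>
  define \<delta> where "\<delta> = min (1 / (2 * K)) (1 / (norm z + 1))"
  have \<delta>: "\<delta> > 0" using K(1) by (auto simp: \<delta>_def add_nonneg_pos)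
  have "p (Suc j) = 0"
  proof (rule poly_small_coeffs_zero[where k = "Suc j", OF \<delta>])
    fix t assume t: "0 < t" "t < \<delta>"
    define g where "g = inv (\<lambda>x. x - t *\<^sub>R A x) (t *\<^sub>R u)"
    have small: "norm (t *\<^sub>R A y) \<le> norm y / 2" for y
    proof -
      have "norm (t *\<^sub>R A y) \<le> t * (norm y * K)" using t K(2) by (simp add: mult_left_mono)
      also have "\<dots> = (t * K) * norm y" by simp
      also have "\<dots> \<le> (1/2) * norm y"
        using t K(1) by (intro mult_right_mono) (auto simp: \<delta>_def field_simps)
      finally show ?thesis by simp
    qed
    have tA: "bounded_clinear_on UNIV (\<lambda>y. t *\<^sub>R A y)"
      using bounded_clinear_scaled[OF A, of "of_real t"] by (simp add: scaleC_of_real)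
    have g: "g = t *\<^sub>R u + t *\<^sub>R A g" "norm g \<le> 2 * norm (t *\<^sub>R u)"
      unfolding g_def by (rule resolvent[OF tA small])+
    have tz: "t *\<^sub>R z \<in> ball 0 1"
    proof -
      have "t * norm z \<le> t * (norm z + 1)" using t by simp
      also have "\<dots> < 1"
        using t by (simp add: \<delta>_def pos_less_divide_eq add_nonneg_pos)
      finally show ?thesis using t by simp
    qed
    have "char_fun T (t *\<^sub>R z) x = - row_op T x + D g"
      by (simp add: char_fun_def g_def A_def pencil_adj_def u_def scaleR_sum_right
          bounded_bilinear.scaleR_left[OF bounded_bilinear_scaleC])
    moreover have "char_fun T (t *\<^sub>R z) x = (\<Sum>i\<le>m. t ^ i *\<^sub>R b i)"
    proof -
      let ?h = "\<lambda>\<alpha>. mi_power (t *\<^sub>R z) \<alpha> *\<^sub>C c \<alpha> x"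
      have h: "?h \<alpha> = t ^ mi_size \<alpha> *\<^sub>R (mi_power z \<alpha> *\<^sub>C c \<alpha> x)" for \<alpha>
        by (simp only: mi_power_scaleR scaleC_scaleC[symmetric] scaleC_of_real)
      have "uniform_limit {x \<in> defect_space T. norm x \<le> 1}
          (\<lambda>F x. \<Sum>\<alpha>\<in>F. mi_power (t *\<^sub>R z) \<alpha> *\<^sub>C c \<alpha> x) (char_fun T (t *\<^sub>R z)) (finite_subsets_at_top UNIV)"
        using c tz unfolding Taylor_coeffs_def by blast
      then have "(?h has_sum char_fun T (t *\<^sub>R z) x) UNIV"
        unfolding has_sum_def using x by (auto dest!: tendsto_uniform_limitI)
      moreover have "(?h has_sum (\<Sum>\<alpha> | mi_size \<alpha> \<le> m. ?h \<alpha>)) UNIV"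
        by (rule has_sum_finite_neutralI) (auto simp: finite_mi_size_le c0 scaleC_zero)
      ultimately have "char_fun T (t *\<^sub>R z) x = (\<Sum>\<alpha> | mi_size \<alpha> \<le> m. ?h \<alpha>)"
        by (rule has_sum_unique)
      also have "\<dots> = (\<Sum>i\<le>m. \<Sum>\<alpha> | \<alpha> \<in> {\<alpha>. mi_size \<alpha> \<le> m} \<and> mi_size \<alpha> = i. ?h \<alpha>)"
        by (rule sum.group[symmetric]) (auto simp: finite_mi_size_le)
      also have "\<dots> = (\<Sum>i\<le>m. t ^ i *\<^sub>R b i)"
      proof (rule sum.cong)
        fix i assume "i \<in> {..m}"
        then have "{\<alpha>. \<alpha> \<in> {\<alpha>. mi_size \<alpha> \<le> m} \<and> mi_size \<alpha> = i} = {\<alpha>::'n \<Rightarrow> nat. mi_size \<alpha> = i}" by auto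
        then show "(\<Sum>\<alpha> | \<alpha> \<in> {\<alpha>. mi_size \<alpha> \<le> m} \<and> mi_size \<alpha> = i. ?h \<alpha>) = t ^ i *\<^sub>R b i"
          by (simp add: b_def scaleR_sum_right h)
      qed simp
      finally show ?thesis .
    qed
    moreover have "D g = (\<Sum>l<Suc j. t ^ Suc l *\<^sub>R D ((A ^^ l) u)) + t ^ Suc j *\<^sub>R D ((A ^^ Suc j) g)"
      by (subst resolvent_expansion[OF g(1) A, of "Suc j"])
        (simp add: linear_add[OF D_linear] linear_sum[OF D_linear] linear_scale[OF D_linear])
    moreover have "(\<Sum>i\<le>Suc j. t ^ i *\<^sub>R p i)
        = - row_op T x + (\<Sum>l<Suc j. t ^ Suc l *\<^sub>R D ((A ^^ l) u)) - (\<Sum>i\<le>m. t ^ i *\<^sub>R b i)"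
    proof -
      have "(\<Sum>i\<le>Suc j. t ^ i *\<^sub>R p i)
          = (\<Sum>i\<le>Suc j. t ^ i *\<^sub>R (if i = 0 then - row_op T x else D ((A ^^ (i - 1)) u)))
            - (\<Sum>i\<le>Suc j. t ^ i *\<^sub>R (if i \<le> m then b i else 0))"
        by (simp add: p_def scaleR_diff_right sum_subtractf)
      moreover have "(\<Sum>i\<le>Suc j. t ^ i *\<^sub>R (if i = 0 then - row_op T x else D ((A ^^ (i - 1)) u)))
          = - row_op T x + (\<Sum>l<Suc j. t ^ Suc l *\<^sub>R D ((A ^^ l) u))"
        by (simp only: sum.atMost_Suc_shift lessThan_Suc_atMost) simp
      moreover have "(\<Sum>i\<le>Suc j. t ^ i *\<^sub>R (if i \<le> m then b i else 0)) = (\<Sum>i\<le>m. t ^ i *\<^sub>R b i)"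
        by (rule sum.mono_neutral_cong_right) (use j in auto)
      ultimately show ?thesis by simp
    qed
    ultimately have "(\<Sum>i\<le>Suc j. t ^ i *\<^sub>R p i) = - (t ^ Suc j *\<^sub>R D ((A ^^ Suc j) g))" by simp
    then have "norm (\<Sum>i\<le>Suc j. t ^ i *\<^sub>R p i) = t ^ Suc j * norm (D ((A ^^ Suc j) g))"
      using t by simp
    \<comment> \<open>The remainder carries \<open>t ^ Suc j\<close> and \<open>g\<close> is itself
      of order \<open>t\<close>: together one power beyond the degree of interest.\<close>
    also have "\<dots> \<le> t ^ Suc j * (K ^ Suc j * (2 * (t * norm u)))"
    proof (intro mult_left_mono)
      have "norm (D ((A ^^ Suc j) g)) \<le> K ^ Suc j * norm g" by (rule order_trans[OF norm_D_le Kpow])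
      also have "\<dots> \<le> K ^ Suc j * (2 * (t * norm u))" using g(2) t K(1) by (intro mult_left_mono) auto
      finally show "norm (D ((A ^^ Suc j) g)) \<le> K ^ Suc j * (2 * (t * norm u))" .
    qed (use t in auto)
    also have "\<dots> = (2 * K ^ Suc j * norm u) * t ^ Suc (Suc j)" by simp
    finally show "norm (\<Sum>i\<le>Suc j. t ^ i *\<^sub>R p i) \<le> (2 * K ^ Suc j * norm u) * t ^ Suc (Suc j)" .
  qed simp
  then show ?thesis using j by (simp add: p_def A_def u_def)
qed

text \<open>The shift relation: the vectors \<open>T\<^sup>\<beta> D h\<close> with \<open>|\<beta>| > m\<close> transform under \<open>T\<^sub>i\<^sup>*\<close> like the
  monomials in the Drury--Arveson space. It is stated for the generating function
  \<open>(z\<^sub>1 T\<^sub>1 + \<dots> + z\<^sub>n T\<^sub>n)\<^sup>j = \<Sum> \<gamma>\<^sub>\<alpha> z\<^sup>\<alpha> T\<^sup>\<alpha>\<close>.\<close>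

lemma shift_relation:
  assumes poly: "polynomial_of_degree (defect_space T) (defect_space_star T) (char_fun T) m"
    and j: "j \<ge> m"
  shows "Ts i ((pencil z ^^ Suc j) (D h)) = (z $ i) *\<^sub>C (pencil z ^^ j) (D h)"
proof -
  \<comment> \<open>Conjugated because \<open>pencil z\<close> is the adjoint of
    \<open>pencil_adj z'\<close>.\<close>
  define z' where "z' = (\<chi> i. cnj (z $ i))"
  have z': "(\<chi> i. cnj (z' $ i)) = z" by (simp add: z'_def vec_eq_iff)
  define w where "w = (pencil z ^^ j) (D h)"
  define v where "v = (\<chi> i. (z $ i) *\<^sub>C w)"
  let ?Z = "\<lambda>v. \<Sum>i\<in>UNIV. (z' $ i) *\<^sub>C (v $ i)"
  have zero: "D ((pencil_adj z' ^^ j) (?Z (defect_op T (defect_op T y)))) = 0" for y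
  proof -
    \<comment> \<open>The coefficient lemma covers vectors of norm at most 1, where the Taylor
      series converges uniformly; \<open>r\<close> scales into that ball.\<close>
    define r where "r = 1 / (norm (defect_op T y) + 1)"
    have r: "r > 0" by (simp add: r_def add_nonneg_pos)
    have lin: "linear (defect_op T)"
      by (intro bounded_linear.linear bounded_clinear_bounded_linear defect_bounded)
    have linp: "linear (pencil_adj z' ^^ j)"
      by (intro bounded_linear.linear bounded_clinear_bounded_linear bounded_clinear_funpow pencil_adj_bounded)
    have "defect_op T (r *\<^sub>R y) \<in> defect_space T"
      unfolding defect_space_def by (rule subsetD[OF closure_subset]) (rule rangeI)
    moreover have "norm (defect_op T (r *\<^sub>R y)) \<le> 1"
      using r by (simp add: linear_scale[OF lin]) (simp add: r_def field_simps add_nonneg_pos)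
    ultimately have "D ((pencil_adj z' ^^ j) (?Z (defect_op T (defect_op T (r *\<^sub>R y))))) = 0"
      by (rule char_fun_coefficient_zero[OF poly _ _ j])
    moreover have "?Z (r *\<^sub>R u) = r *\<^sub>R ?Z u" for u :: "('a, 'n) vec"
      by (simp add: scaleR_sum_right scaleC_scaleR)
    ultimately have "r *\<^sub>R D ((pencil_adj z' ^^ j) (?Z (defect_op T (defect_op T y)))) = 0"
      by (simp add: linear_scale[OF lin] linear_scale[OF linp] linear_scale[OF D_linear])
    then show ?thesis using r by simp
  qed
  \<comment> \<open>\<open>v\<close> is orthogonal to the range of the self-adjoint operator I - T*T
    and so is fixed by T*T. The coordinates of this equation are the claim, since
    \<open>row_op T v\<close> is the next power of the pencil at \<open>D h\<close>.\<close>
  have "cinner (v - adj (row_op T) (row_op T v)) y = 0" for y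
  proof -
    have Zw: "cinner (?Z u) w = cinner u v" for u
      by (simp add: cinner_simps cinner_vec_def v_def z'_def)
    moreover have "cinner (?Z (defect_op T (defect_op T y))) w = 0"
      using zero[of y] cinner_pencil_adj_pow[of j z' "?Z (defect_op T (defect_op T y))" "D h"]
        D_selfadj[of "(pencil_adj z' ^^ j) (?Z (defect_op T (defect_op T y)))" h]
      by (simp add: z' w_def cinner_simps)
    ultimately have "cinner (y - adj (row_op T) (row_op T y)) v = 0" unfolding Zw defect_square by blast
    then have "cinner y (v - adj (row_op T) (row_op T v)) = 0"
      by (simp add: cinner_simps cinner_adj_left[OF row_op_bounded] cinner_adj_right[OF row_op_bounded])
    then show ?thesis by (rule cinner_eq_zero_commute[THEN iffD1])
  qed
  then have "v - adj (row_op T) (row_op T v) = 0"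
    using cinner_extensional[of "v - adj (row_op T) (row_op T v)" 0] by (simp add: cinner_simps)
  then have "v $ i = adj (row_op T) (row_op T v) $ i" by simp
  moreover have "row_op T v = (pencil z ^^ Suc j) (D h)"
    by (simp add: row_op_def v_def bounded_clinear_scaleC[OF T] w_def pencil_def)
  ultimately show ?thesis by (simp add: v_def adj_row_op w_def)
qed

end

section \<open>The decomposition\<close>

lemma subspace_tuple_range:
  assumes S: "closed_csubspace S" and X: "\<And>i. bounded_clinear_on UNIV (X i)"
  shows "complex_vector.subspace (tuple_range S X)"
  unfolding complex_vector.subspace_def
proof (intro conjI ballI allI)
  have lin: "linear (X i)" for i by (rule bounded_linear.linear[OF bounded_clinear_bounded_linear[OF X]])
  show "0 \<in> tuple_range S X"
    unfolding tuple_range_def using closed_csubspaceD(2)[OF S]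
    by (auto intro!: exI[of _ "\<lambda>_. 0"] simp: linear_0[OF lin])
  fix x y c assume "x \<in> tuple_range S X"
  then obtain k where k: "x = (\<Sum>i\<in>UNIV. X i (k i))" "\<And>i. k i \<in> S" unfolding tuple_range_def by blast
  show "c *\<^sub>C x \<in> tuple_range S X"
    unfolding tuple_range_def using k closed_csubspaceD(5)[OF S]
    by (auto intro!: exI[of _ "\<lambda>i. c *\<^sub>C k i"] simp: bounded_clinear_scaleC[OF X] complex_vector.scale_sum_right)
  assume "y \<in> tuple_range S X"
  then obtain l where l: "y = (\<Sum>i\<in>UNIV. X i (l i))" "\<And>i. l i \<in> S" unfolding tuple_range_def by blast
  show "x + y \<in> tuple_range S X"
    unfolding tuple_range_def using k l closed_csubspaceD(3)[OF S]
    by (auto intro!: exI[of _ "\<lambda>i. k i + l i"] simp: linear_add[OF lin] sum.distrib)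
qed

lemma tuple_range_member:
  assumes X: "\<And>i. bounded_clinear_on UNIV (X i)" and S: "0 \<in> S" and x: "x \<in> S"
  shows "X i x \<in> tuple_range S X"
proof -
  have lin: "linear (X i)" for i by (rule bounded_linear.linear[OF bounded_clinear_bounded_linear[OF X]])
  have "(\<Sum>l\<in>UNIV. X l (if l = i then x else 0)) = (\<Sum>l\<in>{i}. X l (if l = i then x else 0))"
    by (rule sum.mono_neutral_right) (auto simp: linear_0[OF lin])
  then show ?thesis
    unfolding tuple_range_def using S x by (auto intro!: exI[of _ "\<lambda>l. if l = i then x else 0"])
qed

lemma mem_ominus: "x \<in> A \<ominus> B \<longleftrightarrow> x \<in> A \<and> (\<forall>u\<in>B. cinner x u = 0)"
  by (simp add: ominus_def)

lemma proj_ominus: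
  assumes A: "closed_csubspace A" and B: "closed_csubspace B" and sub: "B \<subseteq> A" and x: "x \<in> A"
  shows "proj (A \<ominus> B) x = x - proj B x"
proof (rule proj_eqI[OF closed_csubspace_ominus[OF A]])
  have "proj B x \<in> A" using proj_in[OF B] sub by blast
  then show "x - proj B x \<in> A \<ominus> B"
    using closed_csubspaceD(4)[OF A x] proj_orth[OF B] by (auto simp: mem_ominus)
  fix u assume "u \<in> A \<ominus> B"
  then have "cinner u (proj B x) = 0" using proj_in[OF B] by (auto simp: mem_ominus)
  then show "cinner (x - (x - proj B x)) u = 0" using cinner_eq_zero_commute[of "proj B x" u] by simp
qed

lemma orthogonal_direct_sum3_ominus:
  assumes A: "closed_csubspace A" and B: "closed_csubspace B" and sub: "A \<subseteq> B"
  shows "orthogonal_direct_sum3 UNIV A (B \<ominus> A) (UNIV \<ominus> B)"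
  unfolding orthogonal_direct_sum3_def
proof (intro conjI ballI)
  show "closed_csubspace (B \<ominus> A)" "closed_csubspace (UNIV \<ominus> B)"
    by (rule closed_csubspace_ominus[OF B] closed_csubspace_ominus[OF closed_csubspace_UNIV])+
  show "cinner a b = 0" if "a \<in> A" "b \<in> B \<ominus> A" for a b
    using that cinner_eq_zero_commute by (auto simp: mem_ominus)
  show "cinner a c = 0" if "a \<in> A" "c \<in> UNIV \<ominus> B" for a c
    using that sub cinner_eq_zero_commute by (auto simp: mem_ominus)
  show "cinner b c = 0" if "b \<in> B \<ominus> A" "c \<in> UNIV \<ominus> B" for b c
    using that cinner_eq_zero_commute by (auto simp: mem_ominus)
  have "\<exists>a b c. x = a + b + c \<and> a \<in> A \<and> b \<in> B \<ominus> A \<and> c \<in> UNIV \<ominus> B" for x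
  proof (intro exI conjI)
    show "x = proj A (proj B x) + proj (B \<ominus> A) (proj B x) + proj (UNIV \<ominus> B) x"
      using proj_ominus[OF B A sub proj_in[OF B]] proj_ominus[OF closed_csubspace_UNIV B]
      by simp
  qed (auto intro: proj_in A closed_csubspace_ominus[OF B] closed_csubspace_ominus[OF closed_csubspace_UNIV])
  then show "UNIV = {a + b + c |a b c. a \<in> A \<and> b \<in> B \<ominus> A \<and> c \<in> UNIV \<ominus> B}" by blast
qed (rule A)

section \<open>The filtration by the subspaces \<open>L k\<close>\<close>

context row_contraction
begin

abbreviation L :: "nat \<Rightarrow> 'a set" where "L \<equiv> shift_part T"

lemma closed_csubspace_L: "closed_csubspace (L k)"
  unfolding shift_part_def by (rule closed_csubspace_closed_cspan)

lemma gen_in_L: "mi_size \<alpha> \<ge> k \<Longrightarrow> op_power T \<alpha> (D h) \<in> L k"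
  unfolding shift_part_def by (rule subsetD[OF closed_cspan_superset]) blast

lemma L_subset:
  assumes "closed_csubspace S" "\<And>\<alpha> h. mi_size \<alpha> \<ge> k \<Longrightarrow> op_power T \<alpha> (D h) \<in> S"
  shows "L k \<subseteq> S"
  unfolding shift_part_def by (rule closed_cspan_minimal[OF _ assms(1)]) (use assms(2) in blast)

lemma L_antimono: "k \<le> l \<Longrightarrow> L l \<subseteq> L k"
  by (rule L_subset[OF closed_csubspace_L]) (simp add: gen_in_L)

lemma T_L: "x \<in> L k \<Longrightarrow> T i x \<in> L (Suc k)"
proof -
  have "L k \<subseteq> {x. T i x \<in> L (Suc k)}"
  proof (rule L_subset[OF closed_csubspace_vimage[OF T closed_csubspace_L]])
    fix \<alpha> :: "'n \<Rightarrow> nat" and h assume "mi_size \<alpha> \<ge> k"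
    then have "op_power T (mi_inc \<alpha> i) (D h) \<in> L (Suc k)" by (simp add: gen_in_L)
    then show "op_power T \<alpha> (D h) \<in> {x. T i x \<in> L (Suc k)}"
      by (simp add: op_power_inc[OF comm_T] op_power_commute[OF comm_T])
  qed
  then show "x \<in> L k \<Longrightarrow> T i x \<in> L (Suc k)" by blast
qed

lemma T_L_same: "x \<in> L k \<Longrightarrow> T i x \<in> L k"
  using T_L[of x k i] L_antimono[of k "Suc k"] by auto

lemma op_power_T_L:
  assumes "x \<in> L k"
  shows "op_power T \<alpha> x \<in> L (k + mi_size \<alpha>)"
  using assms
proof (induction "mi_size \<alpha>" arbitrary: \<alpha> x k)
  case 0
  then have "\<alpha> = (\<lambda>_. 0)" using mi_size_0_iff by metis
  then show ?case using 0 by (simp add: op_power_0)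
next
  case (Suc l)
  from Suc.hyps(2)[symmetric] obtain \<beta> i where \<beta>: "mi_size \<beta> = l" "\<alpha> = mi_inc \<beta> i"
    by (rule mi_size_SucE)
  have "op_power T \<beta> (T i x) \<in> L (Suc k + mi_size \<beta>)"
    using Suc.hyps(1)[of \<beta>] \<beta>(1) T_L[OF Suc.prems] by blast
  then show ?case by (simp add: \<beta>(2) op_power_inc[OF comm_T])
qed

lemma cinner_gen: "cinner (op_power T \<alpha> (D h)) y = cinner h (D (op_power Ts \<alpha> y))"
proof -
  have "cinner (op_power T \<alpha> (D h)) y = cinner (D h) (op_power Ts \<alpha> y)"
    by (rule cinner_op_power[OF comm_T comm_Ts]) (auto simp: cinner_adj_right[OF T])
  then show ?thesis by (simp add: D_selfadj)
qed

lemma orthogonal_L_0_iff: "(\<forall>u\<in>L 0. cinner y u = 0) \<longleftrightarrow> (\<forall>\<alpha>. D (op_power Ts \<alpha> y) = 0)"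
proof
  assume y: "\<forall>u\<in>L 0. cinner y u = 0"
  show "\<forall>\<alpha>. D (op_power Ts \<alpha> y) = 0"
  proof
    fix \<alpha>
    \<comment> \<open>Testing against the generator built from \<open>y\<close> itself produces the
      squared norm of the vector in question.\<close>
    have "cinner y (op_power T \<alpha> (D (D (op_power Ts \<alpha> y)))) = 0" using y gen_in_L by simp
    then have "cinner (op_power T \<alpha> (D (D (op_power Ts \<alpha> y)))) y = 0"
      by (rule cinner_eq_zero_commute[THEN iffD1])
    then show "D (op_power Ts \<alpha> y) = 0" by (simp add: cinner_gen cinner_self)
  qed
next
  assume y: "\<forall>\<alpha>. D (op_power Ts \<alpha> y) = 0"
  have "L 0 \<subseteq> {x \<in> UNIV. \<forall>u\<in>{y}. cinner x u = 0}"
    by (rule L_subset[OF closed_orthogonal_complement[OF closed_csubspace_UNIV]])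
      (simp add: cinner_gen y cinner_simps)
  then show "\<forall>u\<in>L 0. cinner y u = 0" using cinner_eq_zero_commute by auto
qed

text \<open>The defining condition is not linear. It says that the masses never drop, so in the
  telescoping formula all the nonnegative terms with \<open>D\<close> vanish, and that is
  orthogonality to \<open>L 0\<close>.\<close>

lemma coisometric_part_eq: "coisometric_part T = UNIV \<ominus> L 0"
proof -
  have diff: "(\<Sum>\<alpha> | mi_size \<alpha> = k. mi_gamma \<alpha> * (norm (D (op_power Ts \<alpha> h)))\<^sup>2) = mass Ts k h - mass Ts (Suc k) h" for k h
    by (rule mass_diff[OF comm_Ts]) (auto simp: norm_D_sq)
  have "(\<forall>k. mass Ts k h = (norm h)\<^sup>2) \<longleftrightarrow> (\<forall>\<alpha>. D (op_power Ts \<alpha> h) = 0)" for h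
  proof
    assume h: "\<forall>k. mass Ts k h = (norm h)\<^sup>2"
    show "\<forall>\<alpha>. D (op_power Ts \<alpha> h) = 0"
    proof
      fix \<alpha> :: "'n \<Rightarrow> nat"
      have "(\<Sum>\<beta> | mi_size \<beta> = mi_size \<alpha>. mi_gamma \<beta> * (norm (D (op_power Ts \<beta> h)))\<^sup>2) = 0"
        using diff[of h "mi_size \<alpha>"] h by simp
      then have "mi_gamma \<alpha> * (norm (D (op_power Ts \<alpha> h)))\<^sup>2 = 0"
        by (subst (asm) sum_nonneg_eq_0_iff) (auto simp: finite_mi_size less_imp_le[OF mi_gamma_pos])
      then show "D (op_power Ts \<alpha> h) = 0" using mi_gamma_pos[of \<alpha>] by simp
    qed
  next
    assume h: "\<forall>\<alpha>. D (op_power Ts \<alpha> h) = 0"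
    show "\<forall>k. mass Ts k h = (norm h)\<^sup>2"
    proof
      fix k show "mass Ts k h = (norm h)\<^sup>2"
        by (induction k) (use diff[of h] h in \<open>auto simp: mass_0\<close>)
    qed
  qed
  then show ?thesis
    by (auto simp: coisometric_part_def adjoint_mass_def mem_ominus orthogonal_L_0_iff mass_def)
qed

text \<open>Carries relations from powers of the pencil to single powers of T: up to the multinomial
  weights, the values of \<open>f\<close> are the coefficients of a polynomial in \<open>z\<close>
  that vanishes identically.\<close>

lemma linear_zero_on_op_power:
  assumes f: "bounded_clinear_on UNIV (f :: 'a \<Rightarrow> 'b::complex_hilbert)"
    and zero: "\<And>z. f ((pencil z ^^ mi_size \<alpha>) h) = 0"
  shows "f (op_power T \<alpha> h) = 0"
proof -
  have lin: "linear f" by (rule bounded_linear.linear[OF bounded_clinear_bounded_linear[OF f]])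
  have "mi_gamma \<alpha> *\<^sub>R f (op_power T \<alpha> h) = 0"
  proof (rule mi_poly_coeffs_zero[where F = "{\<beta>. mi_size \<beta> = mi_size \<alpha>}" and c = "\<lambda>\<alpha>. mi_gamma \<alpha> *\<^sub>R f (op_power T \<alpha> h)"])
    fix z :: "(complex, 'n) vec"
    have "(\<Sum>\<beta> | mi_size \<beta> = mi_size \<alpha>. mi_power z \<beta> *\<^sub>C (mi_gamma \<beta> *\<^sub>R f (op_power T \<beta> h)))
        = f ((pencil z ^^ mi_size \<alpha>) h)"
      unfolding pencil_def[abs_def] multinomial_op_power[OF T comm_T]
      by (simp add: linear_sum[OF lin] linear_scale[OF lin] bounded_clinear_scaleC[OF f] scaleC_scaleR)
    then show "(\<Sum>\<beta> | mi_size \<beta> = mi_size \<alpha>. mi_power z \<beta> *\<^sub>C (mi_gamma \<beta> *\<^sub>R f (op_power T \<beta> h))) = 0"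
      by (simp add: zero)
  qed (auto simp: finite_mi_size)
  then show ?thesis using mi_gamma_pos[of \<alpha>] by simp
qed

lemma pencil_power_in_L: "(pencil z ^^ k) (D h) \<in> L k"
  unfolding pencil_def[abs_def] multinomial_op_power[OF T comm_T]
  by (intro closed_csubspace_sum closed_csubspace_L closed_csubspaceD(5,6)[OF closed_csubspace_L])
    (simp add: gen_in_L)

lemma D_zero_iff: "D x = 0 \<longleftrightarrow> (\<Sum>i\<in>UNIV. T i (Ts i x)) = x"
proof
  assume "D x = 0"
  then show "(\<Sum>i\<in>UNIV. T i (Ts i x)) = x"
    using D_square[of x] linear_0[OF D_linear] by simp
next
  assume "(\<Sum>i\<in>UNIV. T i (Ts i x)) = x"
  then have "cinner (D x) (D x) = 0" using D_square[of x] by (simp add: D_selfadj cinner_simps)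
  then show "D x = 0" by (simp add: cinner_self)
qed

end

section \<open>The compression to M when the characteristic function is a polynomial\<close>

locale poly_row_contraction = row_contraction T
  for T :: "'n::{finite,linorder} \<Rightarrow> 'a::complex_hilbert \<Rightarrow> 'a" +
  fixes m :: nat
  assumes poly: "polynomial_of_degree (defect_space T) (defect_space_star T) (char_fun T) m"
begin

abbreviation M :: "'a set" where "M \<equiv> L m"
abbreviation Mc :: "'n \<Rightarrow> 'a \<Rightarrow> 'a" where "Mc \<equiv> compression M T"
abbreviation Hnil :: "'a set" where "Hnil \<equiv> L 0 \<ominus> M"
abbreviation Hc :: "'a set" where "Hc \<equiv> UNIV \<ominus> L 0"
abbreviation N :: "'a set" where "N \<equiv> M \<ominus> tuple_range M T"

text \<open>The adjoint of M_i, given on the whole space so that the facts on bounded maps on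
  \<open>UNIV\<close> apply.\<close>

definition B :: "'n \<Rightarrow> 'a \<Rightarrow> 'a" where "B i x = proj M (Ts i x)"

lemma Suc_size_cases:
  assumes "mi_size \<alpha> \<ge> Suc k"
  obtains j where "mi_size \<alpha> = Suc j" "j \<ge> k"
  using assms by (metis Suc_le_D Suc_le_mono)

lemma Ts_L:
  assumes k: "k \<ge> m" and x: "x \<in> L (Suc k)"
  shows "Ts i x \<in> L k"
proof -
  have "L (Suc k) \<subseteq> {x. Ts i x \<in> L k}"
  proof (rule L_subset[OF closed_csubspace_vimage[OF Ts closed_csubspace_L]])
    fix \<alpha> :: "'n \<Rightarrow> nat" and h assume "mi_size \<alpha> \<ge> Suc k"
    then obtain j where j: "mi_size \<alpha> = Suc j" "j \<ge> k" by (rule Suc_size_cases)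
    \<comment> \<open>The shift relation concerns powers of the pencil, so membership is tested on
      vectors orthogonal to \<open>L k\<close>: each gives a linear functional that vanishes on
      those powers.\<close>
    have "Ts i (op_power T \<alpha> (D h)) \<in> L k"
    proof (rule mem_closed_csubspaceI[OF closed_csubspace_L])
      fix y assume y: "\<And>u. u \<in> L k \<Longrightarrow> cinner u y = 0"
      have f: "bounded_clinear_on UNIV (\<lambda>x. cinner (Ts i x) y)"
        using bounded_linear_compose[OF bounded_bilinear.bounded_linear_left[OF bounded_bilinear_cinner]
            bounded_clinear_bounded_linear[OF Ts[of i]], of y]
        by (intro bounded_clinearI) (auto simp: bounded_clinear_scaleC[OF Ts] cinner_simps scaleC_complex_def)
      show "cinner (Ts i (op_power T \<alpha> (D h))) y = 0"
      proof (rule linear_zero_on_op_power[OF f])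
        fix z
        have "(pencil z ^^ j) (D h) \<in> L k" using pencil_power_in_L L_antimono[OF j(2)] by blast
        then show "cinner (Ts i ((pencil z ^^ mi_size \<alpha>) (D h))) y = 0"
          unfolding j(1) using shift_relation[OF poly, of j i z h] j(2) k y by (simp add: cinner_simps)
      qed
    qed
    then show "op_power T \<alpha> (D h) \<in> {x. Ts i x \<in> L k}" by simp
  qed
  then show ?thesis using x by blast
qed

lemma T_Ts_id:
  assumes "x \<in> L (Suc m)"
  shows "(\<Sum>i\<in>UNIV. T i (Ts i x)) = x"
proof -
  define f where "f = (\<lambda>x. (\<Sum>i\<in>UNIV. T i (Ts i x)) - x)"
  have f: "bounded_clinear_on UNIV f"
    unfolding f_def by (intro bounded_clinear_diff bounded_clinear_sum bounded_clinear_comp[OF T Ts] bounded_clinear_id)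
  have "closed_csubspace {0::'a}" by (rule closed_csubspaceI) (auto simp: scaleC_zero)
  then have cl: "closed_csubspace {x. f x \<in> {0}}" by (rule closed_csubspace_vimage[OF f])
  have "L (Suc m) \<subseteq> {x. f x \<in> {0}}"
  proof (rule L_subset[OF cl])
    fix \<alpha> :: "'n \<Rightarrow> nat" and h assume "mi_size \<alpha> \<ge> Suc m"
    then obtain j where j: "mi_size \<alpha> = Suc j" "j \<ge> m" by (rule Suc_size_cases)
    have "f (op_power T \<alpha> (D h)) = 0"
    proof (rule linear_zero_on_op_power[OF f])
      fix z
      have "(\<Sum>i\<in>UNIV. T i (Ts i ((pencil z ^^ Suc j) (D h)))) = pencil z ((pencil z ^^ j) (D h))"
        unfolding shift_relation[OF poly j(2)] by (simp add: bounded_clinear_scaleC[OF T] pencil_def)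
      then show "f ((pencil z ^^ mi_size \<alpha>) (D h)) = 0" by (simp add: f_def j(1))
    qed
    then show "op_power T \<alpha> (D h) \<in> {x. f x \<in> {0}}" by simp
  qed
  then show ?thesis using assms by (auto simp: f_def)
qed

lemma compression_M: "x \<in> M \<Longrightarrow> Mc i x = T i x"
  unfolding compression_def by (rule proj_id[OF closed_csubspace_L T_L_same])

lemma adjoint_Mc: "adjoint_on M (Mc i) = B i"
proof
  fix y
  show "adjoint_on M (Mc i) y = B i y"
  proof (rule adjoint_on_eqI[OF closed_csubspace_L])
    show "B i y \<in> M" unfolding B_def by (rule proj_in[OF closed_csubspace_L])
    show "cinner (Mc i x) y = cinner x (B i y)" if "x \<in> M" for x
      using that by (simp add: compression_M B_def proj_cinner_left[OF closed_csubspace_L] cinner_adj_right[OF T])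
  qed
qed

lemma B_in_M: "B i x \<in> M"
  unfolding B_def by (rule proj_in[OF closed_csubspace_L])

lemma B_bounded: "bounded_clinear_on UNIV (B i)"
  unfolding B_def[abs_def] by (rule bounded_clinear_comp[OF bounded_clinear_proj[OF closed_csubspace_L] Ts])

lemma cinner_B: "x \<in> M \<Longrightarrow> cinner (T i x) y = cinner x (B i y)"
  by (simp add: B_def proj_cinner_left[OF closed_csubspace_L] cinner_adj_right[OF T])

lemma comm_T_M: "commuting_maps M T"
  using comm_T T_L_same by (simp add: commuting_maps_def)

lemma comm_B: "commuting_maps M B"
proof -
  have "B i (B j x) = B j (B i x)" for i j x
  proof -
    have "cinner (B i (B j x) - B j (B i x)) u = 0" if u: "u \<in> M" for u
    proof -
      have "cinner u (B i (B j x)) = cinner u (B j (B i x))"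
        using u comm_T by (simp add: T_L_same commuting_maps_def flip: cinner_B)
      then show ?thesis by (metis cinner_commute cinner_simps(5) diff_self)
    qed
    moreover have "B i (B j x) - B j (B i x) \<in> M"
      by (intro closed_csubspaceD(4)[OF closed_csubspace_L] B_in_M)
    ultimately have "cinner (B i (B j x) - B j (B i x)) (B i (B j x) - B j (B i x)) = 0" by blast
    then show ?thesis by (simp add: cinner_self)
  qed
  then show ?thesis by (simp add: commuting_maps_def B_in_M)
qed

lemma sum_norm_B_le: "(\<Sum>i\<in>UNIV. (norm (B i y))\<^sup>2) \<le> (norm y)\<^sup>2"
proof -
  have "(\<Sum>i\<in>UNIV. (norm (B i y))\<^sup>2) \<le> (\<Sum>i\<in>UNIV. (norm (Ts i y))\<^sup>2)"
    unfolding B_def by (intro sum_mono power_mono norm_proj_le closed_csubspace_L) auto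
  then show ?thesis using sum_norm_Ts_le[of y] by linarith
qed

lemma tuple_range_L_Suc: "tuple_range M T \<subseteq> L (Suc m)"
  unfolding tuple_range_def using T_L by (auto intro!: closed_csubspace_sum[OF closed_csubspace_L])

text \<open>A power of T of degree above \<open>m\<close>, applied to \<open>D h\<close>, is some
  T_i applied to a generator of M. So the generators of \<open>L (Suc m)\<close> lie in the range of
  the tuple, and orthogonality to that range passes to their closed span.\<close>

lemma N_eq: "N = M \<ominus> L (Suc m)"
proof -
  have "cinner y u = 0" if y: "y \<in> N" and u: "u \<in> L (Suc m)" for y u
  proof -
    have "L (Suc m) \<subseteq> {x \<in> UNIV. \<forall>u\<in>{y}. cinner x u = 0}"
    proof (rule L_subset[OF closed_orthogonal_complement[OF closed_csubspace_UNIV]])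
      fix \<alpha> :: "'n \<Rightarrow> nat" and h assume "mi_size \<alpha> \<ge> Suc m"
      then obtain j where j: "mi_size \<alpha> = Suc j" "j \<ge> m" by (rule Suc_size_cases)
      from j(1) obtain \<beta> i where \<beta>: "mi_size \<beta> = j" "\<alpha> = mi_inc \<beta> i" by (rule mi_size_SucE)
      have "T i (op_power T \<beta> (D h)) \<in> tuple_range M T"
        using closed_csubspaceD(2)[OF closed_csubspace_L] gen_in_L j \<beta> by (intro tuple_range_member T) auto
      then have "op_power T \<alpha> (D h) \<in> tuple_range M T"
        by (simp add: \<beta> op_power_inc[OF comm_T] op_power_commute[OF comm_T])
      then show "op_power T \<alpha> (D h) \<in> {x \<in> UNIV. \<forall>u\<in>{y}. cinner x u = 0}"
        using y by (auto simp: mem_ominus intro: cinner_eq_zero_commute[THEN iffD1])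
    qed
    then have "cinner u y = 0" using u by blast
    then show ?thesis by (rule cinner_eq_zero_commute[THEN iffD1])
  qed
  then have "N \<subseteq> M \<ominus> L (Suc m)" by (simp add: mem_ominus subset_iff)
  moreover have "M \<ominus> L (Suc m) \<subseteq> N" using tuple_range_L_Suc unfolding ominus_def by blast
  ultimately show ?thesis by (rule subset_antisym)
qed

lemma closed_csubspace_N: "closed_csubspace N"
  by (rule closed_csubspace_ominus[OF closed_csubspace_L])

lemma B_N_zero: "q \<in> N \<Longrightarrow> B i q = 0"
  using T_L by (auto simp: N_eq mem_ominus B_def proj_eq_0_iff[OF closed_csubspace_L] cinner_adj_left[OF T])

lemma B_L_Suc: "x \<in> L (Suc m) \<Longrightarrow> B i x = Ts i x"
  unfolding B_def by (intro proj_id closed_csubspace_L Ts_L) auto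

text \<open>Split \<open>x\<close> along \<open>L (Suc m)\<close> and its complement N in M. On the
  first part \<open>B i\<close> agrees with T_i* and \<open>T_Ts_id\<close> applies; the second part
  is killed.\<close>

lemma row_square_B:
  assumes x: "x \<in> M"
  shows "(\<Sum>i\<in>UNIV. T i (B i x)) = x - proj N x"
proof -
  define p where "p = proj (L (Suc m)) x"
  have p: "p \<in> L (Suc m)" unfolding p_def by (rule proj_in[OF closed_csubspace_L])
  have q: "proj N x = x - p"
    unfolding p_def N_eq by (rule proj_ominus[OF closed_csubspace_L closed_csubspace_L L_antimono x]) simp
  have "x - p \<in> N" using proj_in[OF closed_csubspace_N, of x] q by simp
  then have "B i x = B i p" for i
    using B_N_zero[of "x - p" i] linear_diff[OF bounded_linear.linear[OF bounded_clinear_bounded_linear[OF B_bounded]], of i x p]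
    by simp
  then show ?thesis using T_Ts_id[OF p] by (simp add: q B_L_Suc[OF p])
qed

section \<open>Purity of the compression to M\<close>

lemma mass_B_level_zero:
  assumes "x \<in> L (m + d) \<ominus> L (Suc (m + d))"
  shows "mass B (Suc d + e) x = 0"
  using assms
proof (induction d arbitrary: x)
  case 0
  then have x: "x \<in> M" "x \<in> N" by (auto simp: N_eq mem_ominus)
  have "mass B e 0 = 0" using mass_le_norm[OF comm_B, of 0 e] sum_norm_B_le mass_nonneg[of B e 0]
      closed_csubspaceD(2)[OF closed_csubspace_L, of m] by force
  then show ?case by (simp add: mass_Suc[OF comm_B x(1)] B_N_zero[OF x(2)])
next
  case (Suc d)
  have x: "x \<in> L (Suc (m + d))" "\<And>u. u \<in> L (Suc (Suc (m + d))) \<Longrightarrow> cinner x u = 0"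
    using Suc.prems by (auto simp: mem_ominus)
  then have xm: "x \<in> L (Suc m)" "x \<in> M"
    using L_antimono[of "Suc m" "Suc (m + d)"] L_antimono[of m "Suc (m + d)"] by auto
  \<comment> \<open>The image is orthogonal to \<open>L (Suc (m + d))\<close> because T_i raises the
    filtration by one. Repeating the step leads down to N, which \<open>B\<close> kills.\<close>
  have "B i x \<in> L (m + d) \<ominus> L (Suc (m + d))" for i
    unfolding mem_ominus B_L_Suc[OF xm(1)] using x T_L Ts_L[of "m + d" x i]
    by (auto simp: cinner_adj_left[OF T])
  then have "mass B (Suc d + e) (B i x) = 0" for i by (rule Suc.IH)
  then show ?case by (simp add: mass_Suc[OF comm_B xm(2), of "Suc d + e", simplified])
qed

lemma Inter_L_zero:
  assumes y: "\<And>d. y \<in> L (m + d)"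
  shows "y = 0"
proof -
  have "op_power Ts \<alpha> y \<in> {y. \<forall>d. y \<in> L (m + d)}" for \<alpha>
  proof (rule op_power_invariant)
    fix i x assume x: "x \<in> {y. \<forall>d. y \<in> L (m + d)}"
    have "Ts i x \<in> L (m + d)" for d
      by (rule Ts_L) (use x in \<open>auto simp flip: add_Suc_right\<close>)
    then show "Ts i x \<in> {y. \<forall>d. y \<in> L (m + d)}" by blast
  qed (use y in blast)
  then have "op_power Ts \<alpha> y \<in> L (Suc m)" for \<alpha>
    by (metis (mono_tags, lifting) add_Suc_right add.right_neutral mem_Collect_eq)
  then have "D (op_power Ts \<alpha> y) = 0" for \<alpha> by (simp add: D_zero_iff T_Ts_id)
  then have "\<forall>u\<in>L 0. cinner y u = 0" by (simp add: orthogonal_L_0_iff)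
  moreover have "y \<in> L 0" using y[of 0] L_antimono[of 0 m] by auto
  ultimately show ?thesis by (auto simp: cinner_self)
qed

text \<open>No infinite orthogonal sum has to be formed: the vectors whose masses tend to 0 are a
  closed subspace \<open>Z\<close> containing every layer. What is left of \<open>x\<close> is
  orthogonal to all layers, so it slides down through every \<open>L (m + d)\<close> and is
  0.\<close>

lemma mass_B_tendsto_0:
  assumes x: "x \<in> M"
  shows "(\<lambda>j. mass B j x) \<longlonglongrightarrow> 0"
proof -
  define Z where "Z = {x \<in> M. (\<lambda>j. mass B j x) \<longlonglongrightarrow> 0}"
  have le: "mass B j v \<le> (norm v)\<^sup>2" if "v \<in> M" for j v
    using mass_le_norm[OF comm_B that] sum_norm_B_le by blast
  have Z: "closed_csubspace Z"
  proof (rule closed_csubspaceI)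
    show "0 \<in> Z"
      using closed_csubspaceD(2)[OF closed_csubspace_L, of m] le[of 0] mass_nonneg[of B _ 0]
      by (auto simp: Z_def intro!: tendsto_eventually always_eventually order_antisym)
    show "u + v \<in> Z" if "u \<in> Z" "v \<in> Z" for u v
    proof -
      have "(\<lambda>j. 2 * mass B j u + 2 * mass B j v) \<longlonglongrightarrow> 2 * 0 + 2 * 0"
        using that by (intro tendsto_intros) (auto simp: Z_def)
      then have "(\<lambda>j. mass B j (u + v)) \<longlonglongrightarrow> 0"
        by (intro Lim_null_comparison[OF always_eventually, of "\<lambda>j. mass B j (u + v)"])
          (auto simp: mass_nonneg mass_parallelogram_le[of B, OF B_bounded])
      then show ?thesis
        using that closed_csubspaceD(3)[OF closed_csubspace_L] by (auto simp: Z_def)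
    qed
    show "c *\<^sub>C u \<in> Z" if "u \<in> Z" for c u
    proof -
      have "(\<lambda>j. (cmod c)\<^sup>2 * mass B j u) \<longlonglongrightarrow> (cmod c)\<^sup>2 * 0"
        using that by (intro tendsto_intros) (auto simp: Z_def)
      then show ?thesis
        using that closed_csubspaceD(5)[OF closed_csubspace_L] by (auto simp: Z_def mass_scaleC[of B, OF B_bounded])
    qed
    show "closed Z"
      unfolding closed_sequential_limits
    proof (intro allI impI, elim conjE)
      fix s l assume sZ: "\<forall>k. s k \<in> Z" and s: "s \<longlonglongrightarrow> l"
      have sM: "s k \<in> M" for k using sZ by (simp add: Z_def)
      have lM: "l \<in> M" using closed_sequentially[OF closed_csubspaceD(1)[OF closed_csubspace_L] sM s] .
      \<comment> \<open>Closedness rests on the bound of the mass by the squared norm, which is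
        uniform in the degree.\<close>
      have "(\<lambda>j. mass B j l) \<longlonglongrightarrow> 0"
      proof (rule LIMSEQ_I)
        fix e :: real assume e: "e > 0"
        have "(\<lambda>k. (norm (l - s k))\<^sup>2) \<longlonglongrightarrow> (norm (l - l))\<^sup>2" by (intro tendsto_intros s)
        then have "eventually (\<lambda>k. (norm (l - s k))\<^sup>2 < e / 4) sequentially"
          by (rule order_tendstoD(2)) (use e in simp)
        then obtain k where k: "(norm (l - s k))\<^sup>2 < e / 4"
          by (auto simp: eventually_sequentially)
        have "(\<lambda>j. mass B j (s k)) \<longlonglongrightarrow> 0" using sZ by (simp add: Z_def)
        then have "eventually (\<lambda>j. mass B j (s k) < e / 4) sequentially"
          by (rule order_tendstoD(2)) (use e in simp)
        then obtain J where J: "\<And>j. j \<ge> J \<Longrightarrow> mass B j (s k) < e / 4"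
          by (auto simp: eventually_sequentially)
        have "norm (mass B j l - 0) < e" if "j \<ge> J" for j
        proof -
          have "mass B j l \<le> 2 * mass B j (l - s k) + 2 * mass B j (s k)"
            using mass_parallelogram_le[of B j "l - s k" "s k", OF B_bounded] by simp
          moreover have "mass B j (l - s k) \<le> (norm (l - s k))\<^sup>2"
            by (intro le closed_csubspaceD(4)[OF closed_csubspace_L] lM sM)
          ultimately show ?thesis using J[OF that] k mass_nonneg[of B j l] by simp
        qed
        then show "\<exists>J. \<forall>j\<ge>J. norm (mass B j l - 0) < e" by blast
      qed
      then show "l \<in> Z" using lM by (simp add: Z_def)
    qed
  qed
  have level: "L (m + d) \<ominus> L (Suc (m + d)) \<subseteq> Z" for d
  proof
    fix v assume v: "v \<in> L (m + d) \<ominus> L (Suc (m + d))"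
    have "eventually (\<lambda>j. mass B j v = 0) sequentially"
      unfolding eventually_sequentially using mass_B_level_zero[OF v] by (metis le_Suc_ex)
    then have "(\<lambda>j. mass B j v) \<longlonglongrightarrow> 0" by (rule tendsto_eventually)
    then show "v \<in> Z" using v L_antimono[of m "m + d"] by (auto simp: Z_def mem_ominus)
  qed
  define y where "y = x - proj Z x"
  have yZ: "cinner y u = 0" if "u \<in> Z" for u unfolding y_def by (rule proj_orth[OF Z that])
  have "y \<in> L (m + d)" for d
  proof (induction d)
    case 0
    have "proj Z x \<in> M" using proj_in[OF Z] by (simp add: Z_def)
    then show ?case using closed_csubspaceD(4)[OF closed_csubspace_L x] by (simp add: y_def)
  next
    case (Suc d)
    define q where "q = y - proj (L (Suc (m + d))) y"
    have "q \<in> L (m + d) \<ominus> L (Suc (m + d))"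
      unfolding q_def using proj_ominus[OF closed_csubspace_L closed_csubspace_L L_antimono Suc.IH, of "Suc (m + d)"]
        proj_in[OF closed_csubspace_ominus[OF closed_csubspace_L], of "m + d" "L (Suc (m + d))" y] by simp
    then have "cinner y q = 0" using level yZ by blast
    moreover have "cinner (proj (L (Suc (m + d))) y) q = 0"
      unfolding q_def by (rule cinner_eq_zero_commute[THEN iffD1, OF proj_orth[OF closed_csubspace_L proj_in[OF closed_csubspace_L]]])
    ultimately have "cinner q q = 0" unfolding q_def by (simp add: cinner_simps(5)[of y])
    then have "y = proj (L (Suc (m + d))) y" by (simp add: cinner_self q_def)
    then show ?case using proj_in[OF closed_csubspace_L] by (metis add_Suc_right)
  qed
  then have "y = 0" by (rule Inter_L_zero)
  then have "x \<in> Z" using proj_in[OF Z, of x] by (simp add: y_def)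
  then show ?thesis by (simp add: Z_def)
qed

lemma commuting_row_contraction_Mc: "commuting_row_contraction M Mc"
proof -
  have "commuting_tuple M Mc"
    unfolding commuting_tuple_def
  proof (intro conjI allI ballI)
    show "bounded_clinear_on M (Mc i)" for i
      unfolding compression_def[abs_def]
      by (rule bounded_clinear_on_sub[OF bounded_clinear_comp[OF bounded_clinear_proj[OF closed_csubspace_L] T]])
  qed (use comm_T in \<open>auto simp: compression_M T_L_same commuting_maps_def\<close>)
  moreover have "x - row_square M Mc x = proj N x" if "x \<in> M" for x
    using row_square_B[OF that] by (simp add: row_square_def adjoint_Mc compression_M B_in_M)
  moreover have "cinner (proj N x) x = of_real ((norm (proj N x))\<^sup>2)" for x
    using proj_cinner_left[OF closed_csubspace_N proj_in[OF closed_csubspace_N], of x x]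
    by (simp add: cinner_self)
  ultimately show ?thesis
    by (simp add: commuting_row_contraction_def positive_on_def del: of_real_power)
qed

lemma pure_Mc: "pure M Mc"
  using mass_B_tendsto_0 by (simp add: pure_def adjoint_mass_def adjoint_Mc mass_def)

section \<open>The nilpotent and the coisometric corner\<close>

lemma proj_Hnil_T:
  assumes x: "x \<in> L 0"
  shows "proj Hnil (T i x) = proj Hnil (T i (proj Hnil x))"
proof -
  have p: "proj Hnil x = x - proj M x"
    by (rule proj_ominus[OF closed_csubspace_L closed_csubspace_L L_antimono x]) simp
  have "T i (proj M x) \<in> M" by (rule T_L_same[OF proj_in[OF closed_csubspace_L]])
  then have "proj Hnil (T i (proj M x)) = 0"
    by (subst proj_eq_0_iff[OF closed_csubspace_ominus[OF closed_csubspace_L]])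
      (auto simp: mem_ominus intro: cinner_eq_zero_commute[THEN iffD1])
  moreover have "T i x = T i (proj Hnil x) + T i (proj M x)"
    unfolding p by (simp add: linear_diff[OF T_linear])
  ultimately show ?thesis by (simp add: proj_add[OF closed_csubspace_ominus[OF closed_csubspace_L]])
qed

text \<open>Since M is invariant, the compression to \<open>Hnil\<close> is the action of T on the
  quotient of \<open>L 0\<close> by M, and this respects products. A power of degree
  \<open>m\<close> takes \<open>L 0\<close> into \<open>L m\<close>, which is 0 in the
  quotient.\<close>

lemma nil_properties:
  "commuting_tuple Hnil (compression Hnil T)" "nilpotent_le Hnil (compression Hnil T) m"
proof -
  note Hn = closed_csubspace_ominus[OF closed_csubspace_L, of 0 M]
  have sub: "x \<in> Hnil \<Longrightarrow> x \<in> L 0" for x by (simp add: mem_ominus)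
  have inter: "proj Hnil (T i x) = compression Hnil T i (proj Hnil x)" if "x \<in> L 0" for i x
    unfolding compression_def by (rule proj_Hnil_T[OF that])
  show "commuting_tuple Hnil (compression Hnil T)"
    unfolding commuting_tuple_def
  proof (intro conjI allI ballI)
    show "bounded_clinear_on Hnil (compression Hnil T i)" for i
      unfolding compression_def[abs_def]
      by (rule bounded_clinear_on_sub[OF bounded_clinear_comp[OF bounded_clinear_proj[OF Hn] T]])
    show "compression Hnil T i ` Hnil \<subseteq> Hnil" for i
      by (auto simp: compression_def proj_in[OF Hn])
    fix i j x assume x: "x \<in> Hnil"
    have "compression Hnil T i (compression Hnil T j x) = proj Hnil (T i (T j x))" for i j
      by (subst (2) compression_def) (rule inter[OF T_L_same[OF sub[OF x]], symmetric])
    then show "compression Hnil T i (compression Hnil T j x) = compression Hnil T j (compression Hnil T i x)"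
      using comm_T by (simp add: commuting_maps_def)
  qed
  show "nilpotent_le Hnil (compression Hnil T) m"
    unfolding nilpotent_le_def
  proof (intro allI impI ballI)
    fix \<alpha> :: "'n \<Rightarrow> nat" and x assume \<alpha>: "mi_size \<alpha> = m" and x: "x \<in> Hnil"
    have "op_power (compression Hnil T) \<alpha> x = op_power (compression Hnil T) \<alpha> (proj Hnil x)"
      by (simp add: proj_id[OF Hn x])
    also have "\<dots> = proj Hnil (op_power T \<alpha> x)"
      by (rule op_power_intertwine[of "L 0", symmetric]) (auto intro: T_L_same sub x inter)
    also have "\<dots> = 0"
      using op_power_T_L[OF sub[OF x], of \<alpha>] \<alpha>
      by (subst proj_eq_0_iff[OF Hn]) (auto simp: mem_ominus intro: cinner_eq_zero_commute[THEN iffD1])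
    finally show "op_power (compression Hnil T) \<alpha> x = 0" .
  qed
qed

text \<open>As the complement of an invariant subspace, \<open>Hc\<close> is invariant under each
  T_i*. Hence compressing to it respects products, the adjoint of the compression is the restriction
  of T_i*, and \<open>D\<close> vanishes on \<open>Hc\<close>.\<close>

lemma coisometric_properties:
  "commuting_tuple Hc (compression Hc T)" "spherical_coisometry Hc (compression Hc T)"
proof -
  note H = closed_csubspace_ominus[OF closed_csubspace_UNIV, of "L 0"]
  have Ts_H: "Ts i x \<in> Hc" if "x \<in> Hc" for i x
    using that T_L_same by (auto simp: mem_ominus cinner_adj_left[OF T])
  have inter: "proj Hc (T i x) = compression Hc T i (proj Hc x)" for i x
  proof -
    have "proj Hc (T i (x - proj Hc x)) = 0"
      by (auto simp: proj_eq_0_iff[OF H] cinner_adj_right[OF T, symmetric] intro!: proj_orth[OF H] Ts_H)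
    then show ?thesis
      using proj_add[OF H, of "T i (x - proj Hc x)" "T i (proj Hc x)"]
      by (simp add: compression_def linear_diff[OF T_linear])
  qed
  show "commuting_tuple Hc (compression Hc T)"
    unfolding commuting_tuple_def
  proof (intro conjI allI ballI)
    show "bounded_clinear_on Hc (compression Hc T i)" for i
      unfolding compression_def[abs_def]
      by (rule bounded_clinear_on_sub[OF bounded_clinear_comp[OF bounded_clinear_proj[OF H] T]])
    show "compression Hc T i ` Hc \<subseteq> Hc" for i
      by (auto simp: compression_def proj_in[OF H])
    fix i j x
    have "compression Hc T i (compression Hc T j x) = proj Hc (T i (T j x))" for i j
      by (subst (2) compression_def) (rule inter[symmetric])
    then show "compression Hc T i (compression Hc T j x) = compression Hc T j (compression Hc T i x)"
      using comm_T by (simp add: commuting_maps_def)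
  qed
  have adj: "adjoint_on Hc (compression Hc T i) x = Ts i x" if x: "x \<in> Hc" for i x
  proof (rule adjoint_on_eqI[OF H Ts_H[OF x]])
    show "cinner (compression Hc T i u) x = cinner u (Ts i x)" if "u \<in> Hc" for u
      using x by (simp add: compression_def proj_cinner_right[OF H] cinner_adj_right[OF T])
  qed
  show "spherical_coisometry Hc (compression Hc T)"
    unfolding spherical_coisometry_def
  proof
    fix x assume x: "x \<in> Hc"
    then have "D (op_power Ts (\<lambda>_. 0) x) = 0" using orthogonal_L_0_iff[of x] by (auto simp: mem_ominus)
    then have "(\<Sum>i\<in>UNIV. T i (Ts i x)) = x" by (simp add: op_power_0 D_zero_iff)
    moreover have "row_square Hc (compression Hc T) x = proj Hc (\<Sum>i\<in>UNIV. T i (Ts i x))"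
      using linear_sum[OF bounded_linear.linear[OF bounded_clinear_bounded_linear[OF bounded_clinear_proj[OF H]]],
          of "\<lambda>i. T i (Ts i x)" UNIV]
      by (simp add: row_square_def adj[OF x] compression_def)
    ultimately show "row_square Hc (compression Hc T) x = x" by (simp add: proj_id[OF H x])
  qed
qed

lemma triangular:
  "x \<in> M \<Longrightarrow> proj Hnil (T i x) = 0" "x \<in> L 0 \<Longrightarrow> proj Hc (T i x) = 0"
proof -
  show "proj Hnil (T i x) = 0" if "x \<in> M"
    using T_L_same[OF that, of i]
    by (subst proj_eq_0_iff[OF closed_csubspace_ominus[OF closed_csubspace_L]])
      (auto simp: mem_ominus intro: cinner_eq_zero_commute[THEN iffD1])
  show "proj Hc (T i x) = 0" if "x \<in> L 0"
    using T_L_same[OF that, of i]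
    by (subst proj_eq_0_iff[OF closed_csubspace_ominus[OF closed_csubspace_UNIV]])
      (auto simp: mem_ominus intro: cinner_eq_zero_commute[THEN iffD1])
qed

end

section \<open>The Drury--Arveson model\<close>

lemma mi_gamma_dec_le: "\<alpha> i > 0 \<Longrightarrow> mi_gamma (mi_dec \<alpha> i) \<le> mi_gamma \<alpha>"
proof -
  assume pos: "\<alpha> i > 0"
  have le: "\<alpha> i \<le> mi_size \<alpha>" using member_le_sum[of i UNIV \<alpha>] by (simp add: mi_size_def)
  then have "real (\<alpha> i) / real (mi_size \<alpha>) \<le> 1" using pos by simp
  then have "mi_gamma \<alpha> * (real (\<alpha> i) / real (mi_size \<alpha>)) \<le> mi_gamma \<alpha> * 1"
    using mi_gamma_pos[of \<alpha>] by (intro mult_left_mono) auto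
  then show "mi_gamma (mi_dec \<alpha> i) \<le> mi_gamma \<alpha>" using mi_gamma_dec[where \<alpha> = \<alpha> and i = i] pos by simp
qed

lemma mi_gamma_ge_1: "mi_gamma \<alpha> \<ge> 1"
proof (induction "mi_size \<alpha>" arbitrary: \<alpha>)
  case 0
  then have "\<alpha> = (\<lambda>_. 0)" using mi_size_0_iff by metis
  then show ?case by (simp add: mi_gamma_0)
next
  case (Suc k)
  from Suc.hyps(2)[symmetric] obtain \<beta> i where \<beta>: "mi_size \<beta> = k" "\<alpha> = mi_inc \<beta> i"
    by (rule mi_size_SucE)
  then have "1 \<le> mi_gamma \<beta>" using Suc.hyps(1) by simp
  also have "\<dots> \<le> mi_gamma \<alpha>"
    using mi_gamma_dec_le[of \<alpha> i] mi_inc_pos[of \<beta> i] by (simp add: \<beta> mi_dec_inc)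
  finally show ?case .
qed

text \<open>The multinomial theorem for moduli. It dominates a power series with coefficients of
  size \<gamma>_\<alpha> by a geometric series wherever the moduli of the coordinates add up to less
  than 1.\<close>

lemma sum_mi_gamma_cmod_power:
  "(\<Sum>\<alpha> | mi_size \<alpha> = k. mi_gamma \<alpha> * cmod (mi_power z \<alpha>)) = (\<Sum>i\<in>UNIV. cmod (z $ i)) ^ k"
proof (induction k)
  case 0
  then show ?case by (simp add: sum_mi_size_0 mi_gamma_0 mi_power_0)
next
  case (Suc k)
  have inc: "(\<Sum>i\<in>UNIV. cmod (mi_power z (mi_inc \<alpha> i))) = (\<Sum>i\<in>UNIV. cmod (z $ i)) * cmod (mi_power z \<alpha>)" for \<alpha>
    by (simp add: mi_power_inc norm_mult sum_distrib_right)
  have "(\<Sum>\<alpha> | mi_size \<alpha> = Suc k. mi_gamma \<alpha> * cmod (mi_power z \<alpha>))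
      = (\<Sum>\<alpha> | mi_size \<alpha> = k. mi_gamma \<alpha> * (\<Sum>i\<in>UNIV. cmod (mi_power z (mi_inc \<alpha> i))))"
    using sum_mi_gamma_Suc[of "\<lambda>\<alpha>. cmod (mi_power z \<alpha>)" k] by simp
  also have "\<dots> = (\<Sum>\<alpha> | mi_size \<alpha> = k. (\<Sum>i\<in>UNIV. cmod (z $ i)) * (mi_gamma \<alpha> * cmod (mi_power z \<alpha>)))"
    by (simp add: inc mult_ac)
  also have "\<dots> = (\<Sum>i\<in>UNIV. cmod (z $ i)) ^ Suc k"
    by (simp add: Suc sum_distrib_left[symmetric])
  finally show ?case .
qed

lemma sum_mi_size_group: "(\<Sum>\<alpha> | mi_size \<alpha> < k. f \<alpha>) = (\<Sum>j<k. \<Sum>\<alpha> | mi_size \<alpha> = j. f \<alpha>)"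
  by (induction k) (simp_all add: sum_mi_size_less_Suc)

text \<open>Lets an unordered sum over multi-indices be evaluated along its truncations by degree,
  the form in which the sums telescope.\<close>

lemma filterlim_mi_size_less:
  "filterlim (\<lambda>k. {\<alpha> :: 'n::finite \<Rightarrow> nat. mi_size \<alpha> < k}) (finite_subsets_at_top UNIV) sequentially"
  unfolding filterlim_finite_subsets_at_top
proof (intro allI impI)
  fix X :: "('n \<Rightarrow> nat) set" assume X: "finite X \<and> X \<subseteq> UNIV"
  obtain b where b: "\<And>x. x \<in> mi_size ` X \<Longrightarrow> x < b"
    using X finite_nat_set_iff_bounded[of "mi_size ` X"] by auto
  have "X \<subseteq> {\<alpha>. mi_size \<alpha> < k}" if "k \<ge> b" for k using b that by fastforce
  then show "\<forall>\<^sub>F k in sequentially. finite {\<alpha> :: 'n \<Rightarrow> nat. mi_size \<alpha> < k} \<and> X \<subseteq> {\<alpha>. mi_size \<alpha> < k} \<and> {\<alpha>. mi_size \<alpha> < k} \<subseteq> UNIV"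
    unfolding eventually_sequentially by (auto simp: finite_mi_size_less)
qed

lemma has_sum_mi_size_less:
  assumes "(f has_sum s) (UNIV :: ('n::finite \<Rightarrow> nat) set)"
  shows "(\<lambda>k. \<Sum>\<alpha> | mi_size \<alpha> < k. f \<alpha>) \<longlonglongrightarrow> s"
  using filterlim_compose[OF assms[unfolded has_sum_def] filterlim_mi_size_less] .

lemma DA_mult_eq: "DA_mult i a \<beta> = (if \<beta> i = 0 then 0 else a (mi_dec \<beta> i))"
  by (simp add: DA_mult_def mi_dec_def)

text \<open>Square summability bounds the coefficients by a multiple of the square root of
  \<gamma>_\<alpha>; the weaker bound by \<gamma>_\<alpha> is the one that pairs with
  \<open>sum_mi_gamma_cmod_power\<close>.\<close>

lemma DA_space_bound:
  assumes "a \<in> DA_space W"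
  obtains C where "C \<ge> 0" "\<And>\<alpha>. norm (a \<alpha>) \<le> C * mi_gamma \<alpha>"
proof -
  define s where "s = (\<Sum>\<^sub>\<infinity>\<alpha>. (norm (a \<alpha>))\<^sup>2 / mi_gamma \<alpha>)"
  have sm: "(\<lambda>\<alpha>. (norm (a \<alpha>))\<^sup>2 / mi_gamma \<alpha>) summable_on UNIV" using assms by (simp add: DA_space_def)
  have nonneg: "0 \<le> (norm (a \<alpha>))\<^sup>2 / mi_gamma \<alpha>" for \<alpha> using mi_gamma_pos[of \<alpha>] by simp
  have bound: "(norm (a \<alpha>))\<^sup>2 / mi_gamma \<alpha> \<le> s" for \<alpha>
    using finite_sum_le_infsum[OF sm, of "{\<alpha>}"] nonneg by (simp add: s_def)
  have s0: "s \<ge> 0" using bound[of undefined] nonneg[of undefined] by linarith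
  have "norm (a \<alpha>) \<le> sqrt s * mi_gamma \<alpha>" for \<alpha>
  proof (rule power2_le_imp_le)
    have "(norm (a \<alpha>))\<^sup>2 \<le> s * mi_gamma \<alpha>"
      using bound[of \<alpha>] mi_gamma_pos[of \<alpha>] by (simp add: pos_divide_le_eq)
    also have "\<dots> \<le> s * (mi_gamma \<alpha>)\<^sup>2"
      using s0 mi_gamma_ge_1[of \<alpha>] by (intro mult_left_mono) (auto simp: power2_eq_square)
    finally show "(norm (a \<alpha>))\<^sup>2 \<le> (sqrt s * mi_gamma \<alpha>)\<^sup>2" using s0 by (simp add: power_mult_distrib)
  qed (use s0 less_imp_le[OF mi_gamma_pos[of \<alpha>]] in auto)
  then show ?thesis using that[of "sqrt s"] s0 by simp
qed

section \<open>The embedding into the Drury--Arveson space and its adjoint\<close>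

context poly_row_contraction
begin

text \<open>Truncation by degree of the adjoint of \<open>U\<close>.\<close>

definition partial_sum :: "(('n \<Rightarrow> nat) \<Rightarrow> 'a) \<Rightarrow> nat \<Rightarrow> 'a" where
  "partial_sum a k = (\<Sum>\<alpha> | mi_size \<alpha> < k. op_power T \<alpha> (a \<alpha>))"

definition U :: "'a \<Rightarrow> ('n \<Rightarrow> nat) \<Rightarrow> 'a" where
  "U x \<alpha> = mi_gamma \<alpha> *\<^sub>R proj N (op_power B \<alpha> x)"

lemma op_power_T: "bounded_clinear_on UNIV (op_power T \<alpha>)"
  and op_power_B: "bounded_clinear_on UNIV (op_power B \<alpha>)"
  by (rule bounded_clinear_op_power, rule T B_bounded)+

lemma op_power_T_linear: "linear (op_power T \<alpha>)" and op_power_B_linear: "linear (op_power B \<alpha>)"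
  by (rule bounded_linear.linear, rule bounded_clinear_bounded_linear, rule op_power_T op_power_B)+

lemma op_power_T_M: "x \<in> M \<Longrightarrow> op_power T \<alpha> x \<in> M"
  by (rule op_power_invariant) (auto intro: T_L_same)

lemma op_power_B_M: "x \<in> M \<Longrightarrow> op_power B \<alpha> x \<in> M"
  by (rule op_power_invariant) (auto intro: B_in_M)

lemma cinner_op_power_T:
  assumes "x \<in> M" "y \<in> M"
  shows "cinner (op_power T \<alpha> x) y = cinner x (op_power B \<alpha> y)"
  by (rule cinner_op_power[OF comm_T_M comm_B _ assms]) (rule cinner_B)

lemma N_subset_M: "x \<in> N \<Longrightarrow> x \<in> M"
  by (simp add: mem_ominus)

lemma norm_proj_N_sq:
  assumes x: "x \<in> M"
  shows "(norm (proj N x))\<^sup>2 = (norm x)\<^sup>2 - (\<Sum>i\<in>UNIV. (norm (B i x))\<^sup>2)"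
proof -
  have "complex_of_real ((norm (proj N x))\<^sup>2) = cinner (proj N x) x"
    using proj_cinner_left[OF closed_csubspace_N proj_in[OF closed_csubspace_N], of x x] by (simp add: cinner_self)
  also have "\<dots> = cinner x x - (\<Sum>i\<in>UNIV. cinner (T i (B i x)) x)"
    unfolding cinner_simps(11)[symmetric] row_square_B[OF x] by (simp add: cinner_simps)
  also have "\<dots> = complex_of_real ((norm x)\<^sup>2 - (\<Sum>i\<in>UNIV. (norm (B i x))\<^sup>2))"
    by (simp add: cinner_B[OF B_in_M] cinner_self)
  finally show ?thesis using of_real_eq_iff by blast
qed

lemma sum_proj_N_less:
  assumes x: "x \<in> M"
  shows "(\<Sum>\<alpha> | mi_size \<alpha> < k. mi_gamma \<alpha> * (norm (proj N (op_power B \<alpha> x)))\<^sup>2) = (norm x)\<^sup>2 - mass B k x"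
proof (induction k)
  case (Suc k)
  then show ?case
    using mass_diff[OF comm_B x norm_proj_N_sq, of k] by (simp add: sum_mi_size_less_Suc)
qed (simp add: mass_0)

lemma sum_proj_N_finite:
  assumes x: "x \<in> M" and F: "finite F"
  shows "(\<Sum>\<alpha>\<in>F. mi_gamma \<alpha> * (norm (proj N (op_power B \<alpha> x)))\<^sup>2) \<le> (norm x)\<^sup>2"
proof -
  obtain b where b: "\<And>y. y \<in> mi_size ` F \<Longrightarrow> y < b"
    using F finite_nat_set_iff_bounded[of "mi_size ` F"] by auto
  have "(\<Sum>\<alpha>\<in>F. mi_gamma \<alpha> * (norm (proj N (op_power B \<alpha> x)))\<^sup>2)
      \<le> (\<Sum>\<alpha> | mi_size \<alpha> < b. mi_gamma \<alpha> * (norm (proj N (op_power B \<alpha> x)))\<^sup>2)"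
    by (rule sum_mono2) (auto simp: finite_mi_size_less b less_imp_le[OF mi_gamma_pos])
  then show ?thesis using sum_proj_N_less[OF x, of b] mass_nonneg[of B b x] by linarith
qed

lemma norm_U_sq: "(norm (U x \<alpha>))\<^sup>2 / mi_gamma \<alpha> = mi_gamma \<alpha> * (norm (proj N (op_power B \<alpha> x)))\<^sup>2"
  using mi_gamma_pos[of \<alpha>] by (simp add: U_def power_mult_distrib power2_eq_square)

lemma U_in_N: "U x \<alpha> \<in> N"
  unfolding U_def by (intro closed_csubspaceD(6)[OF closed_csubspace_N] proj_in closed_csubspace_N)

lemma U_in_DA:
  assumes x: "x \<in> M"
  shows "U x \<in> DA_space N"
proof -
  have "(\<lambda>\<alpha>. (norm (U x \<alpha>))\<^sup>2 / mi_gamma \<alpha>) summable_on UNIV"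
  proof (rule nonneg_bounded_partial_sums_imp_summable_on)
    show "\<forall>\<^sub>F F in finite_subsets_at_top UNIV. (\<Sum>\<alpha>\<in>F. (norm (U x \<alpha>))\<^sup>2 / mi_gamma \<alpha>) \<le> (norm x)\<^sup>2"
      using sum_proj_N_finite[OF x] by (intro eventually_finite_subsets_at_top_weakI) (simp add: norm_U_sq)
  qed (simp add: less_imp_le[OF mi_gamma_pos])
  then show ?thesis using U_in_N by (auto simp: DA_space_def)
qed

text \<open>Writing the projection onto N as the identity minus the sum of the T_i
  \<open>B i\<close> makes the contribution of each degree the difference of two consecutive
  remainders.\<close>

lemma partial_sum_U:
  assumes x: "x \<in> M"
  shows "partial_sum (U x) k = x - (\<Sum>\<alpha> | mi_size \<alpha> = k. mi_gamma \<alpha> *\<^sub>R op_power T \<alpha> (op_power B \<alpha> x))"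
proof (induction k)
  case 0
  then show ?case by (simp add: partial_sum_def sum_mi_size_0 mi_gamma_0 op_power_0)
next
  case (Suc k)
  have step: "op_power T \<alpha> (proj N (op_power B \<alpha> x))
      = op_power T \<alpha> (op_power B \<alpha> x) - (\<Sum>i\<in>UNIV. op_power T (mi_inc \<alpha> i) (op_power B (mi_inc \<alpha> i) x))" for \<alpha>
  proof -
    have "proj N (op_power B \<alpha> x) = op_power B \<alpha> x - (\<Sum>i\<in>UNIV. T i (B i (op_power B \<alpha> x)))"
      using row_square_B[OF op_power_B_M[OF x], of \<alpha>] by simp
    then show ?thesis
      by (simp add: linear_diff[OF op_power_T_linear] linear_sum[OF op_power_T_linear]
          op_power_inc[OF comm_T] op_power_inc[OF comm_B x] op_power_commute[OF comm_B x])
  qed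
  have "partial_sum (U x) (Suc k) = partial_sum (U x) k + (\<Sum>\<alpha> | mi_size \<alpha> = k. mi_gamma \<alpha> *\<^sub>R op_power T \<alpha> (proj N (op_power B \<alpha> x)))"
    by (simp add: partial_sum_def sum_mi_size_less_Suc U_def linear_scale[OF op_power_T_linear])
  also have "(\<Sum>\<alpha> | mi_size \<alpha> = k. mi_gamma \<alpha> *\<^sub>R op_power T \<alpha> (proj N (op_power B \<alpha> x)))
      = (\<Sum>\<alpha> | mi_size \<alpha> = k. mi_gamma \<alpha> *\<^sub>R op_power T \<alpha> (op_power B \<alpha> x))
        - (\<Sum>\<alpha> | mi_size \<alpha> = Suc k. mi_gamma \<alpha> *\<^sub>R op_power T \<alpha> (op_power B \<alpha> x))"
    unfolding step sum_mi_gamma_Suc by (simp add: scaleR_diff_right sum_subtractf)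
  finally show ?case using Suc by simp
qed

text \<open>The squared norm of the remainder \<open>y\<close> is at most half the mass of
  \<open>x\<close> plus half the mass of \<open>y\<close>, and the latter is at most the squared
  norm of \<open>y\<close>. Absorbing it on the left leaves the mass of \<open>x\<close>, which
  tends to 0.\<close>

lemma partial_sum_U_tendsto:
  assumes x: "x \<in> M"
  shows "partial_sum (U x) \<longlonglongrightarrow> x"
proof -
  have "(norm (partial_sum (U x) k - x))\<^sup>2 \<le> mass B k x" for k
  proof -
    define y where "y = (\<Sum>\<alpha> | mi_size \<alpha> = k. mi_gamma \<alpha> *\<^sub>R op_power T \<alpha> (op_power B \<alpha> x))"
    have yM: "y \<in> M"
      unfolding y_def
      by (intro closed_csubspace_sum closed_csubspace_L closed_csubspaceD(6)[OF closed_csubspace_L] op_power_T_M op_power_B_M x)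
    have "(norm y)\<^sup>2 = Re (cinner y y)" by (simp add: cinner_self)
    also have "\<dots> = (\<Sum>\<alpha> | mi_size \<alpha> = k. mi_gamma \<alpha> * Re (cinner (op_power B \<alpha> x) (op_power B \<alpha> y)))"
      by (subst (1) y_def)
        (simp add: cinner_simps cinner_scaleR_left cinner_op_power_T[OF op_power_B_M[OF x] yM])
    also have "\<dots> \<le> (\<Sum>\<alpha> | mi_size \<alpha> = k. mi_gamma \<alpha> * ((norm (op_power B \<alpha> x))\<^sup>2 / 2 + (norm (op_power B \<alpha> y))\<^sup>2 / 2))"
    proof (intro sum_mono mult_left_mono)
      fix \<alpha>
      have "Re (cinner (op_power B \<alpha> x) (op_power B \<alpha> y)) \<le> norm (op_power B \<alpha> x) * norm (op_power B \<alpha> y)"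
        by (metis inner_eq_Re_cinner norm_cauchy_schwarz)
      also have "\<dots> \<le> (norm (op_power B \<alpha> x))\<^sup>2 / 2 + (norm (op_power B \<alpha> y))\<^sup>2 / 2"
        using sum_squares_bound[of "norm (op_power B \<alpha> x)" "norm (op_power B \<alpha> y)"] by simp
      finally show "Re (cinner (op_power B \<alpha> x) (op_power B \<alpha> y)) \<le> (norm (op_power B \<alpha> x))\<^sup>2 / 2 + (norm (op_power B \<alpha> y))\<^sup>2 / 2" .
    qed (rule less_imp_le[OF mi_gamma_pos])
    also have "\<dots> = mass B k x / 2 + mass B k y / 2"
      by (simp add: mass_def distrib_left sum.distrib sum_divide_distrib)
    finally have "(norm y)\<^sup>2 \<le> mass B k x / 2 + mass B k y / 2" .
    moreover have "mass B k y \<le> (norm y)\<^sup>2" using mass_le_norm[OF comm_B yM] sum_norm_B_le by blast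
    ultimately have "(norm y)\<^sup>2 \<le> mass B k x" by simp
    then show ?thesis by (simp add: partial_sum_U[OF x] y_def)
  qed
  then have "(\<lambda>k. (norm (partial_sum (U x) k - x))\<^sup>2) \<longlonglongrightarrow> 0"
    by (intro Lim_null_comparison[OF always_eventually mass_B_tendsto_0[OF x]]) simp
  then have "(\<lambda>k. sqrt ((norm (partial_sum (U x) k - x))\<^sup>2)) \<longlonglongrightarrow> sqrt 0" by (rule tendsto_real_sqrt)
  then have "(\<lambda>k. norm (partial_sum (U x) k - x)) \<longlonglongrightarrow> 0" by simp
  then show ?thesis by (metis LIM_zero_cancel tendsto_norm_zero_iff)
qed

text \<open>The truncated inner product of \<open>U x\<close> and \<open>U y\<close> is that of
  \<open>partial_sum (U x) k\<close> and \<open>y\<close>, so the isometry follows from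
  \<open>partial_sum_U_tendsto\<close>.\<close>

lemma DA_cinner_U:
  assumes x: "x \<in> M" and y: "y \<in> M"
  shows "DA_cinner (U x) (U y) = cinner x y"
proof -
  let ?f = "\<lambda>\<alpha>. cinner (U x \<alpha>) (U y \<alpha>) / complex_of_real (mi_gamma \<alpha>)"
  have "(\<lambda>\<alpha>. norm (?f \<alpha>)) summable_on UNIV"
  proof (rule Infinite_Sum.abs_summable_on_comparison_test)
    have "(\<lambda>\<alpha>. (norm (U x \<alpha>))\<^sup>2 / mi_gamma \<alpha> + (norm (U y \<alpha>))\<^sup>2 / mi_gamma \<alpha>) summable_on UNIV"
      using U_in_DA[OF x] U_in_DA[OF y] by (intro summable_on_add) (auto simp: DA_space_def)
    then show "(\<lambda>\<alpha>. norm ((norm (U x \<alpha>))\<^sup>2 / mi_gamma \<alpha> + (norm (U y \<alpha>))\<^sup>2 / mi_gamma \<alpha>)) summable_on UNIV"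
      by (simp add: less_imp_le[OF mi_gamma_pos])
    fix \<alpha>
    have "cmod (cinner (U x \<alpha>) (U y \<alpha>)) \<le> norm (U x \<alpha>) * norm (U y \<alpha>)" by (rule cmod_cinner_le)
    also have "\<dots> \<le> (norm (U x \<alpha>))\<^sup>2 + (norm (U y \<alpha>))\<^sup>2"
      using sum_squares_bound[of "norm (U x \<alpha>)" "norm (U y \<alpha>)"]
        mult_nonneg_nonneg[OF norm_ge_zero norm_ge_zero, of "U x \<alpha>" "U y \<alpha>"] by linarith
    finally have "norm (?f \<alpha>) \<le> ((norm (U x \<alpha>))\<^sup>2 + (norm (U y \<alpha>))\<^sup>2) / mi_gamma \<alpha>"
      using mi_gamma_pos[of \<alpha>] by (simp add: norm_divide divide_right_mono)
    also have "\<dots> \<le> norm ((norm (U x \<alpha>))\<^sup>2 / mi_gamma \<alpha> + (norm (U y \<alpha>))\<^sup>2 / mi_gamma \<alpha>)"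
      by (simp add: add_divide_distrib)
    finally show "norm (?f \<alpha>) \<le> norm ((norm (U x \<alpha>))\<^sup>2 / mi_gamma \<alpha> + (norm (U y \<alpha>))\<^sup>2 / mi_gamma \<alpha>)" .
  qed
  then have "(?f has_sum DA_cinner (U x) (U y)) UNIV"
    unfolding DA_cinner_def by (rule has_sum_infsum[OF abs_summable_summable])
  then have "(\<lambda>k. \<Sum>\<alpha> | mi_size \<alpha> < k. ?f \<alpha>) \<longlonglongrightarrow> DA_cinner (U x) (U y)"
    by (rule has_sum_mi_size_less)
  moreover have "(\<Sum>\<alpha> | mi_size \<alpha> < k. ?f \<alpha>) = cinner (partial_sum (U x) k) y" for k
  proof -
    have "?f \<alpha> = cinner (op_power T \<alpha> (U x \<alpha>)) y" for \<alpha>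
    proof -
      have "cinner (U x \<alpha>) (U y \<alpha>) = of_real (mi_gamma \<alpha>) * cinner (U x \<alpha>) (op_power B \<alpha> y)"
        unfolding U_def[of y] by (simp add: cinner_scaleR_right proj_cinner_left[OF closed_csubspace_N U_in_N] scaleR_conv_of_real)
      then show ?thesis
        using mi_gamma_pos[of \<alpha>] by (simp add: cinner_op_power_T[OF N_subset_M[OF U_in_N] y])
    qed
    then show ?thesis by (simp add: partial_sum_def cinner_simps)
  qed
  moreover have "(\<lambda>k. cinner (partial_sum (U x) k) y) \<longlonglongrightarrow> cinner x y"
    by (intro bounded_bilinear.tendsto[OF bounded_bilinear_cinner] partial_sum_U_tendsto x tendsto_const)
  ultimately show ?thesis using LIMSEQ_unique by simp
qed

text \<open>The adjoint of a contraction is a contraction: the sum is paired with itself, its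
  projected adjoint powers are controlled by \<open>sum_proj_N_finite\<close>, and half of the
  squared norm is absorbed.\<close>

lemma norm_sum_op_power_le:
  fixes a :: "('n \<Rightarrow> nat) \<Rightarrow> 'a"
  assumes F: "finite F" and a: "\<And>\<alpha>. a \<alpha> \<in> N"
  shows "(norm (\<Sum>\<alpha>\<in>F. op_power T \<alpha> (a \<alpha>)))\<^sup>2 \<le> (\<Sum>\<alpha>\<in>F. (norm (a \<alpha>))\<^sup>2 / mi_gamma \<alpha>)"
proof -
  define y where "y = (\<Sum>\<alpha>\<in>F. op_power T \<alpha> (a \<alpha>))"
  have yM: "y \<in> M"
    unfolding y_def by (intro closed_csubspace_sum closed_csubspace_L op_power_T_M N_subset_M a)
  let ?p = "\<lambda>\<alpha>. proj N (op_power B \<alpha> y)"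
  have amgm: "u * v \<le> (u\<^sup>2 + v\<^sup>2) / 2" for u v :: real
    using sum_squares_bound[of u v] by simp
  have "(norm y)\<^sup>2 = Re (cinner y y)" by (simp add: cinner_self)
  also have "\<dots> = (\<Sum>\<alpha>\<in>F. Re (cinner (a \<alpha>) (?p \<alpha>)))"
    by (subst (1) y_def)
      (simp add: cinner_simps cinner_op_power_T[OF N_subset_M[OF a] yM] proj_cinner_left[OF closed_csubspace_N a])
  also have "\<dots> \<le> (\<Sum>\<alpha>\<in>F. ((norm (a \<alpha>))\<^sup>2 / mi_gamma \<alpha>) / 2 + mi_gamma \<alpha> * (norm (?p \<alpha>))\<^sup>2 / 2)"
  proof (rule sum_mono)
    fix \<alpha> :: "'n \<Rightarrow> nat"
    have g: "mi_gamma \<alpha> > 0" by (rule mi_gamma_pos)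
    have "Re (cinner (a \<alpha>) (?p \<alpha>)) \<le> norm (a \<alpha>) * norm (?p \<alpha>)"
      by (metis inner_eq_Re_cinner norm_cauchy_schwarz)
    \<comment> \<open>Splitting by the square root of the weight gives one side
      \<open>1 / mi_gamma \<alpha>\<close> and the other \<open>mi_gamma \<alpha>\<close>, as the
      two sums require.\<close>
    also have "\<dots> = (norm (a \<alpha>) / sqrt (mi_gamma \<alpha>)) * (sqrt (mi_gamma \<alpha>) * norm (?p \<alpha>))" using g by simp
    also have "\<dots> \<le> ((norm (a \<alpha>) / sqrt (mi_gamma \<alpha>))\<^sup>2 + (sqrt (mi_gamma \<alpha>) * norm (?p \<alpha>))\<^sup>2) / 2"
      by (rule amgm)
    also have "\<dots> = ((norm (a \<alpha>))\<^sup>2 / mi_gamma \<alpha>) / 2 + mi_gamma \<alpha> * (norm (?p \<alpha>))\<^sup>2 / 2"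
      using g by (simp add: power_mult_distrib power_divide add_divide_distrib)
    finally show "Re (cinner (a \<alpha>) (?p \<alpha>)) \<le> ((norm (a \<alpha>))\<^sup>2 / mi_gamma \<alpha>) / 2 + mi_gamma \<alpha> * (norm (?p \<alpha>))\<^sup>2 / 2" .
  qed
  also have "\<dots> = (\<Sum>\<alpha>\<in>F. (norm (a \<alpha>))\<^sup>2 / mi_gamma \<alpha>) / 2 + (\<Sum>\<alpha>\<in>F. mi_gamma \<alpha> * (norm (?p \<alpha>))\<^sup>2) / 2"
    by (simp add: sum.distrib sum_divide_distrib)
  finally show ?thesis using sum_proj_N_finite[OF yM F] by (simp add: y_def)
qed

lemma partial_sum_convergent:
  assumes a: "a \<in> DA_space N"
  obtains x where "x \<in> M" "partial_sum a \<longlonglongrightarrow> x"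
proof -
  have aN: "a \<alpha> \<in> N" for \<alpha> using a by (auto simp: DA_space_def)
  let ?g = "\<lambda>\<alpha>. (norm (a \<alpha>))\<^sup>2 / mi_gamma \<alpha>"
  define A where "A k = (\<Sum>\<alpha> | mi_size \<alpha> < k. ?g \<alpha>)" for k
  have "?g summable_on UNIV" using a by (simp add: DA_space_def)
  then have "(?g has_sum infsum ?g UNIV) UNIV" by simp
  then have "A \<longlonglongrightarrow> infsum ?g UNIV" unfolding A_def by (rule has_sum_mi_size_less)
  then have cA: "Cauchy A" by (rule LIMSEQ_imp_Cauchy)
  have le: "(norm (partial_sum a l - partial_sum a k))\<^sup>2 \<le> A l - A k" if "k \<le> l" for k l
  proof -
    have split: "(\<Sum>\<alpha> | mi_size \<alpha> < l. f \<alpha>) - (\<Sum>\<alpha> | mi_size \<alpha> < k. f \<alpha>) = (\<Sum>\<alpha> | k \<le> mi_size \<alpha> \<and> mi_size \<alpha> < l. f \<alpha>)"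
      for f :: "('n \<Rightarrow> nat) \<Rightarrow> 'c::ab_group_add"
    proof -
      have "{\<alpha> :: 'n \<Rightarrow> nat. mi_size \<alpha> < l} - {\<alpha>. mi_size \<alpha> < k} = {\<alpha>. k \<le> mi_size \<alpha> \<and> mi_size \<alpha> < l}" by auto
      then show ?thesis
        using sum_diff[of "{\<alpha> :: 'n \<Rightarrow> nat. mi_size \<alpha> < l}" "{\<alpha>. mi_size \<alpha> < k}" f] that
        by (simp add: finite_mi_size_less subset_iff)
    qed
    have "finite {\<alpha> :: 'n \<Rightarrow> nat. k \<le> mi_size \<alpha> \<and> mi_size \<alpha> < l}"
      by (rule finite_subset[OF _ finite_mi_size_less[of l]]) auto
    then show ?thesis
      unfolding partial_sum_def A_def split by (rule norm_sum_op_power_le) (rule aN)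
  qed
  have "Cauchy (partial_sum a)"
  proof (rule metric_CauchyI)
    fix e :: real assume e: "e > 0"
    then obtain K where K: "\<And>j k. j \<ge> K \<Longrightarrow> k \<ge> K \<Longrightarrow> dist (A j) (A k) < e\<^sup>2"
      using metric_CauchyD[OF cA, of "e\<^sup>2"] by auto
    have small: "dist (partial_sum a l) (partial_sum a k) < e" if "K \<le> k" "k \<le> l" for k l
    proof -
      have "(norm (partial_sum a l - partial_sum a k))\<^sup>2 < e\<^sup>2"
        using le[OF that(2)] K[of l k] that by (simp add: dist_real_def)
      then show ?thesis using e by (simp add: dist_norm power_less_imp_less_base)
    qed
    show "\<exists>K. \<forall>j\<ge>K. \<forall>k\<ge>K. dist (partial_sum a j) (partial_sum a k) < e"
    proof (intro exI allI impI)
      fix j k assume "K \<le> j" "K \<le> k"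
      then show "dist (partial_sum a j) (partial_sum a k) < e"
        using small[of j k] small[of k j] by (cases "j \<le> k") (auto simp: dist_commute)
    qed
  qed
  then obtain x where x: "partial_sum a \<longlonglongrightarrow> x" using Cauchy_convergent convergent_def by blast
  have "partial_sum a k \<in> M" for k
    unfolding partial_sum_def by (intro closed_csubspace_sum closed_csubspace_L op_power_T_M N_subset_M aN)
  then have "x \<in> M" using closed_sequentially[OF closed_csubspaceD(1)[OF closed_csubspace_L] _ x] by blast
  then show ?thesis using x that by blast
qed

section \<open>Regularity, surjectivity and the intertwining relation\<close>

definition shifted_range :: "(complex, 'n) vec \<Rightarrow> 'a set" where
  "shifted_range z = tuple_range M (\<lambda>i x. T i x - (z $ i) *\<^sub>C x)"

lemma shifted_bounded: "bounded_clinear_on UNIV (\<lambda>x. T i x - c *\<^sub>C x)"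
  by (intro bounded_clinear_diff T bounded_clinear_scaled bounded_clinear_id)

lemma subspace_shifted_range: "complex_vector.subspace (shifted_range z)"
  unfolding shifted_range_def by (rule subspace_tuple_range[OF closed_csubspace_L shifted_bounded])

text \<open>The remainder theorem for polynomials: modulo the range of T - z, each T_i acts as the
  scalar z_i.\<close>

lemma op_power_minus_scalar:
  assumes a: "a \<in> M"
  shows "op_power T \<alpha> a - mi_power z \<alpha> *\<^sub>C a \<in> shifted_range z"
proof (induction "mi_size \<alpha>" arbitrary: \<alpha>)
  case 0
  then have "\<alpha> = (\<lambda>_. 0)" using mi_size_0_iff by metis
  then show ?case
    using complex_vector.subspace_0[OF subspace_shifted_range] by (simp add: op_power_0 mi_power_0 scaleC_one)
next
  case (Suc k)
  from Suc.hyps(2)[symmetric] obtain \<beta> i where \<beta>: "mi_size \<beta> = k" "\<alpha> = mi_inc \<beta> i"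
    by (rule mi_size_SucE)
  let ?y = "op_power T \<beta> a"
  have "T i ?y - (z $ i) *\<^sub>C ?y \<in> shifted_range z"
    unfolding shifted_range_def
    using tuple_range_member[where X = "\<lambda>i x. T i x - (z $ i) *\<^sub>C x", OF shifted_bounded
        closed_csubspaceD(2)[OF closed_csubspace_L] op_power_T_M[OF a]] .
  moreover have "(z $ i) *\<^sub>C (?y - mi_power z \<beta> *\<^sub>C a) \<in> shifted_range z"
    using Suc.hyps(1) \<beta>(1) by (intro complex_vector.subspace_scale[OF subspace_shifted_range]) blast
  ultimately have "(T i ?y - (z $ i) *\<^sub>C ?y) + (z $ i) *\<^sub>C (?y - mi_power z \<beta> *\<^sub>C a) \<in> shifted_range z"
    by (rule complex_vector.subspace_add[OF subspace_shifted_range])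
  moreover have "(T i ?y - (z $ i) *\<^sub>C ?y) + (z $ i) *\<^sub>C (?y - mi_power z \<beta> *\<^sub>C a)
      = op_power T \<alpha> a - mi_power z \<alpha> *\<^sub>C a"
    by (simp add: \<beta>(2) op_power_inc[OF comm_T] op_power_commute[OF comm_T] mi_power_inc
        complex_vector.scale_right_diff_distrib scaleC_scaleC)
  ultimately show ?case by simp
qed

lemma regular_shifted_range:
  assumes "regular M Mc"
  obtains \<epsilon> where "\<epsilon> > 0"
    "\<And>z. norm z < \<epsilon> \<Longrightarrow> closed (shifted_range z) \<and> shifted_range z \<inter> N = {0}"
proof -
  have cong: "tuple_range M X = tuple_range M Y" if "\<And>i x. x \<in> M \<Longrightarrow> X i x = Y i x"
    for X Y :: "'n \<Rightarrow> 'a \<Rightarrow> 'a"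
    unfolding tuple_range_def using that by (intro Collect_cong ex_cong1) auto
  have "tuple_range M Mc = tuple_range M T"
    "tuple_range M (\<lambda>i x. Mc i x - (z $ i) *\<^sub>C x) = shifted_range z" for z
    unfolding shifted_range_def by (rule cong, simp add: compression_M)+
  then show ?thesis using assms that unfolding regular_def Let_def by auto
qed

text \<open>Regularity turns \<open>\<Sum> T\<^sup>\<alpha> c\<^sub>\<alpha> = 0\<close> into the vanishing of the power series \<open>\<Sum> z\<^sup>\<alpha> c\<^sub>\<alpha>\<close>
  near the origin: its value at \<open>z\<close> lies both in the range of \<open>T - z\<close> and in its complement \<open>\<N>\<close>.\<close>

lemma regular_imp_injective:
  fixes c :: "('n \<Rightarrow> nat) \<Rightarrow> 'a"
  assumes reg: "regular M Mc" and cN: "\<And>\<alpha>. c \<alpha> \<in> N"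
    and bound: "\<And>\<alpha>. norm (c \<alpha>) \<le> C * mi_gamma \<alpha>"
    and lim: "partial_sum c \<longlonglongrightarrow> 0"
  shows "c \<alpha> = 0"
proof -
  obtain \<epsilon> where \<epsilon>: "\<epsilon> > 0"
    "\<And>z. norm z < \<epsilon> \<Longrightarrow> closed (shifted_range z) \<and> shifted_range z \<inter> N = {0}"
    using regular_shifted_range[OF reg] by blast
  define Q where "Q z j = (\<Sum>\<alpha> | mi_size \<alpha> = j. mi_power z \<alpha> *\<^sub>C c \<alpha>)" for z j
  have sums0: "Q z sums 0" if z: "norm z < \<epsilon>" "(\<Sum>i\<in>UNIV. cmod (z $ i)) < 1" for z
  proof -
    define \<rho> where "\<rho> = (\<Sum>i\<in>UNIV. cmod (z $ i))"
    have Q_le: "norm (Q z j) \<le> C * \<rho> ^ j" for j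
    proof -
      have "norm (Q z j) \<le> (\<Sum>\<alpha> | mi_size \<alpha> = j. cmod (mi_power z \<alpha>) * (C * mi_gamma \<alpha>))"
        unfolding Q_def by (intro sum_norm_le) (auto simp: norm_scaleC intro!: mult_left_mono bound)
      also have "\<dots> = C * (\<Sum>\<alpha> | mi_size \<alpha> = j. mi_gamma \<alpha> * cmod (mi_power z \<alpha>))"
        by (simp add: sum_distrib_left mult_ac)
      finally show ?thesis by (simp add: sum_mi_gamma_cmod_power \<rho>_def)
    qed
    have "summable (\<lambda>j. C * \<rho> ^ j)"
      using z(2) by (intro summable_mult summable_geometric) (auto simp: \<rho>_def sum_nonneg)
    then have "summable (Q z)" by (rule summable_comparison_test'[where N = 0]) (rule Q_le)
    then have f: "Q z sums suminf (Q z)" by (rule summable_sums)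
    let ?p = "\<lambda>k. \<Sum>\<alpha> | mi_size \<alpha> < k. mi_power z \<alpha> *\<^sub>C c \<alpha>"
    have p: "?p \<longlonglongrightarrow> suminf (Q z)"
      using f by (simp add: sums_def Q_def sum_mi_size_group)
    have "?p k \<in> N" for k
      by (intro closed_csubspace_sum closed_csubspace_N closed_csubspaceD(5)[OF closed_csubspace_N] cN)
    then have fN: "suminf (Q z) \<in> N"
      using closed_sequentially[OF closed_csubspaceD(1)[OF closed_csubspace_N] _ p] by blast
    \<comment> \<open>As \<open>partial_sum c\<close> tends to 0, the value of the series at
      \<open>z\<close> is, up to sign, a limit of elements of the shifted range, which is
      closed.\<close>
    have mem: "partial_sum c k - ?p k \<in> shifted_range z" for k
      unfolding partial_sum_def sum_subtractf[symmetric]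
      by (intro complex_vector.subspace_sum[OF subspace_shifted_range] op_power_minus_scalar N_subset_M cN)
    have "0 - suminf (Q z) \<in> shifted_range z"
      by (rule closed_sequentially[OF conjunct1[OF \<epsilon>(2)[OF z(1)]] mem tendsto_diff[OF lim p]])
    then have "suminf (Q z) \<in> shifted_range z"
      using complex_vector.subspace_neg[OF subspace_shifted_range] by fastforce
    then have "suminf (Q z) = 0" using fN \<epsilon>(2)[OF z(1)] by blast
    then show ?thesis using f by simp
  qed
  have scale: "Q (t *\<^sub>R z) j = t ^ j *\<^sub>R Q z j" for t z j
  proof -
    have "mi_power (t *\<^sub>R z) \<alpha> *\<^sub>C c \<alpha> = t ^ mi_size \<alpha> *\<^sub>R (mi_power z \<alpha> *\<^sub>C c \<alpha>)" for \<alpha>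
      by (simp only: mi_power_scaleR scaleC_scaleC[symmetric] scaleC_of_real)
    then show ?thesis by (simp add: Q_def scaleR_sum_right)
  qed
  have Q0: "Q z j = 0" for z j
  proof -
    define \<rho> where "\<rho> = (\<Sum>i\<in>UNIV. cmod (z $ i))"
    \<comment> \<open>Both conditions of \<open>sums0\<close> then hold along the whole segment from
      \<open>-r\<close> to \<open>r\<close>; the added 1 keeps the denominators positive and the
      estimates strict.\<close>
    define r where "r = min (\<epsilon> / (norm z + 1)) (1 / (\<rho> + 1))"
    have \<rho>0: "\<rho> \<ge> 0" by (simp add: \<rho>_def sum_nonneg)
    have r0: "r > 0" using \<epsilon>(1) \<rho>0 by (simp add: r_def add_nonneg_pos)
    have "Q (r *\<^sub>R z) j = 0"
    proof (rule powser_sums_zero_coeffs_zero[where q = "Q (r *\<^sub>R z)"])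
      fix t :: real assume t: "\<bar>t\<bar> < 1"
      have tr: "\<bar>t * r\<bar> \<le> r" using t r0 by (simp add: abs_mult mult_left_le_one_le)
      have "norm ((t * r) *\<^sub>R z) \<le> r * norm z" using tr by (simp add: mult_right_mono)
      also have "\<dots> < r * (norm z + 1)" using r0 by simp
      also have "\<dots> \<le> \<epsilon>" by (simp add: r_def pos_le_divide_eq[symmetric] add_nonneg_pos)
      finally have 1: "norm ((t * r) *\<^sub>R z) < \<epsilon>" .
      have "(\<Sum>i\<in>UNIV. cmod (((t * r) *\<^sub>R z) $ i)) = \<bar>t * r\<bar> * \<rho>"
        by (simp add: \<rho>_def sum_distrib_left)
      also have "\<dots> \<le> r * \<rho>" using tr \<rho>0 by (rule mult_right_mono)
      also have "\<dots> < r * (\<rho> + 1)" using r0 by simp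
      also have "\<dots> \<le> 1" using \<rho>0 by (simp add: r_def pos_le_divide_eq[symmetric] add_nonneg_pos)
      finally have "Q ((t * r) *\<^sub>R z) sums 0" by (intro sums0 1)
      then show "(\<lambda>j. t ^ j *\<^sub>R Q (r *\<^sub>R z) j) sums 0" by (simp flip: scale)
    qed
    then show ?thesis using r0 by (simp add: scale)
  qed
  show ?thesis
    by (rule mi_poly_coeffs_zero[of "{\<beta>. mi_size \<beta> = mi_size \<alpha>}" c \<alpha>])
      (use Q0 in \<open>auto simp: Q_def finite_mi_size\<close>)
qed

lemma regular_imp_Drury_Arveson_shift:
  assumes reg: "regular M Mc"
  shows "Drury_Arveson_shift M Mc"
proof -
  have U_add: "U (x + y) \<alpha> = U x \<alpha> + U y \<alpha>" for x y \<alpha>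
    by (simp add: U_def linear_add[OF op_power_B_linear] proj_add[OF closed_csubspace_N] scaleR_add_right)
  have U_scale: "U (c *\<^sub>C x) \<alpha> = c *\<^sub>C U x \<alpha>" for c x \<alpha>
    by (simp add: U_def bounded_clinear_scaleC[OF op_power_B] proj_scaleC[OF closed_csubspace_N] scaleC_scaleR)
  \<comment> \<open>A vector has only one such expansion with coefficients in N. This yields the
    surjectivity of \<open>U\<close> and also, without computing \<open>U (T i x)\<close>, the
    intertwining relation.\<close>
  have diff_zero: "a = b"
    if ab: "\<And>\<alpha>. a \<alpha> \<in> N" "\<And>\<alpha>. b \<alpha> \<in> N" "\<And>\<alpha>. norm (a \<alpha>) \<le> Ca * mi_gamma \<alpha>" "\<And>\<alpha>. norm (b \<alpha>) \<le> Cb * mi_gamma \<alpha>"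
      and lim: "partial_sum a \<longlonglongrightarrow> x" "partial_sum b \<longlonglongrightarrow> x" for a b :: "('n \<Rightarrow> nat) \<Rightarrow> 'a" and Ca Cb x
  proof
    fix \<alpha>
    have "a \<alpha> - b \<alpha> = 0"
    proof (rule regular_imp_injective[OF reg, where c = "\<lambda>\<alpha>. a \<alpha> - b \<alpha>" and C = "Ca + Cb"])
      show "a \<alpha> - b \<alpha> \<in> N" for \<alpha> by (intro closed_csubspaceD(4)[OF closed_csubspace_N] ab)
      show "norm (a \<alpha> - b \<alpha>) \<le> (Ca + Cb) * mi_gamma \<alpha>" for \<alpha>
        using norm_triangle_ineq4[of "a \<alpha>" "b \<alpha>"] ab(3,4)[of \<alpha>] by (simp add: distrib_right)
      have "partial_sum (\<lambda>\<alpha>. a \<alpha> - b \<alpha>) k = partial_sum a k - partial_sum b k" for k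
        by (simp add: partial_sum_def linear_diff[OF op_power_T_linear] sum_subtractf)
      then have "partial_sum (\<lambda>\<alpha>. a \<alpha> - b \<alpha>) = (\<lambda>k. partial_sum a k - partial_sum b k)" by (rule ext)
      then show "partial_sum (\<lambda>\<alpha>. a \<alpha> - b \<alpha>) \<longlonglongrightarrow> 0"
        using tendsto_diff[OF lim] by simp
    qed
    then show "a \<alpha> = b \<alpha>" by simp
  qed
  have bij: "bij_betw U M (DA_space N)"
    unfolding bij_betw_def
  proof
    show "inj_on U M"
    proof (rule inj_onI)
      fix x y assume "x \<in> M" "y \<in> M" "U x = U y"
      then have "partial_sum (U x) \<longlonglongrightarrow> x" "partial_sum (U x) \<longlonglongrightarrow> y"
        using partial_sum_U_tendsto[of x] partial_sum_U_tendsto[of y] by simp_all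
      then show "x = y" by (rule LIMSEQ_unique)
    qed
    show "U ` M = DA_space N"
    proof
      show "U ` M \<subseteq> DA_space N" using U_in_DA by blast
      show "DA_space N \<subseteq> U ` M"
      proof
        fix a :: "('n \<Rightarrow> nat) \<Rightarrow> 'a" assume a: "a \<in> DA_space N"
        obtain x where x: "x \<in> M" "partial_sum a \<longlonglongrightarrow> x" using partial_sum_convergent[OF a] .
        obtain Ca where Ca: "\<And>\<alpha>. norm (a \<alpha>) \<le> Ca * mi_gamma \<alpha>" using DA_space_bound[OF a] by blast
        obtain Cb where Cb: "\<And>\<alpha>. norm (U x \<alpha>) \<le> Cb * mi_gamma \<alpha>" using DA_space_bound[OF U_in_DA[OF x(1)]] by blast
        have aN: "a \<alpha> \<in> N" for \<alpha> using a by (auto simp: DA_space_def)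
        have "a = U x" by (rule diff_zero[OF aN U_in_N Ca Cb x(2) partial_sum_U_tendsto[OF x(1)]])
        then show "a \<in> U ` M" using x(1) by blast
      qed
    qed
  qed
  have shift: "U (T i x) = DA_mult i (U x)" if x: "x \<in> M" for i x
  proof -
    obtain Ca where Ca: "\<And>\<alpha>. norm (U (T i x) \<alpha>) \<le> Ca * mi_gamma \<alpha>"
      using DA_space_bound[OF U_in_DA[OF T_L_same[OF x]]] by blast
    obtain Cb where Cb: "Cb \<ge> 0" "\<And>\<alpha>. norm (U x \<alpha>) \<le> Cb * mi_gamma \<alpha>" using DA_space_bound[OF U_in_DA[OF x]] by blast
    have Cb': "norm (DA_mult i (U x) \<alpha>) \<le> Cb * mi_gamma \<alpha>" for \<alpha>
    proof (cases "\<alpha> i = 0")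
      case True
      then show ?thesis using Cb(1) less_imp_le[OF mi_gamma_pos[of \<alpha>]] by (simp add: DA_mult_eq)
    next
      case False
      have "norm (U x (mi_dec \<alpha> i)) \<le> Cb * mi_gamma (mi_dec \<alpha> i)" by (rule Cb)
      also have "\<dots> \<le> Cb * mi_gamma \<alpha>" using False by (intro mult_left_mono mi_gamma_dec_le Cb(1)) simp
      finally show ?thesis using False by (simp add: DA_mult_eq)
    qed
    have inN: "DA_mult i (U x) \<alpha> \<in> N" for \<alpha>
      using U_in_N closed_csubspaceD(2)[OF closed_csubspace_N] by (simp add: DA_mult_eq)
    \<comment> \<open>Multiplication by a coordinate raises the degree by one, hence
      \<open>Suc k\<close> against \<open>k\<close>.\<close>
    have "partial_sum (DA_mult i (U x)) (Suc k) = T i (partial_sum (U x) k)" for k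
    proof -
      have "partial_sum (DA_mult i (U x)) (Suc k)
          = (\<Sum>\<alpha> | mi_size \<alpha> < Suc k \<and> \<alpha> i > 0. op_power T \<alpha> (U x (mi_dec \<alpha> i)))"
        unfolding partial_sum_def
        by (rule sum.mono_neutral_cong_right)
          (auto simp: finite_mi_size_less DA_mult_eq linear_0[OF op_power_T_linear])
      also have "\<dots> = (\<Sum>\<alpha> | mi_size \<alpha> < k. T i (op_power T \<alpha> (U x \<alpha>)))"
        by (rule sum.reindex_bij_witness[where i = "\<lambda>\<alpha>. mi_inc \<alpha> i" and j = "\<lambda>\<alpha>. mi_dec \<alpha> i"])
          (auto simp: mi_inc_dec mi_dec_inc mi_inc_pos op_power_commute[OF comm_T] dest: mi_size_dec
            simp flip: op_power_inc[OF comm_T])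
      finally show ?thesis by (simp add: partial_sum_def linear_sum[OF T_linear])
    qed
    moreover have "(\<lambda>k. T i (partial_sum (U x) k)) \<longlonglongrightarrow> T i x"
      by (rule bounded_linear.tendsto[OF bounded_clinear_bounded_linear[OF T] partial_sum_U_tendsto[OF x]])
    ultimately have "(\<lambda>k. partial_sum (DA_mult i (U x)) (Suc k)) \<longlonglongrightarrow> T i x" by simp
    then have "partial_sum (DA_mult i (U x)) \<longlonglongrightarrow> T i x" by (simp add: filterlim_sequentially_Suc)
    then show ?thesis
      by (rule diff_zero[OF U_in_N inN Ca Cb' partial_sum_U_tendsto[OF T_L_same[OF x]]])
  qed
  show ?thesis
    unfolding Drury_Arveson_shift_def
    using closed_csubspace_N bij DA_cinner_U shift
    by (intro exI[of _ N] exI[of _ U]) (auto simp: fun_eq_iff U_add U_scale compression_M)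
qed

end

theorem theorem3p6:
  fixes T :: "'n::{finite,linorder} \<Rightarrow> 'a::complex_hilbert \<Rightarrow> 'a" and m :: nat
  assumes "commuting_row_contraction UNIV T"
    and "polynomial_of_degree (defect_space T) (defect_space_star T) (char_fun T) m"
  shows
    "let \<M> = shift_part T m;
         \<H>nil = nil_part T m;
         \<H>c = coisometric_part T;
         M = compression \<M> T;
         N = compression \<H>nil T;
         W = compression \<H>c T;
         \<N> = \<M> \<ominus> tuple_range \<M> T
     in orthogonal_direct_sum3 UNIV \<M> \<H>nil \<H>c \<and>
        (\<forall>i. \<forall>x\<in>\<M>. proj \<H>nil (T i x) = 0 \<and> proj \<H>c (T i x) = 0) \<and>
        (\<forall>i. \<forall>x\<in>\<H>nil. proj \<H>c (T i x) = 0) \<and>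
        commuting_row_contraction \<M> M \<and> pure \<M> M \<and>
        commuting_tuple \<H>nil N \<and> nilpotent_le \<H>nil N m \<and>
        commuting_tuple \<H>c W \<and> spherical_coisometry \<H>c W \<and>
        (\<forall>x\<in>\<M>. row_square \<M> M x = x - proj \<N> x) \<and>
        (regular \<M> M \<longrightarrow> Drury_Arveson_shift \<M> M)"
proof -
  interpret poly_row_contraction T m
    using assms by unfold_locales
  have nil: "nil_part T m = shift_part T 0 \<ominus> shift_part T m"
    by (simp add: nil_part_def shift_part_def)
  have sub: "shift_part T m \<subseteq> shift_part T 0" by (rule L_antimono) simp
  have square: "row_square M Mc x = x - proj N x" if "x \<in> M" for x
    using row_square_B[OF that] by (simp add: row_square_def adjoint_Mc compression_M B_in_M)
  show ?thesis
    unfolding Let_def nil coisometric_part_eq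
  proof (intro conjI allI ballI impI)
    show "orthogonal_direct_sum3 UNIV M Hnil Hc"
      by (rule orthogonal_direct_sum3_ominus[OF closed_csubspace_L closed_csubspace_L sub])
    show "proj Hc (T i x) = 0" if "x \<in> M" for i x using that sub by (intro triangular(2)) blast
    show "proj Hc (T i x) = 0" if "x \<in> Hnil" for i x using that by (intro triangular(2)) (simp add: mem_ominus)
  qed (rule triangular(1) commuting_row_contraction_Mc pure_Mc nil_properties coisometric_properties square
      regular_imp_Drury_Arveson_shift; assumption?)+
qed

end
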